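(* Let $X$ be a planar polynomial vector field free of characteristic orbits near the infinity and suppose that the upper boundary of its Newton polytope is just one segment, that is, $\mathcal{P}^{U}=\gamma$. Suppose also that the origin is the only singularity of the upper principal part $X_{\Delta}^{U}$. If $X_{\Delta}^{U}$ is free of periodic orbits near the infinity, then $X$ is also free of periodic orbits near the infinity.
   Context: **Newton polytope.** Every planar polynomial vector field is written uniquely as a finite sum $X(x,y)=\sum_{m,n} x^{m}y^{n}\big(a_{m,n}x\frac{\partial}{\partial x}+b_{m,n}y\frac{\partial}{\partial y}\big)$ with $m,n\in\mathbb{Z}$, $a_{m,n},b_{m,n}\in\mathbb{R}$, where $a_{m,n}=0$ if $m<-1$ or $n\le -1$, and $b_{m,n}=0$ if $m\le -1$ or $n<-1$. The support is $\mathcal{S}=\{(m,n)\in\mathbb{Z}^2: a_{m,n}^2+b_{m,n}^2\neq 0\}$ and the Newton polytope $\mathcal{P}$ is the convex hull of $\mathcal{S}$. Let $\mathcal{P}_+$ be the convex hull of $\mathcal{S}+(\mathbb{R}_{\ge 0})^2$. If $\mathcal{P}$ has non-empty interior, the upper boundary $\mathcal{P}^U$ is the closure of $\partial\mathcal{P}\setminus\partial\mathcal{P}_+$; if $\mathcal{P}$ has empty interior, $\mathcal{P}^U=\mathcal{P}$. The upper principal part of $X$ is $X_{\Delta}^{U}(x,y)=\sum_{(m,n)\in\mathcal{P}^U}x^my^n\big(a_{m,n}x\frac{\partial}{\partial x}+b_{m,n}y\frac{\partial}{\partial y}\big)$. "Singularity" means zero of the vector field. **Poincaré--Lyapunov compactification.**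 Fix a weight vector $(\alpha,\beta)$ of positive integers. Let $\operatorname{Cs}\theta,\operatorname{Sn}\theta$ be the solutions of $\frac{d}{d\theta}\operatorname{Cs}\theta=-\operatorname{Sn}^{2\alpha-1}\theta$, $\frac{d}{d\theta}\operatorname{Sn}\theta=\operatorname{Cs}^{2\beta-1}\theta$, $\operatorname{Cs}0=1$, $\operatorname{Sn}0=0$; they are analytic and periodic with a common period $T$. The Poincaré--Lyapunov disk $\mathbb{D}_{(\alpha,\beta)}$ is the closed disk obtained by adding to $\mathbb{R}^2$ a boundary circle $\{r=0\}$ (the infinity) through the coordinates $x=\operatorname{Cs}\theta/r^{\alpha}$, $y=\operatorname{Sn}\theta/r^{\beta}$, $\theta\in\mathbb{R}/T\mathbb{Z}$, $r\ge 0$. The compactification $\overline{X}$ is the analytic vector field near the boundary obtained by writing $X$ in the coordinates $(\theta,r)$ and multiplying by $r^{D}$, where $D=\max\{\alpha m+\beta n:(m,n)\in\mathcal{S}\}$, so that it extends analytically to $r=0$; in the interior it has the same oriented orbits as $X$. **Characteristic orbits.** A characteristic orbit of a singularity is a non-constant orbit tending to the singularity in forward or backward time with a well-defined limiting tangent direction. A planar vector field $Y$ is free of characteristic orbits near the infinity if, for its compactification $\overline{Y}$, there is no singularity in the boundary of $\mathbb{D}_{(\alpha,\beta)}$ having a characteristic orbit intersecting the interior of $\mathbb{D}_{(\alpha,\beta)}$. **Periodic orbits.** A planar vector field $Y$ is free of periodic orbits near the infinity if there is a neighbourhood $W$ of the boundary of $\mathbb{D}_{(\alpha,\beta)}$ such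 that the compactification $\overline{Y}$ does not have periodic orbits contained in $W$ other than, possibly, the boundary circle itself. *)

theory Defs
  imports "HOL-Analysis.Analysis"
begin

subsection \<open>Planar polynomial vector fields and the Newton polytope\<close>

text \<open>A planar polynomial vector field is given by its coefficients: \<open>X (m, n) = (a, b)\<close> stands
  for the term \<open>x^m y^n (a x \<partial>/\<partial>x + b y \<partial>/\<partial>y)\<close>, so exponents can be \<open>-1\<close>.\<close>

type_synonym vf_coeffs = "int \<times> int \<Rightarrow> real \<times> real"

definition supp :: "vf_coeffs \<Rightarrow> (int \<times> int) set" where
  "supp X = {p. (fst (X p))\<^sup>2 + (snd (X p))\<^sup>2 \<noteq> 0}"

definition polynomial_vf :: "vf_coeffs \<Rightarrow> bool" where
  "polynomial_vf X \<longleftrightarrow> finite (supp X) \<and>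
     (\<forall>m n. (m < -1 \<or> n \<le> -1) \<longrightarrow> fst (X (m, n)) = 0) \<and>
     (\<forall>m n. (m \<le> -1 \<or> n < -1) \<longrightarrow> snd (X (m, n)) = 0)"

text \<open>Under \<^const>\<open>polynomial_vf\<close>, every \<^const>\<open>nat\<close> below is applied to a nonnegative integer or
  the term has coefficient 0.\<close>

definition vf :: "vf_coeffs \<Rightarrow> real \<times> real \<Rightarrow> real \<times> real" where
  "vf X = (\<lambda>(x, y). \<Sum>(m, n)\<in>supp X.
     (fst (X (m, n)) * x ^ nat (m + 1) * y ^ nat n,
      snd (X (m, n)) * x ^ nat m * y ^ nat (n + 1)))"

definition real_pt :: "int \<times> int \<Rightarrow> real \<times> real" where
  "real_pt = (\<lambda>(m, n). (real_of_int m, real_of_int n))"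

definition newton_polytope :: "vf_coeffs \<Rightarrow> (real \<times> real) set" where
  "newton_polytope X = convex hull (real_pt ` supp X)"

definition newton_polytope_plus :: "vf_coeffs \<Rightarrow> (real \<times> real) set" where
  "newton_polytope_plus X =
     convex hull {real_pt p + (u, v) | p u v. p \<in> supp X \<and> 0 \<le> u \<and> 0 \<le> v}"

definition upper_boundary :: "vf_coeffs \<Rightarrow> (real \<times> real) set" where
  "upper_boundary X =
     (if interior (newton_polytope X) \<noteq> {}
      then closure (frontier (newton_polytope X) - frontier (newton_polytope_plus X))
      else newton_polytope X)"

definition upper_principal_part :: "vf_coeffs \<Rightarrow> vf_coeffs" where
  "upper_principal_part X = (\<lambda>p. if real_pt p \<in> upper_boundary X then X p else (0, 0))"

subsection \<open>Poincare--Lyapunov compactification\<close>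

definition common_period :: "(real \<Rightarrow> real) \<Rightarrow> (real \<Rightarrow> real) \<Rightarrow> real \<Rightarrow> bool" where
  "common_period f g T \<longleftrightarrow> 0 < T \<and> (\<forall>t. f (t + T) = f t \<and> g (t + T) = g t)"

text \<open>Generalised cosine and sine; \<open>T\<close> is the least common period, so that \<open>(\<theta>, r)\<close> with \<open>\<theta>\<close> modulo \<open>T\<close> are genuine
  coordinates.\<close>

definition pl_trig ::
  "nat \<Rightarrow> nat \<Rightarrow> (real \<Rightarrow> real) \<Rightarrow> (real \<Rightarrow> real) \<Rightarrow> real \<Rightarrow> bool" where
  "pl_trig \<alpha> \<beta> Cs Sn T \<longleftrightarrow>
     (\<forall>\<theta>. (Cs has_real_derivative - (Sn \<theta> ^ (2 * \<alpha> - 1))) (at \<theta>)) \<and>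
     (\<forall>\<theta>. (Sn has_real_derivative Cs \<theta> ^ (2 * \<beta> - 1)) (at \<theta>)) \<and>
     Cs 0 = 1 \<and> Sn 0 = 0 \<and>
     common_period Cs Sn T \<and> (\<forall>T'. common_period Cs Sn T' \<longrightarrow> T \<le> T')"

lemma pl_trig_1_1: "pl_trig 1 1 cos sin (2 * pi)"
proof -
  have "2 * pi \<le> T'" if "common_period cos sin T'" for T'
  proof -
    have "T' > 0" "cos (0 + T') = cos 0"
      using that unfolding common_period_def by blast+
    then have "cos T' = 1" by simp
    then consider k :: nat where "T' = real k * 2 * pi" | k :: nat where "T' = - (real k * 2 * pi)"
      using cos_one_2pi[of T'] by blast
    then obtain k :: nat where "T' = real k * 2 * pi"
    proof cases
      case (2 k)
      have "0 \<le> real k * 2 * pi" by simp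
      with 2 \<open>T' > 0\<close> show ?thesis by linarith
    qed blast
    then show ?thesis using \<open>T' > 0\<close> by (cases k) (auto simp: algebra_simps)
  qed
  then show ?thesis
    by (auto simp: pl_trig_def common_period_def intro!: derivative_eq_intros)
qed

definition pl_chart ::
  "nat \<Rightarrow> nat \<Rightarrow> (real \<Rightarrow> real) \<Rightarrow> (real \<Rightarrow> real) \<Rightarrow> real \<times> real \<Rightarrow> real \<times> real" where
  "pl_chart \<alpha> \<beta> Cs Sn = (\<lambda>(\<theta>, r). (Cs \<theta> / r ^ \<alpha>, Sn \<theta> / r ^ \<beta>))"

definition weight_degree :: "nat \<Rightarrow> nat \<Rightarrow> vf_coeffs \<Rightarrow> int" where
  "weight_degree \<alpha> \<beta> X = Max ((\<lambda>(m, n). int \<alpha> * m + int \<beta> * n) ` supp X)"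

text \<open>The compactified field in the coordinates \<open>(\<theta>, r)\<close>, \<open>r \<ge> 0\<close>, in closed form. The lemmas
  \<open>pl_compactification_pushforward\<close> and \<open>continuous_on_pl_compactification\<close> below characterise it:
  for \<open>r > 0\<close> it is \<open>r^D X\<close> written in these coordinates, and it is continuous up to \<open>r = 0\<close>. It
  is defined on the universal cover, \<open>\<theta>\<close> ranging over all reals.\<close>

definition pl_compactification ::
  "nat \<Rightarrow> nat \<Rightarrow> (real \<Rightarrow> real) \<Rightarrow> (real \<Rightarrow> real) \<Rightarrow> vf_coeffs \<Rightarrow>
     real \<times> real \<Rightarrow> real \<times> real" where
  "pl_compactification \<alpha> \<beta> Cs Sn X = (\<lambda>(\<theta>, r). \<Sum>(m, n)\<in>supp X.
     (let a = fst (X (m, n)); b = snd (X (m, n));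
          \<rho> = r ^ nat (weight_degree \<alpha> \<beta> X - (int \<alpha> * m + int \<beta> * n))
      in (\<rho> * ((b - real \<beta> / real \<alpha> * a) * Cs \<theta> ^ nat (m + 1) * Sn \<theta> ^ nat (n + 1)),
          - (r / real \<alpha>) * \<rho> *
            (a * Cs \<theta> ^ nat (m + 2 * int \<beta>) * Sn \<theta> ^ nat n +
             b * Cs \<theta> ^ nat m * Sn \<theta> ^ nat (n + 2 * int \<alpha>)))))"

lemma pl_trig_deriv:
  assumes "pl_trig \<alpha> \<beta> Cs Sn T"
  shows "(Cs has_real_derivative - (Sn \<theta> ^ (2 * \<alpha> - 1))) (at \<theta>)"
    and "(Sn has_real_derivative Cs \<theta> ^ (2 * \<beta> - 1)) (at \<theta>)"
  using assms by (auto simp: pl_trig_def)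

lemma pl_trig_conserved:
  assumes "pl_trig \<alpha> \<beta> Cs Sn T" "\<alpha> > 0" "\<beta> > 0"
  shows "real \<alpha> * Cs \<theta> ^ (2 * \<beta>) + real \<beta> * Sn \<theta> ^ (2 * \<alpha>) = real \<alpha>"
proof -
  let ?H = "\<lambda>t. real \<alpha> * Cs t ^ (2 * \<beta>) + real \<beta> * Sn t ^ (2 * \<alpha>)"
  have "(?H has_real_derivative 0) (at t)" for t
  proof -
    have "(?H has_real_derivative
        real \<alpha> * (real (2 * \<beta>) * Cs t ^ (2 * \<beta> - 1) * - (Sn t ^ (2 * \<alpha> - 1))) +
        real \<beta> * (real (2 * \<alpha>) * Sn t ^ (2 * \<alpha> - 1) * Cs t ^ (2 * \<beta> - 1))) (at t)"
      using DERIV_add[OF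
          DERIV_cmult[OF DERIV_power[OF pl_trig_deriv(1)[OF assms(1), of t], of "2 * \<beta>"],
            of "real \<alpha>"]
          DERIV_cmult[OF DERIV_power[OF pl_trig_deriv(2)[OF assms(1), of t], of "2 * \<alpha>"],
            of "real \<beta>"]]
      by (simp add: mult_ac)
    then show ?thesis by (simp add: algebra_simps)
  qed
  then have "?H \<theta> = ?H 0"
    using DERIV_isconst_all by blast
  also have "\<dots> = real \<alpha>" using assms by (simp add: pl_trig_def)
  finally show ?thesis .
qed

lemma pl_chart_has_derivative:
  assumes "pl_trig \<alpha> \<beta> Cs Sn T" "r > 0" "\<alpha> > 0" "\<beta> > 0"
  shows "(pl_chart \<alpha> \<beta> Cs Sn has_derivative
     (\<lambda>(u, v). (- (Sn \<theta> ^ (2 * \<alpha> - 1)) / r ^ \<alpha> * u - real \<alpha> * Cs \<theta> / r ^ (\<alpha> + 1) * v,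
                Cs \<theta> ^ (2 * \<beta> - 1) / r ^ \<beta> * u - real \<beta> * Sn \<theta> / r ^ (\<beta> + 1) * v)))
     (at (\<theta>, r))"
proof -
  have *: "((\<lambda>p. f (fst p) / snd p ^ k) has_derivative
          (\<lambda>p. f' / r ^ k * fst p - real k * f \<theta> / r ^ (k + 1) * snd p)) (at (\<theta>, r))"
    if f: "(f has_real_derivative f') (at \<theta>)" and "k > 0" for f f' k
  proof -
    have f2: "((\<lambda>p. f (fst p)) has_derivative (\<lambda>p. f' * fst p)) (at (\<theta>, r))"
      by (rule has_derivative_compose[of fst fst "(\<theta>, r)" UNIV f "(*) f'"])
         (use f in \<open>auto intro!: derivative_intros simp: has_field_derivative_def\<close>)
    have g: "((\<lambda>r. inverse (r ^ k)) has_real_derivative - (real k / r ^ (k + 1))) (at r)"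
    proof -
      have "r ^ k \<noteq> 0" using assms(2) by simp
      then have "((\<lambda>r. inverse (r ^ k)) has_real_derivative
          - (inverse (r ^ k) * (real k * r ^ (k - Suc 0)) * inverse (r ^ k))) (at r)"
        by (intro DERIV_inverse' DERIV_pow)
      moreover obtain j where "k = Suc j" using \<open>k > 0\<close> gr0_conv_Suc by blast
      ultimately show ?thesis
        using assms(2) by (auto simp: field_simps elim!: DERIV_cong)
    qed
    have g2: "((\<lambda>p. inverse (snd p ^ k)) has_derivative (\<lambda>p. - (real k / r ^ (k + 1)) * snd p))
        (at (\<theta>, r))"
      by (rule has_derivative_compose[of snd snd "(\<theta>, r)" UNIV "\<lambda>r. inverse (r ^ k)"
            "(*) (- (real k / r ^ (k + 1)))"])
         (use g in \<open>auto intro!: derivative_intros simp: has_field_derivative_def\<close>)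
    show ?thesis
      using has_derivative_mult[OF f2 g2] by (simp add: divide_inverse algebra_simps)
  qed
  have "pl_chart \<alpha> \<beta> Cs Sn = (\<lambda>p. (Cs (fst p) / snd p ^ \<alpha>, Sn (fst p) / snd p ^ \<beta>))"
    by (auto simp: pl_chart_def)
  then show ?thesis
    using has_derivative_Pair[OF *[OF pl_trig_deriv(1)[OF assms(1)] assms(3)]
        *[OF pl_trig_deriv(2)[OF assms(1)] assms(4)]]
    by (simp add: case_prod_unfold)
qed

lemma weight_power_split:
  assumes "(r::real) > 0" "int a * m + int b * n \<le> d" "int M = m + 1" "int N = n"
  shows "r powi d * ((C / r ^ a) ^ M * (S / r ^ b) ^ N) * r ^ a =
         r ^ nat (d - (int a * m + int b * n)) * (C ^ M * S ^ N)"
proof -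
  let ?e = "d - (int a * m + int b * n)"
  have "r powi d = r powi (?e + int (a * M + b * N) - int a)"
    using assms by (simp add: algebra_simps)
  also have "\<dots> = r powi ?e * r ^ (a * M + b * N) / r ^ a"
    using assms(1)
    by (simp add: power_int_add power_int_diff del: of_nat_add of_nat_mult)
  also have "r powi ?e = r ^ nat ?e"
    using assms(2) by (simp add: power_int_def)
  finally show ?thesis
    using assms(1) by (simp add: power_divide power_add power_mult)
qed

lemma pl_compactification_pushforward:
  assumes trig: "pl_trig \<alpha> \<beta> Cs Sn T" and pos: "\<alpha> > 0" "\<beta> > 0"
    and X: "polynomial_vf X" and r: "r > 0"
  shows "frechet_derivative (pl_chart \<alpha> \<beta> Cs Sn) (at (\<theta>, r))
           (pl_compactification \<alpha> \<beta> Cs Sn X (\<theta>, r)) =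
         (r powi weight_degree \<alpha> \<beta> X) *\<^sub>R vf X (pl_chart \<alpha> \<beta> Cs Sn (\<theta>, r))"
proof -
  define C S d where "C = Cs \<theta>" and "S = Sn \<theta>" and "d = weight_degree \<alpha> \<beta> X"
  define L where "L = (\<lambda>(u, v). (- (S ^ (2 * \<alpha> - 1)) / r ^ \<alpha> * u - real \<alpha> * C / r ^ (\<alpha> + 1) * v,
                C ^ (2 * \<beta> - 1) / r ^ \<beta> * u - real \<beta> * S / r ^ (\<beta> + 1) * v))"
  have der: "(pl_chart \<alpha> \<beta> Cs Sn has_derivative L) (at (\<theta>, r))"
    unfolding L_def C_def S_def by (rule pl_chart_has_derivative[OF trig r pos])
  have L: "frechet_derivative (pl_chart \<alpha> \<beta> Cs Sn) (at (\<theta>, r)) = L"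
    using frechet_derivative_at[OF der] by simp
  have lin: "linear L"
    using der has_derivative_linear by blast
  have cons: "C ^ (2 * \<beta>) = 1 - real \<beta> / real \<alpha> * S ^ (2 * \<alpha>)"
    using pl_trig_conserved[OF trig pos, of \<theta>] pos by (simp add: C_def S_def field_simps)
  have fin: "finite (supp X)" using X by (simp add: polynomial_vf_def)
  have C2: "C ^ (2 * \<beta>) = C * C ^ (2 * \<beta> - 1)" and S2: "S ^ (2 * \<alpha>) = S * S ^ (2 * \<alpha> - 1)"
    using pos by (simp_all flip: power_Suc)
  have key: "L (r ^ nat (d - (int \<alpha> * m + int \<beta> * n)) *
           ((b - real \<beta> / real \<alpha> * a) * C ^ nat (m + 1) * S ^ nat (n + 1)),
         - (r / real \<alpha>) * r ^ nat (d - (int \<alpha> * m + int \<beta> * n)) *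
           (a * C ^ nat (m + 2 * int \<beta>) * S ^ nat n + b * C ^ nat m * S ^ nat (n + 2 * int \<alpha>)))
      = (r powi d) *\<^sub>R
         (a * (C / r ^ \<alpha>) ^ nat (m + 1) * (S / r ^ \<beta>) ^ nat n,
          b * (C / r ^ \<alpha>) ^ nat m * (S / r ^ \<beta>) ^ nat (n + 1))"
    (is "L (?R * ?U, - (r / real \<alpha>) * ?R * ?V) = ?rhs")
    if mn: "(m, n) \<in> supp X" and ab: "a = fst (X (m, n))" "b = snd (X (m, n))" for m n a b
  proof -
    have le: "int \<alpha> * m + int \<beta> * n \<le> d"
      unfolding d_def weight_degree_def using mn fin by (intro Max_ge) auto
    have a0: "a = 0 \<or> m \<ge> -1 \<and> n \<ge> 0" and b0: "b = 0 \<or> m \<ge> 0 \<and> n \<ge> -1"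
      using X ab unfolding polynomial_vf_def by force+
    define A where "A = a * C ^ nat (m + 1) * S ^ nat n"
    define B where "B = b * C ^ nat m * S ^ nat (n + 1)"
    have U: "?U = C * B - real \<beta> / real \<alpha> * (S * A)"
    proof -
      have "a * (C ^ nat (m + 1) * S ^ nat (n + 1)) = S * A"
        using a0 by (auto simp: A_def nat_add_distrib)
      moreover have "b * (C ^ nat (m + 1) * S ^ nat (n + 1)) = C * B"
        using b0 by (auto simp: B_def nat_add_distrib)
      ultimately show ?thesis by (simp add: algebra_simps)
    qed
    have V: "?V = C ^ (2 * \<beta> - 1) * A + S ^ (2 * \<alpha> - 1) * B"
    proof -
      have "a * C ^ nat (m + 2 * int \<beta>) * S ^ nat n = C ^ (2 * \<beta> - 1) * A"
      proof (cases "a = 0")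
        case False
        then have "nat (m + 2 * int \<beta>) = (2 * \<beta> - 1) + nat (m + 1)" using a0 pos by linarith
        then show ?thesis by (simp add: A_def power_add)
      qed (simp add: A_def)
      moreover have "b * C ^ nat m * S ^ nat (n + 2 * int \<alpha>) = S ^ (2 * \<alpha> - 1) * B"
      proof (cases "b = 0")
        case False
        then have "nat (n + 2 * int \<alpha>) = (2 * \<alpha> - 1) + nat (n + 1)" using b0 pos by linarith
        then show ?thesis by (simp add: B_def power_add)
      qed (simp add: B_def)
      ultimately show ?thesis by simp
    qed
    have "- (S ^ (2 * \<alpha> - 1)) / r ^ \<alpha> * (?R * ?U) -
            real \<alpha> * C / r ^ (\<alpha> + 1) * (- (r / real \<alpha>) * ?R * ?V) =
          ?R / r ^ \<alpha> * (C * ?V - S ^ (2 * \<alpha> - 1) * ?U)"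
      using r pos by (simp add: field_simps)
    also have "C * ?V - S ^ (2 * \<alpha> - 1) * ?U =
        A * (C ^ (2 * \<beta>) + real \<beta> / real \<alpha> * S ^ (2 * \<alpha>))"
      unfolding U V C2 S2 by (simp add: algebra_simps)
    also have "\<dots> = A" by (simp add: cons)
    also have "?R / r ^ \<alpha> * A =
        r powi d * (a * (C / r ^ \<alpha>) ^ nat (m + 1) * (S / r ^ \<beta>) ^ nat n)"
    proof (cases "a = 0")
      case False
      have "?R / r ^ \<alpha> * A = a * (?R * (C ^ nat (m + 1) * S ^ nat n)) / r ^ \<alpha>"
        by (simp add: A_def)
      also have "?R * (C ^ nat (m + 1) * S ^ nat n) =
          r powi d * ((C / r ^ \<alpha>) ^ nat (m + 1) * (S / r ^ \<beta>) ^ nat n) * r ^ \<alpha>"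
        using weight_power_split[OF r le, of "nat (m + 1)" "nat n" C S] False a0 by (simp add: ac_simps)
      finally show ?thesis using r by simp
    qed (simp add: A_def)
    finally have 1: "- (S ^ (2 * \<alpha> - 1)) / r ^ \<alpha> * (?R * ?U) -
            real \<alpha> * C / r ^ (\<alpha> + 1) * (- (r / real \<alpha>) * ?R * ?V) =
        r powi d * (a * (C / r ^ \<alpha>) ^ nat (m + 1) * (S / r ^ \<beta>) ^ nat n)" .
    have "C ^ (2 * \<beta> - 1) / r ^ \<beta> * (?R * ?U) -
            real \<beta> * S / r ^ (\<beta> + 1) * (- (r / real \<alpha>) * ?R * ?V) =
          ?R / r ^ \<beta> * (C ^ (2 * \<beta> - 1) * ?U + real \<beta> / real \<alpha> * S * ?V)"
      using r pos by (simp add: field_simps)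
    also have "C ^ (2 * \<beta> - 1) * ?U + real \<beta> / real \<alpha> * S * ?V =
        B * (C ^ (2 * \<beta>) + real \<beta> / real \<alpha> * S ^ (2 * \<alpha>))"
      unfolding U V C2 S2 by (simp add: algebra_simps)
    also have "\<dots> = B" by (simp add: cons)
    also have "?R / r ^ \<beta> * B =
        r powi d * (b * (C / r ^ \<alpha>) ^ nat m * (S / r ^ \<beta>) ^ nat (n + 1))"
    proof (cases "b = 0")
      case False
      have le2: "int \<beta> * n + int \<alpha> * m \<le> d" using le by simp
      have "?R / r ^ \<beta> * B = b * (?R * (C ^ nat m * S ^ nat (n + 1))) / r ^ \<beta>"
        by (simp add: B_def)
      also have "?R * (C ^ nat m * S ^ nat (n + 1)) =
          r powi d * ((C / r ^ \<alpha>) ^ nat m * (S / r ^ \<beta>) ^ nat (n + 1)) * r ^ \<beta>"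
        using weight_power_split[OF r le2, of "nat (n + 1)" "nat m" S C] False b0 by (simp add: ac_simps)
      finally show ?thesis using r by simp
    qed (simp add: B_def)
    finally have 2: "C ^ (2 * \<beta> - 1) / r ^ \<beta> * (?R * ?U) -
            real \<beta> * S / r ^ (\<beta> + 1) * (- (r / real \<alpha>) * ?R * ?V) =
        r powi d * (b * (C / r ^ \<alpha>) ^ nat m * (S / r ^ \<beta>) ^ nat (n + 1))" .
    show ?thesis
      unfolding L_def prod.case 1 2 by simp
  qed
  show ?thesis
    unfolding L unfolding pl_compactification_def vf_def pl_chart_def prod.case Let_def
      linear_sum[OF lin] scaleR_sum_right
    using key[unfolded C_def S_def d_def] by (intro sum.cong) auto
qed

lemma continuous_on_pl_compactification:
  assumes "pl_trig \<alpha> \<beta> Cs Sn T"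
  shows "continuous_on UNIV (pl_compactification \<alpha> \<beta> Cs Sn X)"
proof -
  have "continuous_on UNIV Cs" "continuous_on UNIV Sn"
    using pl_trig_deriv[OF assms] DERIV_isCont continuous_at_imp_continuous_on by blast+
  then have C: "continuous_on UNIV (\<lambda>p::real \<times> real. Cs (fst p))"
    and S: "continuous_on UNIV (\<lambda>p::real \<times> real. Sn (fst p))"
    using continuous_on_compose2[OF _ continuous_on_fst[OF continuous_on_id]] by blast+
  show ?thesis
    unfolding pl_compactification_def case_prod_unfold Let_def divide_inverse
    by (intro continuous_on_sum continuous_on_Pair continuous_on_mult continuous_on_add
        continuous_on_minus continuous_on_power continuous_on_const continuous_on_snd
        continuous_on_id C S)
qed

subsection \<open>Orbits near infinity\<close>

text \<open>Curves in the disk near its boundary are represented by their lifts to the half plane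
  \<open>r \<ge> 0\<close> of pairs \<open>(\<theta>, r)\<close>.\<close>

definition solves :: "(real \<times> real \<Rightarrow> real \<times> real) \<Rightarrow> (real \<Rightarrow> real \<times> real) \<Rightarrow> real set \<Rightarrow> bool"
  where "solves F c I \<longleftrightarrow>
     (\<forall>t\<in>I. 0 \<le> snd (c t) \<and> (c has_vector_derivative F (c t)) (at t within I))"

text \<open>A characteristic orbit is given by its end at the singularity, a half orbit: the rest of the
  orbit may leave the chart through the origin of the plane.\<close>

definition characteristic_orbit ::
  "(real \<times> real \<Rightarrow> real \<times> real) \<Rightarrow> real \<times> real \<Rightarrow> (real \<Rightarrow> real \<times> real) \<Rightarrow> real set \<Rightarrow> bool"
  where "characteristic_orbit F p c I \<longleftrightarrow>
     solves F c I \<and> \<not> c constant_on I \<and>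
     (\<exists>E. (I = {0..} \<and> E = at_top \<or> I = {..0} \<and> E = at_bot) \<and>
          (c \<longlongrightarrow> p) E \<and>
          (\<exists>v. norm v = 1 \<and> ((\<lambda>t. sgn (c t - p)) \<longlongrightarrow> v) E))"

definition free_of_characteristic_orbits ::
  "nat \<Rightarrow> nat \<Rightarrow> (real \<Rightarrow> real) \<Rightarrow> (real \<Rightarrow> real) \<Rightarrow> vf_coeffs \<Rightarrow> bool" where
  "free_of_characteristic_orbits \<alpha> \<beta> Cs Sn X \<longleftrightarrow>
     (let F = pl_compactification \<alpha> \<beta> Cs Sn X in
      \<not> (\<exists>\<theta> c I. F (\<theta>, 0) = 0 \<and> characteristic_orbit F (\<theta>, 0) c I \<and>
                 (\<exists>t\<in>I. 0 < snd (c t))))"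

text \<open>All lifts of the points of a curve, that is, the preimage of its orbit under
  \<open>\<theta> \<mapsto> \<theta> mod T\<close>.\<close>

definition lifted_orbit :: "real \<Rightarrow> (real \<Rightarrow> real \<times> real) \<Rightarrow> (real \<times> real) set" where
  "lifted_orbit T c = {c t + (of_int k * T, 0) | t k. True}"

definition periodic_orbit ::
  "real \<Rightarrow> (real \<times> real \<Rightarrow> real \<times> real) \<Rightarrow> (real \<Rightarrow> real \<times> real) \<Rightarrow> bool" where
  "periodic_orbit T F c \<longleftrightarrow>
     solves F c UNIV \<and> \<not> c constant_on UNIV \<and>
     (\<exists>\<tau>>0. \<forall>t. \<exists>k. c (t + \<tau>) = c t + (of_int k * T, 0))"

definition boundary_circle :: "(real \<times> real) set" where
  "boundary_circle = UNIV \<times> {0}"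

definition boundary_neighbourhood :: "real \<Rightarrow> (real \<times> real) set \<Rightarrow> bool" where
  "boundary_neighbourhood T W \<longleftrightarrow>
     W \<subseteq> UNIV \<times> {0..} \<and>
     (\<forall>\<theta> r. (\<theta> + T, r) \<in> W \<longleftrightarrow> (\<theta>, r) \<in> W) \<and>
     (\<exists>V. openin (top_of_set (UNIV \<times> {0..})) V \<and> boundary_circle \<subseteq> V \<and> V \<subseteq> W)"

definition free_of_periodic_orbits ::
  "nat \<Rightarrow> nat \<Rightarrow> (real \<Rightarrow> real) \<Rightarrow> (real \<Rightarrow> real) \<Rightarrow> real \<Rightarrow> vf_coeffs \<Rightarrow> bool" where
  "free_of_periodic_orbits \<alpha> \<beta> Cs Sn T X \<longleftrightarrow>
     (\<exists>W. boundary_neighbourhood T W \<and>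
        (\<forall>c. periodic_orbit T (pl_compactification \<alpha> \<beta> Cs Sn X) c \<and> lifted_orbit T c \<subseteq> W \<longrightarrow>
             lifted_orbit T c = boundary_circle))"

end

theory Submission
  imports Defs
begin

text \<open>The upper boundary is a segment with a normal \<open>(A, B)\<close> whose entries are positive (if the
  polytope has empty interior, the field equals its principal part). In the polar coordinates
  \<open>x = e\<^sup>A\<^sup>\<sigma> cos \<phi>\<close>, \<open>y = e\<^sup>B\<^sup>\<sigma> sin \<phi>\<close>, and up to a positive factor, the field is
  \<open>\<phi>' = g(\<phi>) + O(e\<^sup>-\<^sup>\<sigma>)\<close>, \<open>\<sigma>' = f(\<phi>) + O(e\<^sup>-\<^sup>\<sigma>)\<close>, and the principal part is the same field without
  the error terms. As the origin is the only singularity of the principal part, \<open>f\<close> and \<open>g\<close> have no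
  common zero.

  If \<open>g\<close> has a zero, there are no periodic orbits with large \<open>\<sigma>\<close>: an orbit that does not wind around
  stays where \<open>g\<close> is small, so \<open>\<sigma>\<close> is monotone on it; an orbit that winds around excludes a change of
  sign of \<open>g\<close>, so it passes a zero \<open>p\<close> of \<open>g\<close> with \<open>g'(p) = 0\<close> and is caught in a cone at \<open>p\<close>. If \<open>g\<close> has no
  zero, let \<open>\<kappa>\<close> be the mean of \<open>f / g\<close> and \<open>h' = f / g - \<kappa>\<close>. For \<open>\<kappa> \<noteq> 0\<close> the function \<open>\<sigma> - h(\<phi>)\<close> is
  strictly monotone along orbits with large \<open>\<sigma>\<close>; for \<open>\<kappa> = 0\<close> the principal part has the periodic orbits
  \<open>\<sigma> = h(\<phi>) + const\<close>, which contradicts its being free of them. Periodic orbits off the boundary do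
  not depend on the weights \<open>(\<alpha>, \<beta>)\<close> of the compactification, so all this transfers to the given disk.\<close>

subsection \<open>Antiderivatives, quasiperiodic functions and barriers\<close>

text \<open>The normal (A, B) is dictated by the segment and in general bears no relation to the
  weights (\<alpha>, \<beta>), so the flow on the boundary circle of the given disk need not show
  \<open>f\<close> and \<open>g\<close>. The transfer therefore passes through the plane: a closed
  orbit near the boundary but off it is a closed planar curve far out, and being far out can be
  compared between the two weightings. The rate 1 in the error terms is a normalisation: finitely
  many support points lie below the line of the segment, and scaling (A, B) makes their gap at least
  1. The cone at \<open>p\<close> has the width of the error terms. The quantity
  \<open>u = (\<phi> - p) * exp \<sigma>\<close> obeys an equation with the growth term
  \<open>u * f\<close>, an error bounded by a constant, and a contribution of \<open>g\<close> that
  is small against \<open>u\<close> because the derivative of \<open>g\<close> vanishes at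
  \<open>p\<close>; for large \<open>\<bar>u\<bar>\<close> the growth term wins. Only one sign of
  \<open>f p\<close> and of the mean of \<open>f / g\<close> relative to \<open>g\<close> has to be
  treated, as time reversal gives the other.\<close>

lemma ex_antiderivative_real:
  fixes f :: "real \<Rightarrow> real"
  assumes "continuous_on UNIV f"
  shows "\<exists>F. \<forall>x. (F has_real_derivative f x) (at x)"
proof (intro exI allI)
  fix x :: real
  \<comment> \<open>The interval contains 0 and has \<open>x\<close> in its interior, so the
    derivative within it is a derivative at \<open>x\<close>.\<close>
  let ?a = "min 0 x - 1" and ?b = "max 0 x + 1"
  have "((\<lambda>u. LBINT y=0..u. f y) has_vector_derivative f x) (at x within {?a..?b})"
    using interval_integral_FTC2[of ?a 0 ?b f x] continuous_on_subset[OF assms] by (auto simp: zero_ereal_def)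
  moreover have "at x within {?a..?b} = at x"
    by (rule at_within_interior) (auto simp: interior_atLeastAtMost_real)
  ultimately show "((\<lambda>u. LBINT y=0..u. f y) has_real_derivative f x) (at x)"
    by (simp add: has_real_derivative_iff_has_vector_derivative)
qed

lemma DERIV_continuous_on_all:
  fixes f :: "real \<Rightarrow> real"
  assumes "\<And>t. (f has_real_derivative f' t) (at t)"
  shows "continuous_on S f"
  using assms DERIV_isCont continuous_at_imp_continuous_on by blast

text \<open>For an antiderivative \<open>K\<close> of \<open>k\<close>, \<open>W * exp (- K)\<close>
  does not increase and \<open>W * exp K\<close> does not decrease, so the zero at \<open>a\<close>
  propagates forwards and backwards. This yields uniqueness for the trigonometric system and
  invariance of the boundary circle.\<close>

lemma gronwall_zero:
  fixes W W' k :: "real \<Rightarrow> real"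
  assumes W: "\<And>t. (W has_real_derivative W' t) (at t)"
    and nonneg: "\<And>t. 0 \<le> W t" and bound: "\<And>t. \<bar>W' t\<bar> \<le> k t * W t"
    and k: "continuous_on UNIV k" and zero: "W a = 0"
  shows "W t = 0"
proof -
  obtain K where K: "\<And>t. (K has_real_derivative k t) (at t)"
    using ex_antiderivative_real[OF k] by blast
  have "W t \<le> 0"
  proof (cases "a \<le> t")
    case True
    have "W t * exp (- K t) \<le> W a * exp (- K a)"
    proof (rule DERIV_nonpos_imp_nonincreasing[OF True])
      fix s
      have "((\<lambda>s. W s * exp (- K s)) has_real_derivative (W' s - k s * W s) * exp (- K s)) (at s)"
        by (auto intro!: derivative_eq_intros W K simp: algebra_simps)
      moreover have "(W' s - k s * W s) * exp (- K s) \<le> 0"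
        using bound[of s] by (intro mult_nonpos_nonneg) auto
      ultimately show "\<exists>y. ((\<lambda>s. W s * exp (- K s)) has_real_derivative y) (at s) \<and> y \<le> 0"
        by blast
    qed
    then show ?thesis by (simp add: zero mult_le_0_iff)
  next
    case False
    then have "t \<le> a" by simp
    have "W t * exp (K t) \<le> W a * exp (K a)"
    proof (rule DERIV_nonneg_imp_nondecreasing[OF \<open>t \<le> a\<close>])
      fix s
      have "((\<lambda>s. W s * exp (K s)) has_real_derivative (W' s + k s * W s) * exp (K s)) (at s)"
        by (auto intro!: derivative_eq_intros W K simp: algebra_simps)
      moreover have "0 \<le> (W' s + k s * W s) * exp (K s)"
        using bound[of s] by (intro mult_nonneg_nonneg) auto
      ultimately show "\<exists>y. ((\<lambda>s. W s * exp (K s)) has_real_derivative y) (at s) \<and> 0 \<le> y"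
        by blast
    qed
    then show ?thesis by (simp add: zero mult_le_0_iff)
  qed
  then show ?thesis using nonneg[of t] by simp
qed

text \<open>At the last time in \<open>{a..b}\<close> with \<open>L \<le> w\<close> the value would
  be exactly \<open>L\<close>; the positive derivative there produces a later such time.\<close>

lemma upcrossing_barrier:
  fixes w w' :: "real \<Rightarrow> real"
  assumes w: "\<And>t. (w has_real_derivative w' t) (at t)"
    and up: "\<And>t. w t = L \<Longrightarrow> 0 < w' t"
    and ab: "a \<le> b" and "L \<le> w a"
  shows "L \<le> w b"
proof (rule ccontr)
  assume "\<not> L \<le> w b"
  have cont: "continuous_on S w" for S
    using w DERIV_isCont continuous_at_imp_continuous_on by blast
  define S where "S = {t \<in> {a..b}. L \<le> w t}"
  have "compact S"
    unfolding S_def using continuous_closed_preimage[OF cont, of "{a..b}" "{L..}"]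
    by (auto simp: compact_eq_bounded_closed vimage_def Int_def intro: bounded_subset[of "{a..b}"])
  moreover have "a \<in> S" using assms by (simp add: S_def)
  ultimately obtain c where c: "c \<in> S" "\<And>t. t \<in> S \<Longrightarrow> t \<le> c"
    using compact_attains_sup[of S] by blast
  have cb: "a \<le> c" "c < b" "L \<le> w c"
    using c \<open>\<not> L \<le> w b\<close> by (auto simp: S_def order.order_iff_strict)
  obtain x where x: "c \<le> x" "x \<le> b" "w x = L"
    using IVT2'[of w b L c] cb \<open>\<not> L \<le> w b\<close> cont by force
  then have "x \<in> S" using cb by (simp add: S_def)
  then have "x = c" using c x by force
  then have "w c = L" using x by simp
  then obtain d where d: "d > 0" "\<And>h. 0 < h \<Longrightarrow> h < d \<Longrightarrow> w c < w (c + h)"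
    using DERIV_pos_inc_right[OF w up] by blast
  define h where "h = min (d / 2) (b - c)"
  have h: "0 < h" "h < d" "c + h \<le> b" using d cb by (auto simp: h_def)
  then have "c + h \<in> S" using d(2)[of h] \<open>w c = L\<close> cb by (simp add: S_def)
  then show False using c(2)[of "c + h"] h by simp
qed

lemma not_periodic_if_deriv_pos:
  fixes V :: "real \<Rightarrow> real"
  assumes "\<And>t. (V has_real_derivative V' t) (at t)" "\<And>t. 0 < V' t" "0 < \<tau>" "V (a + \<tau>) = V a"
  shows False
  using DERIV_pos_imp_increasing[of a "a + \<tau>" V] assms by force

text \<open>Distinct values are at least \<open>P\<close> apart. Periodic orbits are defined with an
  integer that may depend on the time; this turns it into one winding number.\<close>

lemma int_valued_constant:
  fixes f :: "real \<Rightarrow> real"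
  assumes cont: "continuous_on UNIV f" and P: "0 < P"
    and int: "\<And>t. \<exists>k::int. f t = of_int k * P"
  shows "\<exists>k::int. \<forall>t. f t = of_int k * P"
proof -
  have "f constant_on UNIV"
  proof (rule continuous_discrete_range_constant[OF _ cont])
    fix x :: real
    show "\<exists>e>0. \<forall>y. y \<in> UNIV \<and> f y \<noteq> f x \<longrightarrow> e \<le> norm (f y - f x)"
    proof (intro exI[of _ P] conjI allI impI P)
      fix y assume "y \<in> UNIV \<and> f y \<noteq> f x"
      moreover obtain i j where ij: "f y = of_int i * P" "f x = of_int j * P" using int by metis
      ultimately have "i \<noteq> j" by auto
      then have "1 * P \<le> \<bar>of_int (i - j)\<bar> * P"
        using P by (intro mult_right_mono) linarith+
      also have "\<dots> = norm (f y - f x)" using P by (simp add: ij abs_mult flip: left_diff_distrib)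
      finally show "P \<le> norm (f y - f x)" by simp
    qed
  qed auto
  then show ?thesis using int unfolding constant_on_def by (metis UNIV_I)
qed

lemma quasiperiodic_shift:
  fixes q :: "real \<Rightarrow> real"
  assumes q: "\<And>t. q (t + P) = q t + c"
  shows "q (t + of_int n * P) = q t + of_int n * c"
proof -
  have nat: "q (t + of_nat n * P) = q t + of_nat n * c" for n :: nat and t
  proof (induction n)
    case (Suc n)
    have "q (t + of_nat (Suc n) * P) = q ((t + of_nat n * P) + P)" by (simp add: algebra_simps)
    also have "\<dots> = q (t + of_nat n * P) + c" by (rule q)
    finally show ?case by (simp only: Suc.IH) (simp add: algebra_simps)
  qed simp
  show ?thesis
  proof (cases n rule: int_cases2)
    case (nonneg k)
    then show ?thesis using nat[of t k] by simp
  next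
    case (nonpos k)
    then show ?thesis using nat[of "t + of_int n * P" k] by (simp add: algebra_simps)
  qed
qed

lemma periodic_attains_inf:
  fixes q :: "real \<Rightarrow> real"
  assumes cont: "continuous_on UNIV q" and per: "\<And>t. q (t + P) = q t" and P: "0 < P"
  shows "\<exists>a. \<forall>t. q a \<le> q t"
proof -
  have "\<exists>a\<in>{0..P}. \<forall>y\<in>{0..P}. q a \<le> q y"
    by (intro continuous_attains_inf) (use P in \<open>auto intro: continuous_on_subset[OF cont]\<close>)
  then obtain a where "\<forall>y\<in>{0..P}. q a \<le> q y" by blast
  then have a: "q a \<le> q y" if "0 \<le> y" "y \<le> P" for y using that by simp
  have "q a \<le> q t" for t
  proof -
    define n where "n = - \<lfloor>t / P\<rfloor>"
    have "0 \<le> t + of_int n * P" "t + of_int n * P \<le> P"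
      using floor_divide_lower[OF P, of t] floor_divide_upper[OF P, of t]
      by (simp_all add: n_def algebra_simps)
    then have "q a \<le> q (t + of_int n * P)" by (rule a)
    then show ?thesis using quasiperiodic_shift[of q P 0 t n] per by simp
  qed
  then show ?thesis by blast
qed

lemma periodic_attains_sup:
  fixes q :: "real \<Rightarrow> real"
  assumes cont: "continuous_on UNIV q" and per: "\<And>t. q (t + P) = q t" and P: "0 < P"
  shows "\<exists>a. \<forall>t. q t \<le> q a"
  using periodic_attains_inf[of "\<lambda>t. - q t" P] assms by (simp add: continuous_on_minus)

lemma antiderivative_periodic:
  fixes F q :: "real \<Rightarrow> real"
  assumes F: "\<And>x. (F has_real_derivative q x) (at x)" and per: "\<And>x. q (x + P) = q x"
  shows "F (x + P) = F x + (F P - F 0)"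
proof -
  have "((\<lambda>x. F (x + P) - F x) has_real_derivative 0) (at x)" for x
    using DERIV_chain'[of "\<lambda>x. x + P" 1 x UNIV F "q (x + P)"] F per
    by (auto intro!: derivative_eq_intros DERIV_chain2[OF F])
  then have "F (x + P) - F x = F (0 + P) - F 0"
    using DERIV_isconst_all by blast
  then show ?thesis by simp
qed

lemma nonvanishing_sign:
  fixes q :: "real \<Rightarrow> real"
  assumes q: "continuous_on UNIV q" "\<And>x. q x \<noteq> 0"
  shows "(\<forall>x. 0 < q x) \<or> (\<forall>x. q x < 0)"
proof (rule ccontr)
  assume "\<not> ?thesis"
  then obtain a b where "q a \<le> 0" "0 \<le> q b" by (auto simp: not_less)
  moreover have "connected (range q)" using q by (intro connected_continuous_image) auto
  ultimately have "0 \<in> range q" using connectedD_interval[of _ "q a" "q b" 0] by auto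
  then show False using q(2) by force
qed

text \<open>Each shift by \<open>P\<close> adds \<open>c\<close>, so the range is unbounded above
  and below, and it is connected.\<close>

lemma quasiperiodic_surj:
  fixes q :: "real \<Rightarrow> real"
  assumes cont: "continuous_on UNIV q" and q: "\<And>t. q (t + P) = q t + c" and c: "c \<noteq> 0"
  shows "surj q"
proof -
  have above: "\<exists>t. y \<le> q t" for y
  proof -
    have "\<exists>n::int. y \<le> q 0 + of_int n * c"
    proof (cases "0 < c")
      case True
      obtain n :: int where "(y - q 0) / c \<le> of_int n" using ex_le_of_int by blast
      then show ?thesis using True by (intro exI[of _ n]) (simp add: field_simps)
    next
      case False
      obtain n :: int where "(y - q 0) / (- c) \<le> of_int n" using ex_le_of_int by blast
      then show ?thesis using False c by (intro exI[of _ "- n"]) (simp add: field_simps)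
    qed
    then show ?thesis using quasiperiodic_shift[where q = q, OF q, of 0] by metis
  qed
  have below: "\<exists>t. q t \<le> y" for y
  proof -
    \<comment> \<open>The target is reflected at \<open>q 0\<close>: a value above
      \<open>2 * q 0 - y\<close> counts the periods needed to descend from \<open>q 0\<close> below
      \<open>y\<close>.\<close>
    obtain t where t: "2 * q 0 - y \<le> q t" using above by blast
    define n where "n = \<lceil>(q t - q 0) / \<bar>c\<bar>\<rceil>"
    have "(q t - q 0) / \<bar>c\<bar> \<le> of_int n" by (simp add: n_def)
    then have "q t - q 0 \<le> of_int n * \<bar>c\<bar>" using c by (simp add: field_simps)
    then have "q 0 - of_int n * \<bar>c\<bar> \<le> y" using t by linarith
    moreover have "q (0 + of_int (if 0 < c then - n else n) * P) = q 0 - of_int n * \<bar>c\<bar>"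
      unfolding quasiperiodic_shift[where q = q, OF q] by simp
    ultimately show ?thesis by metis
  qed
  have conn: "connected (range q)" by (intro connected_continuous_image cont) auto
  have "y \<in> range q" for y
    using above[of y] below[of y] connectedD_interval[OF conn, of _ _ y] by blast
  then show ?thesis by blast
qed

subsection \<open>Perturbed fields on the cylinder\<close>

text \<open>One closed orbit on the cylinder, given by functions of time. The positive factor
  \<open>\<nu>\<close> admits every time parametrisation, the errors are recorded only along the
  orbit, \<open>k\<close> counts the turns in one period, and \<open>M\<close> measures how far out
  the orbit lies.\<close>

locale cylinder_orbit =
  fixes f g :: "real \<Rightarrow> real" and K M \<tau> :: real and \<phi> \<sigma> \<nu> e1 e2 :: "real \<Rightarrow> real" and k :: int
  assumes phi_deriv: "\<And>t. (\<phi> has_real_derivative \<nu> t * (g (\<phi> t) + e1 t)) (at t)"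
    and sigma_deriv: "\<And>t. (\<sigma> has_real_derivative \<nu> t * (f (\<phi> t) + e2 t)) (at t)"
    and nu_pos: "\<And>t. 0 < \<nu> t"
    and e1_bound: "\<And>t. \<bar>e1 t\<bar> \<le> K * exp (- \<sigma> t)"
    and e2_bound: "\<And>t. \<bar>e2 t\<bar> \<le> K * exp (- \<sigma> t)"
    and tau_pos: "0 < \<tau>"
    and phi_winds: "\<And>t. \<phi> (t + \<tau>) = \<phi> t + of_int k * (2 * pi)"
    and sigma_periodic: "\<And>t. \<sigma> (t + \<tau>) = \<sigma> t"
    and sigma_ge: "\<And>t. M \<le> \<sigma> t"
begin

lemma K_nonneg: "0 \<le> K"
proof -
  have "0 \<le> K * exp (- \<sigma> 0)" using e1_bound[of 0] by linarith
  then show ?thesis by (simp add: zero_le_mult_iff)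
qed

lemma exp_sigma_le: "K * exp (- \<sigma> t) \<le> K * exp (- M)"
  using sigma_ge[of t] K_nonneg by (intro mult_left_mono) auto

lemma e1_le: "\<bar>e1 t\<bar> \<le> K * exp (- M)" and e2_le: "\<bar>e2 t\<bar> \<le> K * exp (- M)"
  using e1_bound[of t] e2_bound[of t] exp_sigma_le[of t] by linarith+

text \<open>Sign cases such as \<open>f p < 0\<close> or \<open>\<kappa> * g < 0\<close> reduce to
  the opposite ones by running time backwards.\<close>

lemma reversed:
  "cylinder_orbit (\<lambda>x. - f x) (\<lambda>x. - g x) K M \<tau>
     (\<lambda>t. \<phi> (- t)) (\<lambda>t. \<sigma> (- t)) (\<lambda>t. \<nu> (- t)) (\<lambda>t. - e1 (- t)) (\<lambda>t. - e2 (- t)) (- k)"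
proof
  fix t
  show "((\<lambda>t. \<phi> (- t)) has_real_derivative \<nu> (- t) * (- g (\<phi> (- t)) + - e1 (- t))) (at t)"
    by (rule DERIV_cong[OF DERIV_chain2[where f = \<phi> and g = uminus, OF phi_deriv[of "- t"]]])
      (auto intro!: derivative_eq_intros simp: algebra_simps)
  show "((\<lambda>t. \<sigma> (- t)) has_real_derivative \<nu> (- t) * (- f (\<phi> (- t)) + - e2 (- t))) (at t)"
    by (rule DERIV_cong[OF DERIV_chain2[where f = \<sigma> and g = uminus, OF sigma_deriv[of "- t"]]])
      (auto intro!: derivative_eq_intros simp: algebra_simps)
  show "\<phi> (- (t + \<tau>)) = \<phi> (- t) + of_int (- k) * (2 * pi)"
    using phi_winds[of "- t - \<tau>"] by simp
  show "\<sigma> (- (t + \<tau>)) = \<sigma> (- t)"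
    using sigma_periodic[of "- t - \<tau>"] by simp
qed (auto simp: nu_pos e1_bound e2_bound tau_pos sigma_ge)

text \<open>Once \<open>g s\<close> exceeds the error bound, every passage through \<open>s\<close>
  is upward, so the level is a one-way barrier; \<open>no_up_crossing\<close> is its mirror
  image.\<close>

lemma no_down_crossing:
  assumes "K * exp (- M) < g s" "s \<le> \<phi> a" "a \<le> b"
  shows "s \<le> \<phi> b"
proof (rule upcrossing_barrier[OF phi_deriv])
  fix t assume "\<phi> t = s"
  then show "0 < \<nu> t * (g (\<phi> t) + e1 t)"
    using assms(1) e1_le[of t] nu_pos[of t] by auto
qed (use assms in auto)

lemma no_up_crossing:
  assumes "K * exp (- M) < - g s" "\<phi> a \<le> s" "a \<le> b"
  shows "\<phi> b \<le> s"
proof -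
  have "- s \<le> - \<phi> b"
  proof (rule upcrossing_barrier[OF DERIV_minus[OF phi_deriv]])
    fix t assume "- \<phi> t = - s"
    then have "\<nu> t * (g (\<phi> t) + e1 t) < 0"
      using assms(1) e1_le[of t] nu_pos[of t] by (intro mult_pos_neg) auto
    then show "0 < - (\<nu> t * (g (\<phi> t) + e1 t))" by simp
  qed (use assms in auto)
  then show ?thesis by simp
qed

lemma phi_shift: "\<phi> (t + of_int n * \<tau>) = \<phi> t + of_int n * (of_int k * (2 * pi))"
  using quasiperiodic_shift[of \<phi>, OF phi_winds] .

lemma ex_later: "\<exists>n::int. a \<le> t + of_int n * \<tau>"
proof -
  obtain n :: int where "(a - t) / \<tau> \<le> of_int n" using ex_le_of_int by blast
  then have "a \<le> t + of_int n * \<tau>" using tau_pos by (simp add: field_simps)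
  then show ?thesis ..
qed

lemma continuous_phi: "continuous_on S \<phi>"
  using phi_deriv DERIV_isCont continuous_at_imp_continuous_on by blast

text \<open>If \<open>k = 0\<close>, \<phi> attains a maximum and a minimum. A level between them
  with \<open>\<bar>g\<bar> \<ge> \<eta>\<close> would be a one-way barrier crossed in both
  directions. So \<open>g\<close> is small on the whole range of \<phi>, \<open>f\<close> is at
  least \<eta> in absolute value there with one sign, and \<sigma> is strictly monotone instead of
  periodic.\<close>

lemma winding_nonzero:
  assumes fg: "\<And>x. \<bar>g x\<bar> < \<eta> \<Longrightarrow> \<eta> \<le> \<bar>f x\<bar>" and \<eta>: "K * exp (- M) < \<eta>"
    and f: "continuous_on UNIV f"
  shows "k \<noteq> 0"
proof
  assume "k = 0"
  then have per: "\<phi> (t + \<tau>) = \<phi> t" for t using phi_winds by simp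
  obtain t1 where t1: "\<And>t. \<phi> t \<le> \<phi> t1"
    using periodic_attains_sup[OF continuous_phi per tau_pos] by blast
  obtain t2 where t2: "\<And>t. \<phi> t2 \<le> \<phi> t"
    using periodic_attains_inf[OF continuous_phi per tau_pos] by blast
  have "\<nu> t1 * (g (\<phi> t1) + e1 t1) = 0"
    by (rule DERIV_local_max[OF phi_deriv zero_less_one]) (use t1 in auto)
  \<comment> \<open>The extreme values need this separate argument, because the barrier only shows
    that a level with large \<open>g\<close> is one of them.\<close>
  then have g1: "\<bar>g (\<phi> t1)\<bar> < \<eta>" using nu_pos[of t1] e1_le[of t1] \<eta> by auto
  have "\<nu> t2 * (g (\<phi> t2) + e1 t2) = 0"
    by (rule DERIV_local_min[OF phi_deriv zero_less_one]) (use t2 in auto)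
  then have g2: "\<bar>g (\<phi> t2)\<bar> < \<eta>" using nu_pos[of t2] e1_le[of t2] \<eta> by auto
  have later: "\<exists>t'\<ge>a. \<phi> t' = \<phi> t" for a t
    using ex_later[of a t] phi_shift[of t] \<open>k = 0\<close> by auto
  have small: "\<bar>g s\<bar> < \<eta>" if s: "\<phi> t2 \<le> s" "s \<le> \<phi> t1" for s
  proof (rule ccontr)
    assume "\<not> \<bar>g s\<bar> < \<eta>"
    then consider "\<eta> \<le> g s" | "\<eta> \<le> - g s" by linarith
    then show False
    proof cases
      case 1
      obtain b where "t1 \<le> b" "\<phi> b = \<phi> t2" using later by blast
      then have "s \<le> \<phi> t2" using no_down_crossing[of s t1 b] 1 \<eta> s by auto
      then show False using g2 1 s by auto
    next
      case 2
      obtain b where "t2 \<le> b" "\<phi> b = \<phi> t1" using later by blast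
      then have "\<phi> t1 \<le> s" using no_up_crossing[of s t2 b] 2 \<eta> s by auto
      then show False using g1 2 s by auto
    qed
  qed
  have conn: "connected (f ` {\<phi> t2..\<phi> t1})"
    by (intro connected_continuous_image continuous_on_subset[OF f]) auto
  have big: "\<eta> \<le> \<bar>y\<bar>" if "y \<in> f ` {\<phi> t2..\<phi> t1}" for y
    using that small fg by auto
  have "0 < \<eta>" using \<eta> order_trans[OF abs_ge_zero e1_le] by (rule order.strict_trans1[rotated])
  have "(\<forall>t. \<eta> \<le> f (\<phi> t)) \<or> (\<forall>t. f (\<phi> t) \<le> - \<eta>)"
  proof (rule ccontr)
    assume "\<not> ?thesis"
    then obtain a b where "f (\<phi> a) < \<eta>" "f (\<phi> b) > - \<eta>" by (auto simp: not_le)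
    moreover have in_img: "f (\<phi> t) \<in> f ` {\<phi> t2..\<phi> t1}" for t using t1 t2 by auto
    ultimately have "f (\<phi> a) \<le> 0" "0 \<le> f (\<phi> b)"
      using big[OF in_img[of a]] big[OF in_img[of b]] by auto
    then have "0 \<in> f ` {\<phi> t2..\<phi> t1}"
      using connectedD_interval[OF conn in_img in_img] by blast
    then show False using big[of 0] \<open>0 < \<eta>\<close> by simp
  qed
  then show False
  proof
    assume "\<forall>t. \<eta> \<le> f (\<phi> t)"
    then have "0 < \<nu> t * (f (\<phi> t) + e2 t)" for t
      using nu_pos[of t] e2_le[of t] \<eta> by (intro mult_pos_pos) (auto simp: abs_le_iff dest!: spec[of _ t])
    then show False
      using not_periodic_if_deriv_pos[OF sigma_deriv _ tau_pos sigma_periodic] by blast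
  next
    assume "\<forall>t. f (\<phi> t) \<le> - \<eta>"
    then have "\<nu> t * (f (\<phi> t) + e2 t) < 0" for t
      using nu_pos[of t] e2_le[of t] \<eta> by (intro mult_pos_neg) (auto simp: abs_le_iff dest!: spec[of _ t])
    then show False
      using not_periodic_if_deriv_pos[OF DERIV_minus[OF sigma_deriv] _ tau_pos] sigma_periodic
      by (metis neg_0_less_iff_less)
  qed
qed

text \<open>A period adds \<open>k\<close> turns to \<phi>, so some whole number of periods carries
  it above \<open>b\<close> and another below \<open>a\<close>; the sign of \<open>k\<close> decides
  which of the two times is earlier.\<close>

lemma phi_unbounded:
  assumes "k \<noteq> 0" "a < b" 
  shows "0 < k \<Longrightarrow> \<exists>s t. s \<le> t \<and> \<phi> s \<le> a \<and> b \<le> \<phi> t"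
    and "k < 0 \<Longrightarrow> \<exists>s t. s \<le> t \<and> b \<le> \<phi> s \<and> \<phi> t \<le> a"
proof -
  let ?P = "of_int k * (2 * pi) :: real"
  have ge: "\<exists>n::int. b \<le> \<phi> 0 + of_int n * ?P" and le: "\<exists>n::int. \<phi> 0 + of_int n * ?P \<le> a" 
  proof -
    have "?P \<noteq> 0" using assms by simp
    have *: "\<exists>n::int. y \<le> of_int n * x" if "x \<noteq> 0" for x y :: real
    proof (cases "x > 0")
      case True
      obtain n :: int where "y / x \<le> of_int n" using ex_le_of_int by blast
      then show ?thesis using True by (auto simp: field_simps)
    next
      case False
      obtain n :: int where "y / (- x) \<le> of_int n" using ex_le_of_int by blast
      then have "y \<le> of_int (- n) * x" using False that by (simp add: field_simps)
      then show ?thesis by blast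
    qed
    show "\<exists>n::int. b \<le> \<phi> 0 + of_int n * ?P"
      using *[OF \<open>?P \<noteq> 0\<close>, of "b - \<phi> 0"] by (auto simp: algebra_simps)
    obtain n :: int where "\<phi> 0 - a \<le> of_int n * ?P" using *[OF \<open>?P \<noteq> 0\<close>] by blast
    then have "\<phi> 0 + of_int (- n) * ?P \<le> a" by simp
    then show "\<exists>n::int. \<phi> 0 + of_int n * ?P \<le> a" by blast
  qed
  obtain n m :: int where n: "b \<le> \<phi> 0 + of_int n * ?P" and m: "\<phi> 0 + of_int m * ?P \<le> a"
    using ge le by blast
  have nm: "of_int m * ?P < of_int n * ?P" using n m assms by linarith
  have "of_int i * \<tau> \<le> of_int j * \<tau>" if "i \<le> j" for i j :: int
    using that tau_pos by (intro mult_right_mono) auto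
  moreover have "m \<le> n" if "0 < k"
  proof -
    have "0 < ?P" using that by simp
    then have "(of_int m :: real) < of_int n" using nm mult_less_cancel_right_pos by blast
    then show ?thesis by simp
  qed
  moreover have "n \<le> m" if "k < 0"
  proof -
    have "?P < 0" using that by (simp add: mult_neg_pos)
    then have "(of_int n :: real) < of_int m" using nm mult_less_cancel_right_disj[of "of_int m" ?P "of_int n"] by auto
    then show ?thesis by simp
  qed
  ultimately show "0 < k \<Longrightarrow> \<exists>s t. s \<le> t \<and> \<phi> s \<le> a \<and> b \<le> \<phi> t"
    and "k < 0 \<Longrightarrow> \<exists>s t. s \<le> t \<and> b \<le> \<phi> s \<and> \<phi> t \<le> a"
    using phi_shift[of 0 n] phi_shift[of 0 m] n m by (metis add_0)+
qed

text \<open>A positive \<open>k\<close> would need an upward passage through \<open>b\<close>, a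
  negative one a downward passage through \<open>a\<close>; both are blocked by barriers.\<close>

lemma no_winding_if_sign_change:
  assumes a: "K * exp (- M) < g a" and b: "K * exp (- M) < - g b" and "k \<noteq> 0"
  shows False
proof (cases "0 < k")
  case True
  obtain s t where "s \<le> t" "\<phi> s \<le> b" "b + 1 \<le> \<phi> t"
    using phi_unbounded(1)[of b "b + 1"] True by auto
  then show False using no_up_crossing[OF b, of s t] by simp
next
  case False
  obtain s t where "s \<le> t" "a \<le> \<phi> s" "\<phi> t \<le> a - 1"
    using phi_unbounded(2)[of "a - 1" a] False \<open>k \<noteq> 0\<close> by auto
  then show False using no_down_crossing[OF a, of s t] by simp
qed

lemma phi_attains: "k \<noteq> 0 \<Longrightarrow> \<exists>t. \<phi> t = a"
  using quasiperiodic_surj[where q = \<phi>, OF continuous_phi phi_winds] by (metis mult_eq_0_iff of_int_eq_0_iff pi_neq_zero surjD zero_neq_numeral)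

text \<open>In backward time the orbit cannot leave the cone \<open>\<bar>\<phi> - p\<bar> \<le> L e\<^sup>-\<^sup>\<sigma>\<close>, and inside the cone
  \<open>\<sigma>\<close> is increasing.\<close>

lemma cone_trap:
  assumes f0: "0 < f0"
    and near: "\<And>x. \<bar>x - p\<bar> < \<delta> \<Longrightarrow> f0 / 2 \<le> f x \<and> \<bar>g x\<bar> \<le> f0 / 8 * \<bar>x - p\<bar>"
    and KM: "K * exp (- M) \<le> f0 / 8"
    and L: "0 < L" "4 * K < L * f0" "L * exp (- M) < \<delta>"
    and t0: "\<phi> t0 = p"
  shows False
proof -
  \<comment> \<open>The cone is \<open>\<bar>u\<bar> \<le> L\<close>. Scaling by
    \<open>exp \<sigma>\<close> turns the decaying error \<open>e1\<close> into one bounded by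
    \<open>K\<close>, while the motion of \<sigma> contributes the growth term
    \<open>u * f\<close>.\<close>
  define u where "u t = (\<phi> t - p) * exp (\<sigma> t)" for t
  define u' where "u' t = \<nu> t * ((g (\<phi> t) + e1 t) * exp (\<sigma> t) + u t * (f (\<phi> t) + e2 t))" for t
  have u_deriv: "(u has_real_derivative u' t) (at t)" for t
    unfolding u_def u'_def
    by (auto intro!: derivative_eq_intros phi_deriv sigma_deriv simp: algebra_simps)
  have near_t: "f0 / 2 \<le> f (\<phi> t)" "\<bar>g (\<phi> t)\<bar> * exp (\<sigma> t) \<le> f0 / 8 * \<bar>u t\<bar>" if "\<bar>u t\<bar> \<le> L" for t
  proof -
    have "\<bar>\<phi> t - p\<bar> = \<bar>u t\<bar> * exp (- \<sigma> t)"
      unfolding u_def abs_mult by (simp add: exp_minus)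
    also have "\<dots> \<le> L * exp (- M)"
      using that sigma_ge[of t] L by (intro mult_mono) auto
    finally have lt: "\<bar>\<phi> t - p\<bar> < \<delta>" using L by simp
    then show "f0 / 2 \<le> f (\<phi> t)" using near by blast
    have "\<bar>g (\<phi> t)\<bar> * exp (\<sigma> t) \<le> f0 / 8 * \<bar>\<phi> t - p\<bar> * exp (\<sigma> t)"
      using near[OF lt] by (intro mult_right_mono) auto
    then show "\<bar>g (\<phi> t)\<bar> * exp (\<sigma> t) \<le> f0 / 8 * \<bar>u t\<bar>"
      by (simp add: u_def abs_mult)
  qed
  \<comment> \<open>For \<open>\<bar>u\<bar> = L\<close>, the product \<open>u * u'\<close> divided
    by \<open>\<nu>\<close> is at least
    \<open>L\<^sup>2 * (f0 / 2 - f0 / 8) - L * (f0 / 8 * L + K)\<close>, which equals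
    \<open>L * (L * f0 / 4 - K)\<close>; the choice of \<open>L\<close> makes this positive.\<close>
  have up: "0 < 2 * u t * u' t" if "(u t)\<^sup>2 = L\<^sup>2" for t
  proof -
    have uL: "\<bar>u t\<bar> = L" using that L by (metis abs_of_pos power2_eq_iff_nonneg abs_ge_zero power2_abs less_imp_le)
    let ?G = "(g (\<phi> t) + e1 t) * exp (\<sigma> t)"
    have "\<bar>e1 t\<bar> * exp (\<sigma> t) \<le> K * exp (- \<sigma> t) * exp (\<sigma> t)"
      using e1_bound by (intro mult_right_mono) auto
    also have "\<dots> = K" by (simp add: exp_minus)
    finally have "\<bar>e1 t\<bar> * exp (\<sigma> t) \<le> K" .
    then have "\<bar>?G\<bar> \<le> f0 / 8 * L + K"
      using near_t(2)[of t] uL abs_triangle_ineq[of "g (\<phi> t) * exp (\<sigma> t)" "e1 t * exp (\<sigma> t)"]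
      by (simp add: abs_mult algebra_simps)
    then have "\<bar>u t * ?G\<bar> \<le> L * (f0 / 8 * L + K)"
      unfolding abs_mult uL using L by (intro mult_left_mono) auto
    moreover have "L\<^sup>2 * (f0 / 2 - f0 / 8) \<le> (u t)\<^sup>2 * (f (\<phi> t) + e2 t)"
      unfolding that using near_t(1)[of t] uL e2_le[of t] KM by (intro mult_left_mono) auto
    moreover have "0 < L * (L * f0 / 4 - K)" using L by (intro mult_pos_pos) auto
    ultimately have "0 < u t * ?G + (u t)\<^sup>2 * (f (\<phi> t) + e2 t)"
      by (simp add: algebra_simps power2_eq_square)
    then have "0 < 2 * \<nu> t * (u t * ?G + (u t)\<^sup>2 * (f (\<phi> t) + e2 t))"
      using nu_pos[of t] by simp
    then show ?thesis unfolding u'_def by (simp add: algebra_simps power2_eq_square)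
  qed
  \<comment> \<open>The square of \<open>u\<close> passes \<open>L\<^sup>2\<close> only upwards, so
    a point outside the cone before \<open>t0\<close> would stay outside until \<open>t0\<close>,
    where \<open>u\<close> is 0.\<close>
  have in_cone: "\<bar>u t\<bar> \<le> L" if "t \<le> t0" for t
  proof (rule ccontr)
    assume "\<not> \<bar>u t\<bar> \<le> L"
    then have "L\<^sup>2 \<le> (u t)\<^sup>2" using L by (metis abs_le_square_iff abs_of_pos less_imp_le linear)
    moreover have "((\<lambda>t. (u t)\<^sup>2) has_real_derivative 2 * u t * u' t) (at t)" for t
      by (auto intro!: derivative_eq_intros u_deriv)
    ultimately have "L\<^sup>2 \<le> (u t0)\<^sup>2"
      using upcrossing_barrier[of "\<lambda>t. (u t)\<^sup>2" "\<lambda>t. 2 * u t * u' t" "L\<^sup>2" t t0] up that by blast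
    then show False using L t0 by (simp add: u_def)
  qed
  \<comment> \<open>The full period before \<open>t0\<close> lies in the cone, where
    \<open>f + e2\<close> is at least \<open>f0 / 2 - f0 / 8\<close>.\<close>
  have "\<sigma> (t0 - \<tau>) < \<sigma> t0"
  proof (rule DERIV_pos_imp_increasing[where f = \<sigma>])
    fix t assume "t0 - \<tau> \<le> t" "t \<le> t0"
    then have "0 < f (\<phi> t) + e2 t"
      using near_t(1)[OF in_cone[of t]] e2_le[of t] KM f0 by linarith
    then show "\<exists>y. (\<sigma> has_real_derivative y) (at t) \<and> 0 < y"
      by (intro exI[of _ "\<nu> t * (f (\<phi> t) + e2 t)"] conjI sigma_deriv) (simp add: nu_pos)
  qed (use tau_pos in simp)
  then show False using sigma_periodic[of "t0 - \<tau>"] by simp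
qed

text \<open>The function \<open>\<sigma> - h \<circ> \<phi>\<close> is strictly monotone along the orbit.\<close>

lemma lyapunov_increasing:
  assumes h: "\<And>x. (h has_real_derivative f x / g x - \<kappa>) (at x)" and per: "\<And>x. h (x + 2 * pi) = h x"
    and g: "\<And>x. g x \<noteq> 0" "\<And>x. c \<le> \<kappa> * g x" and C: "\<And>x. \<bar>f x / g x - \<kappa>\<bar> \<le> C"
    and M: "(1 + C) * (K * exp (- M)) < c"
  shows False
proof (rule not_periodic_if_deriv_pos[OF _ _ tau_pos])
  fix t
  let ?q = "f (\<phi> t) / g (\<phi> t) - \<kappa>"
  have "((\<lambda>t. h (\<phi> t)) has_real_derivative ?q * (\<nu> t * (g (\<phi> t) + e1 t))) (at t)"
    by (rule DERIV_chain2[OF h phi_deriv])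
  \<comment> \<open>The derivative of \<open>h\<close> is chosen so that \<open>f\<close> cancels.
    There remains \<open>\<kappa> * g \<ge> c\<close> against errors of at most
    \<open>(1 + C) * (K * exp (- M))\<close>.\<close>
  then show "((\<lambda>t. \<sigma> t - h (\<phi> t)) has_real_derivative
      \<nu> t * (\<kappa> * g (\<phi> t) + (e2 t - ?q * e1 t))) (at t)"
    by (rule DERIV_cong[OF DERIV_diff[OF sigma_deriv]]) (use g(1)[of "\<phi> t"] in \<open>simp add: field_simps\<close>)
  have "\<bar>?q * e1 t\<bar> \<le> C * (K * exp (- M))"
    unfolding abs_mult using C[of "\<phi> t"] e1_le[of t] by (intro mult_mono) auto
  then have "0 < \<kappa> * g (\<phi> t) + (e2 t - ?q * e1 t)"
    using g(2)[of "\<phi> t"] e2_le[of t] M by (simp add: algebra_simps)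
  then show "0 < \<nu> t * (\<kappa> * g (\<phi> t) + (e2 t - ?q * e1 t))"
    using nu_pos[of t] by simp
next
  show "\<sigma> (0 + \<tau>) - h (\<phi> (0 + \<tau>)) = \<sigma> 0 - h (\<phi> 0)"
    unfolding phi_winds sigma_periodic using quasiperiodic_shift[of h "2 * pi" 0] per by simp
qed

end

text \<open>Thresholds obtained from different arguments thereby combine to their maximum.\<close>

lemma cylinder_orbit_mono:
  assumes "cylinder_orbit f g K M \<tau> \<phi> \<sigma> \<nu> e1 e2 k" "M' \<le> M"
  shows "cylinder_orbit f g K M' \<tau> \<phi> \<sigma> \<nu> e1 e2 k"
proof -
  interpret cylinder_orbit f g K M \<tau> \<phi> \<sigma> \<nu> e1 e2 k by fact
  show ?thesis
    by unfold_locales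
      (use assms(2) sigma_ge in \<open>auto intro: order_trans phi_deriv sigma_deriv nu_pos e1_bound
        e2_bound tau_pos phi_winds sigma_periodic\<close>)
qed

section \<open>Thresholds beyond which no closed orbit exists\<close>

lemma ex_exp_small: "0 < (\<epsilon>::real) \<Longrightarrow> \<exists>M. K * exp (- M) < \<epsilon>"
proof -
  assume \<epsilon>: "0 < \<epsilon>"
  have "((\<lambda>M::real. K * exp (- M)) \<longlongrightarrow> K * 0) at_top"
    by (intro tendsto_mult tendsto_const filterlim_compose[OF exp_at_bot filterlim_uminus_at_bot_at_top])
  then have "\<forall>\<^sub>F M in at_top. K * exp (- M) < \<epsilon>"
    using \<epsilon> order_tendstoD(2)[of _ 0] by simp
  then show ?thesis using eventually_happens by force
qed

text \<open>Constants for \<open>cone_trap\<close>: \<open>\<delta>\<close> comes from continuity of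
  \<open>f\<close> and from \<open>g x = o(x - p)\<close>, which is what the vanishing derivative
  gives; \<open>L\<close> depends on \<open>K\<close> and \<open>f p\<close>, and \<open>M\<close>
  must then make both the errors and the cone width small.\<close>

lemma no_cylinder_orbit_positive_zero:
  assumes f: "continuous_on UNIV f" and g0: "g p = 0" "(g has_real_derivative 0) (at p)" and fp: "0 < f p"
  shows "\<exists>M. \<forall>\<tau> \<phi> \<sigma> \<nu> e1 e2 k. k \<noteq> 0 \<longrightarrow> \<not> cylinder_orbit f g K M \<tau> \<phi> \<sigma> \<nu> e1 e2 k"
proof -
  have "isCont f p" using f by (simp add: continuous_on_eq_continuous_at)
  then have ev_f: "\<forall>\<^sub>F x in nhds p. f p / 2 < f x"
    using fp order_tendstoD(1)[of f "f p" "nhds p" "f p / 2"]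
    by (simp add: isCont_def tendsto_at_iff_tendsto_nhds)
  have "((\<lambda>x. \<bar>g x\<bar> / \<bar>x - p\<bar>) \<longlongrightarrow> 0) (at p)"
    using tendsto_rabs_zero[OF g0(2)[unfolded has_field_derivative_iff]] g0(1)
    by (simp add: abs_divide)
  then have "\<forall>\<^sub>F x in at p. \<bar>g x\<bar> / \<bar>x - p\<bar> < f p / 8"
    by (rule order_tendstoD(2)) (use fp in simp)
  then have "\<forall>\<^sub>F x in nhds p. x \<noteq> p \<longrightarrow> \<bar>g x\<bar> / \<bar>x - p\<bar> < f p / 8"
    by (simp add: eventually_at_filter)
  with ev_f have "\<forall>\<^sub>F x in nhds p. f p / 2 \<le> f x \<and> \<bar>g x\<bar> \<le> f p / 8 * \<bar>x - p\<bar>"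
    by eventually_elim (use g0 in \<open>auto simp: field_simps split: if_splits\<close>)
  then obtain \<delta> where \<delta>: "0 < \<delta>" "\<And>x. \<bar>x - p\<bar> < \<delta> \<Longrightarrow> f p / 2 \<le> f x \<and> \<bar>g x\<bar> \<le> f p / 8 * \<bar>x - p\<bar>"
    unfolding eventually_nhds_metric by (auto simp: dist_real_def)
  \<comment> \<open>No sign of \<open>K\<close> is assumed here; the maximum keeps \<open>L\<close>
    positive and still above \<open>4 * K / f p\<close>.\<close>
  define L where "L = max 0 (4 * K / f p) + 1"
  have "4 * K / f p < L" "0 < L" by (auto simp: L_def)
  then have L: "0 < L" "4 * K < L * f p" using fp by (auto simp: field_simps)
  obtain M1 where M1: "K * exp (- M1) < f p / 8" using ex_exp_small[of "f p / 8" K] fp by auto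
  obtain M2 where M2: "L * exp (- M2) < \<delta>" using ex_exp_small[OF \<delta>(1)] by blast
  show ?thesis
  proof (intro exI[of _ "max M1 M2"] allI impI notI)
    fix \<tau> \<phi> \<sigma> \<nu> e1 e2 and k :: int
    assume k: "k \<noteq> 0" and orb: "cylinder_orbit f g K (max M1 M2) \<tau> \<phi> \<sigma> \<nu> e1 e2 k"
    interpret M1: cylinder_orbit f g K M1 \<tau> \<phi> \<sigma> \<nu> e1 e2 k by (rule cylinder_orbit_mono[OF orb]) simp
    interpret cylinder_orbit f g K "max M1 M2" \<tau> \<phi> \<sigma> \<nu> e1 e2 k by (rule orb)
    obtain t0 where "\<phi> t0 = p" using phi_attains[OF k] by blast
    moreover have "K * exp (- max M1 M2) \<le> K * exp (- M1)"
      using K_nonneg by (intro mult_left_mono) auto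
    moreover have "L * exp (- max M1 M2) \<le> L * exp (- M2)"
      using L by (intro mult_left_mono) auto
    ultimately show False
      using cone_trap[OF fp \<delta>(2) _ L(1,2)] M1 M2 by force
  qed
qed

lemma no_cylinder_orbit_zero:
  assumes f: "continuous_on UNIV f" and g0: "g p = 0" "(g has_real_derivative 0) (at p)" and fp: "f p \<noteq> 0"
  shows "\<exists>M. \<forall>\<tau> \<phi> \<sigma> \<nu> e1 e2 k. k \<noteq> 0 \<longrightarrow> \<not> cylinder_orbit f g K M \<tau> \<phi> \<sigma> \<nu> e1 e2 k"
proof (cases "0 < f p")
  case True
  then show ?thesis using no_cylinder_orbit_positive_zero[OF f g0] by blast
next
  case False
  have "((\<lambda>x. - g x) has_real_derivative 0) (at p)" using DERIV_minus[OF g0(2)] by simp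
  then obtain M where "\<And>\<tau> \<phi> \<sigma> \<nu> e1 e2 k. k \<noteq> 0 \<Longrightarrow>
      \<not> cylinder_orbit (\<lambda>x. - f x) (\<lambda>x. - g x) K M \<tau> \<phi> \<sigma> \<nu> e1 e2 k"
    using no_cylinder_orbit_positive_zero[of "\<lambda>x. - f x" "\<lambda>x. - g x" p K] f g0(1) fp False
    by (auto simp: continuous_on_minus)
  then show ?thesis using cylinder_orbit.reversed by (metis neg_equal_0_iff_equal)
qed

text \<open>By periodicity \<open>\<kappa> * g\<close> has a positive minimum and
  \<open>\<bar>f / g - \<kappa>\<bar>\<close> a maximum; they serve as \<open>c\<close> and
  \<open>C\<close> in \<open>lyapunov_increasing\<close>. Subtracting the mean slope \<kappa> from
  \<open>F\<close> makes \<open>h\<close> periodic.\<close>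

lemma no_cylinder_orbit_increasing:
  assumes f: "continuous_on UNIV f" "\<And>x. f (x + 2 * pi) = f x"
    and g: "continuous_on UNIV g" "\<And>x. g (x + 2 * pi) = g x" "\<And>x. 0 < \<kappa> * g x"
    and F: "\<And>x. (F has_real_derivative f x / g x) (at x)" "F (2 * pi) - F 0 = 2 * pi * \<kappa>"
  shows "\<exists>M. \<forall>\<tau> \<phi> \<sigma> \<nu> e1 e2 k. \<not> cylinder_orbit f g K M \<tau> \<phi> \<sigma> \<nu> e1 e2 k"
proof -
  have g_nz: "g x \<noteq> 0" for x using g(3)[of x] by auto
  obtain a where a: "\<And>x. \<kappa> * g a \<le> \<kappa> * g x"
    using periodic_attains_inf[of "\<lambda>x. \<kappa> * g x" "2 * pi"] g continuous_on_mult_left[OF g(1), of \<kappa>] by auto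
  have "continuous_on UNIV (\<lambda>x. \<bar>f x / g x - \<kappa>\<bar>)"
    using f g g_nz by (intro continuous_intros) auto
  then obtain b where b: "\<And>x. \<bar>f x / g x - \<kappa>\<bar> \<le> \<bar>f b / g b - \<kappa>\<bar>"
    using periodic_attains_sup[of "\<lambda>x. \<bar>f x / g x - \<kappa>\<bar>" "2 * pi"] f(2) g(2) by auto
  define C where "C = \<bar>f b / g b - \<kappa>\<bar>"
  obtain M where M: "((1 + C) * K) * exp (- M) < \<kappa> * g a"
    using ex_exp_small[OF g(3)] by blast
  define h where "h x = F x - \<kappa> * x" for x
  have h: "(h has_real_derivative f x / g x - \<kappa>) (at x)" for x
    unfolding h_def by (auto intro!: derivative_eq_intros F)
  have "F (x + 2 * pi) = F x + (F (2 * pi) - F 0)" for x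
    by (rule antiderivative_periodic[OF F(1)]) (simp add: f g)
  then have per: "h (x + 2 * pi) = h x" for x
    unfolding h_def by (simp only: F(2)) (simp add: algebra_simps)
  show ?thesis
  proof (intro exI[of _ M] allI notI)
    fix \<tau> \<phi> \<sigma> \<nu> e1 e2 k assume "cylinder_orbit f g K M \<tau> \<phi> \<sigma> \<nu> e1 e2 k"
    then show False
      by (rule cylinder_orbit.lyapunov_increasing[OF _ h per g_nz a b]) (use M in \<open>simp add: C_def mult.assoc\<close>)
  qed
qed

text \<open>\<open>no_center\<close> excludes a nonvanishing \<open>g\<close> with
  \<open>f / g\<close> of mean zero: then the graphs \<open>\<sigma> = F(\<phi>) + const\<close>
  would be closed orbits of the unperturbed field, and the Lyapunov function would be constant to
  leading order.\<close>

theorem no_cylinder_orbit: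
  assumes f: "continuous_on UNIV f" "\<And>x. f (x + 2 * pi) = f x"
    and g: "\<And>x. (g has_real_derivative g' x) (at x)" "\<And>x. g (x + 2 * pi) = g x"
    and fg: "\<And>x. f x \<noteq> 0 \<or> g x \<noteq> 0"
    and no_center: "\<nexists>F. (\<forall>x. g x \<noteq> 0) \<and> (\<forall>x. (F has_real_derivative f x / g x) (at x)) \<and>
      (\<forall>x. F (x + 2 * pi) = F x)"
  shows "\<exists>M. \<forall>\<tau> \<phi> \<sigma> \<nu> e1 e2 k. \<not> cylinder_orbit f g K M \<tau> \<phi> \<sigma> \<nu> e1 e2 k"
proof -
  have contg: "continuous_on UNIV g"
    using g(1) DERIV_isCont continuous_at_imp_continuous_on by blast
  show ?thesis
  proof (cases "\<exists>x. g x = 0")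
    case False
    then obtain F where F: "\<And>x. (F has_real_derivative f x / g x) (at x)"
      using ex_antiderivative_real[of "\<lambda>x. f x / g x"] f(1) contg by (auto intro: continuous_on_divide)
    define \<kappa> where "\<kappa> = (F (2 * pi) - F 0) / (2 * pi)"
    have per: "F (x + 2 * pi) = F x + (F (2 * pi) - F 0)" for x
      by (rule antiderivative_periodic[OF F]) (simp add: f g)
    have "\<kappa> \<noteq> 0"
    proof
      assume "\<kappa> = 0"
      then have "F (2 * pi) - F 0 = 0" by (simp add: \<kappa>_def)
      then have "\<forall>x. F (x + 2 * pi) = F x" using per by simp
      then show False using no_center False F by blast
    qed
    have F2: "F (2 * pi) - F 0 = 2 * pi * \<kappa>" by (simp add: \<kappa>_def)
    have "continuous_on UNIV (\<lambda>x. \<kappa> * g x)" by (intro continuous_intros contg)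
    then consider "\<And>x. 0 < \<kappa> * g x" | "\<And>x. \<kappa> * g x < 0"
      using nonvanishing_sign[of "\<lambda>x. \<kappa> * g x"] False \<open>\<kappa> \<noteq> 0\<close> by auto
    then show ?thesis
    proof cases
      case 1
      show ?thesis
        by (rule no_cylinder_orbit_increasing[OF f contg g(2) 1 F F2])
    next
      case 2
      \<comment> \<open>Reversing time negates \<open>f\<close> and \<open>g\<close>, hence
        \<open>\<kappa> * g\<close>, but leaves \<open>f / g\<close>, \<open>F\<close> and \<kappa>
        unchanged.\<close>
      have "\<exists>M. \<forall>\<tau> \<phi> \<sigma> \<nu> e1 e2 k. \<not> cylinder_orbit (\<lambda>x. - f x) (\<lambda>x. - g x) K M \<tau> \<phi> \<sigma> \<nu> e1 e2 k"
        by (rule no_cylinder_orbit_increasing[where F = F and \<kappa> = \<kappa>])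
          (use f g(2) contg 2 F F2 in \<open>auto intro: continuous_on_minus\<close>)
      then show ?thesis using cylinder_orbit.reversed by meson
    qed
  next
    case True
    then obtain p where p: "g p = 0" by blast
    have "continuous_on UNIV (\<lambda>x. \<bar>f x\<bar> + \<bar>g x\<bar>)"
      using f contg by (intro continuous_intros) auto
    then obtain a where a: "\<And>x. \<bar>f a\<bar> + \<bar>g a\<bar> \<le> \<bar>f x\<bar> + \<bar>g x\<bar>"
      using periodic_attains_inf[of "\<lambda>x. \<bar>f x\<bar> + \<bar>g x\<bar>" "2 * pi"] f g by auto
    \<comment> \<open>Half the minimum of \<open>\<bar>f\<bar> + \<bar>g\<bar>\<close>, so that
      wherever \<open>g\<close> is below \<eta> in absolute value, \<open>f\<close> has to supply
      the other half.\<close>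
    define \<eta> where "\<eta> = (\<bar>f a\<bar> + \<bar>g a\<bar>) / 2"
    have \<eta>: "0 < \<eta>" "\<And>x. \<bar>g x\<bar> < \<eta> \<Longrightarrow> \<eta> \<le> \<bar>f x\<bar>"
    proof -
      show "0 < \<eta>" using fg[of a] by (auto simp: \<eta>_def)
      show "\<eta> \<le> \<bar>f x\<bar>" if "\<bar>g x\<bar> < \<eta>" for x
        using a[of x] that by (simp add: \<eta>_def field_simps)
    qed
    obtain M1 where M1: "K * exp (- M1) < \<eta>" using ex_exp_small[OF \<eta>(1)] by blast
    have "\<exists>M. \<forall>\<tau> \<phi> \<sigma> \<nu> e1 e2 k. k \<noteq> 0 \<longrightarrow> \<not> cylinder_orbit f g K M \<tau> \<phi> \<sigma> \<nu> e1 e2 k"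
    proof (cases "\<exists>a b. 0 < g a \<and> g b < 0")
      case True
      then obtain a b where ab: "0 < g a" "0 < - g b" by auto
      obtain M where M: "K * exp (- M) < min (g a) (- g b)"
        using ex_exp_small[of "min (g a) (- g b)" K] ab by auto
      then have "K * exp (- M) < g a" "K * exp (- M) < - g b" by auto
      then show ?thesis using cylinder_orbit.no_winding_if_sign_change by blast
    next
      case False
      \<comment> \<open>Without a sign change the zero \<open>p\<close> is a global extremum of
        \<open>g\<close>.\<close>
      have "g' p = 0"
      proof (cases "\<forall>x. 0 \<le> g x")
        case True
        then show ?thesis by (intro DERIV_local_min[OF g(1) zero_less_one]) (simp add: p)
      next
        case no: False
        then have "\<forall>x. g x \<le> 0" using False by (meson not_le)
        then show ?thesis by (intro DERIV_local_max[OF g(1) zero_less_one]) (simp add: p)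
      qed
      then show ?thesis
        using no_cylinder_orbit_zero[where f = f and g = g, OF f(1) p] g(1)[of p] fg[of p] p by auto
    qed
    then obtain M2 where M2: "\<And>\<tau> \<phi> \<sigma> \<nu> e1 e2 k. k \<noteq> 0 \<Longrightarrow> \<not> cylinder_orbit f g K M2 \<tau> \<phi> \<sigma> \<nu> e1 e2 k"
      by blast
    show ?thesis
    proof (intro exI[of _ "max M1 M2"] allI notI)
      fix \<tau> \<phi> \<sigma> \<nu> e1 e2 k assume orb: "cylinder_orbit f g K (max M1 M2) \<tau> \<phi> \<sigma> \<nu> e1 e2 k"
      have "k \<noteq> 0"
        by (rule cylinder_orbit.winding_nonzero[OF cylinder_orbit_mono[OF orb max.cobounded1] \<eta>(2) M1 f(1)])
      then show False
        using M2 cylinder_orbit_mono[OF orb max.cobounded2] by blast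
    qed
  qed
qed

subsection \<open>The normal of the upper boundary\<close>

lemma newton_polytope_plus_translate:
  assumes "0 \<le> u" "0 \<le> v" "z \<in> newton_polytope X"
  shows "(u, v) + z \<in> newton_polytope_plus X"
proof -
  have "(u, v) + z \<in> (+) (u, v) ` (convex hull (real_pt ` supp X))"
    using assms by (auto simp: newton_polytope_def)
  also have "\<dots> = convex hull ((+) (u, v) ` real_pt ` supp X)"
    by (rule convex_hull_translation[symmetric])
  also have "\<dots> \<subseteq> newton_polytope_plus X"
    unfolding newton_polytope_plus_def
    by (intro hull_mono) (use assms in \<open>force simp: add.commute\<close>)
  finally show ?thesis .
qed

text \<open>The ray leaves the bounded polytope at a frontier point. Translating the interior of the
  polytope along the ray gives an open set inside \<open>newton_polytope_plus X\<close>, since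
  \<open>u\<close> and \<open>v\<close> are nonnegative; it contains the exit point, which is
  therefore not on the frontier of the larger set.\<close>

lemma exit_point_in_upper_boundary:
  assumes fin: "finite (supp X)" and z: "z \<in> interior (newton_polytope X)"
    and uv: "0 \<le> u" "0 \<le> v" "(u, v) \<noteq> 0"
  shows "\<exists>t>0. z + t *\<^sub>R (u, v) \<in> upper_boundary X"
proof -
  let ?P = "newton_polytope X"
  have "bounded ?P"
    unfolding newton_polytope_def by (intro bounded_convex_hull finite_imp_bounded finite_imageI fin)
  from ray_to_frontier[OF this z uv(3)]
  obtain t where t: "0 < t" "z + t *\<^sub>R (u, v) \<in> frontier ?P" by blast
  have "(+) (t *\<^sub>R (u, v)) ` interior ?P \<subseteq> newton_polytope_plus X"
    using newton_polytope_plus_translate[of "t * u" "t * v" _ X] uv t interior_subset[of ?P]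
    by (auto simp: subset_iff)
  then have "(+) (t *\<^sub>R (u, v)) ` interior ?P \<subseteq> interior (newton_polytope_plus X)"
    by (intro interior_maximal open_translation) auto
  moreover have "t *\<^sub>R (u, v) + z \<in> (+) (t *\<^sub>R (u, v)) ` interior ?P" using z by blast
  ultimately have "z + t *\<^sub>R (u, v) \<notin> frontier (newton_polytope_plus X)"
    unfolding frontier_def by (auto simp: add.commute)
  then have "z + t *\<^sub>R (u, v) \<in> upper_boundary X"
    using t z unfolding upper_boundary_def by (auto intro: closure_subset[THEN subsetD])
  then show ?thesis using t by blast
qed

text \<open>The horizontal and the vertical ray from an interior point of the polytope both leave it
  through the segment, so the segment has a normal with positive entries.\<close>

lemma upper_boundary_normal:
  assumes fin: "finite (supp X)" and int: "interior (newton_polytope X) \<noteq> {}"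
    and seg: "upper_boundary X = closed_segment p q"
  shows "\<exists>A B d::real. 0 < A \<and> 0 < B \<and>
    (\<forall>m n. (m, n) \<in> supp X \<longrightarrow>
      (if real_pt (m, n) \<in> upper_boundary X then A * of_int m + B * of_int n = d
       else A * of_int m + B * of_int n < d))"
proof -
  let ?P = "newton_polytope X" and ?U = "upper_boundary X"
  obtain z0 where z0: "z0 \<in> interior ?P" using int by blast
  \<comment> \<open>Exit distances are swapped into weights: \<open>B\<close> is the horizontal and
    \<open>A\<close> the vertical one, so both exit points have the value
    \<open>w z0 + A * B\<close>, and \<open>w\<close> is constant along the segment.\<close>
  obtain B where B: "0 < B" "z0 + B *\<^sub>R (1, 0) \<in> ?U"
    using exit_point_in_upper_boundary[OF fin z0, of 1 0] by (auto simp: zero_prod_def)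
  obtain A where A: "0 < A" "z0 + A *\<^sub>R (0, 1) \<in> ?U"
    using exit_point_in_upper_boundary[OF fin z0, of 0 1] by (auto simp: zero_prod_def)
  define w where "w z = A * fst z + B * snd z" for z :: "real \<times> real"
  have w_lin: "w (x + y) = w x + w y" "w (c *\<^sub>R x) = c * w x" "w (x - y) = w x - w y" for x y c
    by (simp_all add: w_def algebra_simps)
  have U_iff: "z \<in> ?U \<longleftrightarrow> (\<exists>s. 0 \<le> s \<and> s \<le> 1 \<and> z = p + s *\<^sub>R (q - p))" for z
    unfolding seg closed_segment_def by (auto simp: algebra_simps)
  obtain s1 s2 where s: "z0 + B *\<^sub>R (1, 0) = p + s1 *\<^sub>R (q - p)" "z0 + A *\<^sub>R (0, 1) = p + s2 *\<^sub>R (q - p)"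
    using A B U_iff by auto
  have "s1 \<noteq> s2" using s A B by (auto simp: prod_eq_iff)
  have "w (z0 + B *\<^sub>R (1, 0)) = w (z0 + A *\<^sub>R (0, 1))" by (simp add: w_def algebra_simps)
  then have "(s1 - s2) * w (q - p) = 0" unfolding s by (simp add: w_lin algebra_simps)
  then have wqp: "w (q - p) = 0" using \<open>s1 \<noteq> s2\<close> by simp
  define d where "d = w p"
  have U_d: "w z = d" if "z \<in> ?U" for z
    using that wqp unfolding U_iff d_def by (auto simp: w_lin)
  have exit: "w z < d \<and> z + ((d - w z) / A) *\<^sub>R (1, 0) \<in> ?U" if z: "z \<in> interior ?P" for z
  proof -
    obtain t where t: "0 < t" "z + t *\<^sub>R (1, 0) \<in> ?U"
      using exit_point_in_upper_boundary[OF fin z, of 1 0] by (auto simp: zero_prod_def)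
    have "w z + t * A = d" using U_d[OF t(2)] by (simp add: w_def algebra_simps)
    then have "t = (d - w z) / A" "w z < d" using A t by (auto simp: field_simps)
    then show ?thesis using t by simp
  qed
  have "convex ?P" by (simp add: newton_polytope_def)
  have "closed ?U" unfolding seg by simp
  have P_d: "w z \<le> d \<and> (w z = d \<longrightarrow> z \<in> ?U)" if "z \<in> ?P" for z
  proof -
    have "z \<in> closure (interior ?P)"
      using that convex_closure_interior[OF \<open>convex ?P\<close> int] closure_subset by blast
    then obtain x where x: "\<And>n::nat. x n \<in> interior ?P" "x \<longlonglongrightarrow> z"
      unfolding closure_sequential by blast
    have wx: "(\<lambda>n. w (x n)) \<longlonglongrightarrow> w z"
      unfolding w_def by (intro tendsto_intros x)
    have "w z \<le> d"
      using LIMSEQ_le_const2[OF wx] exit[OF x(1)] less_imp_le by blast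
    \<comment> \<open>Horizontal exit points of interior points approaching \<open>z\<close> lie on
      the segment. Their displacements \<open>(d - w (x n)) / A\<close> tend to 0, so they converge
      to \<open>z\<close>.\<close>
    moreover have "z \<in> ?U" if "w z = d"
    proof (rule closed_sequentially[OF \<open>closed ?U\<close>])
      show "x n + ((d - w (x n)) / A) *\<^sub>R (1, 0) \<in> ?U" for n using exit x(1) by blast
      have "(\<lambda>n. x n + ((d - w (x n)) / A) *\<^sub>R (1, 0)) \<longlonglongrightarrow> z + ((d - w z) / A) *\<^sub>R (1, 0)"
        using A by (intro tendsto_intros x wx) auto
      also have "z + ((d - w z) / A) *\<^sub>R (1, 0) = z" using that by (simp add: prod_eq_iff)
      finally show "(\<lambda>n. x n + ((d - w (x n)) / A) *\<^sub>R (1, 0)) \<longlonglongrightarrow> z" .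
    qed
    ultimately show ?thesis by blast
  qed
  have "if real_pt (m, n) \<in> ?U then A * of_int m + B * of_int n = d
       else A * of_int m + B * of_int n < d" if "(m, n) \<in> supp X" for m n
  proof -
    have "real_pt (m, n) \<in> ?P"
      unfolding newton_polytope_def using that by (intro hull_inc) auto
    then show ?thesis
      using P_d[of "real_pt (m, n)"] U_d[of "real_pt (m, n)"] by (auto simp: w_def real_pt_def)
  qed
  then show ?thesis using A B by blast
qed

text \<open>Finitely many support points lie strictly below the line, so a positive
  \<open>\<delta>\<close> bounds all gaps from below; dividing \<open>A\<close>, \<open>B\<close>
  and \<open>d\<close> by it makes every gap at least 1. This unit is the rate in the error
  \<open>exp (- \<sigma>)\<close>.\<close>

lemma upper_boundary_normal_gap:
  assumes fin: "finite (supp X)" and int: "interior (newton_polytope X) \<noteq> {}"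
    and seg: "upper_boundary X = closed_segment p q"
  shows "\<exists>A B d::real. 0 < A \<and> 0 < B \<and>
    (\<forall>m n. (m, n) \<in> supp X \<longrightarrow>
      (if real_pt (m, n) \<in> upper_boundary X then A * of_int m + B * of_int n = d
       else A * of_int m + B * of_int n \<le> d - 1))"
proof -
  obtain A B d :: real where AB: "0 < A" "0 < B" and d: "\<And>m n. (m, n) \<in> supp X \<Longrightarrow>
      (if real_pt (m, n) \<in> upper_boundary X then A * of_int m + B * of_int n = d
       else A * of_int m + B * of_int n < d)"
    using upper_boundary_normal[OF assms] by blast
  \<comment> \<open>The inserted 1 keeps the set nonempty, so that its minimum is defined without a
    further argument.\<close>
  define G where "G = insert 1 ((\<lambda>(m, n). d - (A * of_int m + B * of_int n)) `
    {(m, n) \<in> supp X. real_pt (m, n) \<notin> upper_boundary X})"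
  have "finite G"
    unfolding G_def by (intro finite.insertI finite_imageI finite_subset[OF _ fin]) auto
  define \<delta> where "\<delta> = Min G"
  have "\<delta> \<in> G" unfolding \<delta>_def using \<open>finite G\<close> by (intro Min_in) (auto simp: G_def)
  then have "0 < \<delta>" unfolding G_def using d by (fastforce split: if_splits)
  have le: "\<delta> \<le> d - (A * of_int m + B * of_int n)"
    if "(m, n) \<in> supp X" "real_pt (m, n) \<notin> upper_boundary X" for m n
    unfolding \<delta>_def using \<open>finite G\<close> that by (intro Min_le) (auto simp: G_def)
  show ?thesis
  proof (rule exI[of _ "A / \<delta>"], rule exI[of _ "B / \<delta>"], rule exI[of _ "d / \<delta>"],
      intro conjI allI impI)
    fix m n assume mn: "(m, n) \<in> supp X"
    have eq': "d / \<delta> - 1 = (d - \<delta>) / \<delta>" using \<open>0 < \<delta>\<close> by (simp add: diff_divide_distrib)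
    have eq: "A / \<delta> * of_int m + B / \<delta> * of_int n = (A * of_int m + B * of_int n) / \<delta>"
      by (simp add: add_divide_distrib)
    show "if real_pt (m, n) \<in> upper_boundary X then A / \<delta> * of_int m + B / \<delta> * of_int n = d / \<delta>
       else A / \<delta> * of_int m + B / \<delta> * of_int n \<le> d / \<delta> - 1"
      unfolding eq eq' using d[OF mn] le[OF mn] \<open>0 < \<delta>\<close> by (auto simp: divide_le_cancel)
  qed (use AB \<open>0 < \<delta>\<close> in auto)
qed

subsection \<open>Generalised trigonometric functions\<close>

lemma power_lipschitz:
  fixes R :: real
  shows "\<exists>L\<ge>0. \<forall>x y. \<bar>x\<bar> \<le> R \<longrightarrow> \<bar>y\<bar> \<le> R \<longrightarrow> \<bar>x ^ n - y ^ n\<bar> \<le> L * \<bar>x - y\<bar>"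
proof (induction n)
  case (Suc n)
  then obtain L where L: "0 \<le> L" "\<And>x y. \<bar>x\<bar> \<le> R \<Longrightarrow> \<bar>y\<bar> \<le> R \<Longrightarrow> \<bar>x ^ n - y ^ n\<bar> \<le> L * \<bar>x - y\<bar>" by blast
  show ?case
  proof (intro exI[of _ "\<bar>R\<bar> * L + \<bar>R\<bar> ^ n"] conjI allI impI)
    fix x y assume xy: "\<bar>x\<bar> \<le> R" "\<bar>y\<bar> \<le> R"
    have "x ^ Suc n - y ^ Suc n = x * (x ^ n - y ^ n) + (x - y) * y ^ n" by (simp add: algebra_simps)
    also have "\<bar>\<dots>\<bar> \<le> \<bar>x\<bar> * \<bar>x ^ n - y ^ n\<bar> + \<bar>x - y\<bar> * \<bar>y\<bar> ^ n"
      using abs_triangle_ineq[of "x * (x ^ n - y ^ n)" "(x - y) * y ^ n"] by (simp add: abs_mult power_abs)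
    also have "\<dots> \<le> \<bar>R\<bar> * (L * \<bar>x - y\<bar>) + \<bar>x - y\<bar> * \<bar>R\<bar> ^ n"
      using xy L by (intro add_mono mult_mono power_mono) auto
    finally show "\<bar>x ^ Suc n - y ^ Suc n\<bar> \<le> (\<bar>R\<bar> * L + \<bar>R\<bar> ^ n) * \<bar>x - y\<bar>" by (simp add: algebra_simps)
  qed (use L in auto)
qed (intro exI[of _ 0], simp)

text \<open>On the curve \<open>u ^ (2 * \<beta>)\<close> is at most 1 and
  \<open>v ^ (2 * \<alpha>)\<close> at most \<alpha>; as \<alpha> is at least 1, one crude bound
  serves both coordinates.\<close>

lemma trig_curve_bounded:
  fixes u v :: real and \<alpha> \<beta> :: nat
  assumes "real \<alpha> * u ^ (2 * \<beta>) + real \<beta> * v ^ (2 * \<alpha>) = real \<alpha>" "\<alpha> > 0" "\<beta> > 0"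
  shows "\<bar>u\<bar> \<le> real \<alpha> \<and> \<bar>v\<bar> \<le> real \<alpha>"
proof -
  have le: "\<bar>x\<bar> \<le> real \<alpha>" if "x ^ (2 * n) \<le> real \<alpha>" "n > 0" for x :: real and n :: nat
  proof (cases "1 \<le> \<bar>x\<bar>")
    case True
    have "\<bar>x\<bar> ^ 1 \<le> \<bar>x\<bar> ^ (2 * n)" using True that(2) by (intro power_increasing) auto
    then show ?thesis using that(1) by (simp add: power_mult)
  next
    case False
    then show ?thesis using assms(2) by linarith
  qed
  have nonneg: "0 \<le> real \<alpha> * u ^ (2 * \<beta>)" "0 \<le> real \<beta> * v ^ (2 * \<alpha>)" by simp_all
  have "real \<alpha> * u ^ (2 * \<beta>) \<le> real \<alpha> * 1" using assms(1) nonneg by linarith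
  then have "u ^ (2 * \<beta>) \<le> 1" using assms(2) by (simp only: mult_le_cancel_left_pos of_nat_0_less_iff)
  then have "u ^ (2 * \<beta>) \<le> real \<alpha>" using assms(2) by linarith
  moreover have "1 * v ^ (2 * \<alpha>) \<le> real \<beta> * v ^ (2 * \<alpha>)"
    using assms(3) by (intro mult_right_mono) auto
  then have "v ^ (2 * \<alpha>) \<le> real \<alpha>" using assms(1) nonneg by linarith
  ultimately show ?thesis using le assms(2,3) by blast
qed

text \<open>Both solutions stay in a bounded square, where the powers are Lipschitz, so the squared
  distance \<open>W\<close> satisfies
  \<open>\<bar>W'\<bar> \<le> \<bar>\<omega>\<bar> * (L1 + L2) * W\<close> and Gronwall applies. The
  factor \<omega> admits motion along the closed curve at variable speed.\<close>

lemma trig_system_unique: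
  fixes u v U V \<omega> :: "real \<Rightarrow> real"
  assumes pos: "\<alpha> > 0" "\<beta> > 0" and \<omega>: "continuous_on UNIV \<omega>"
    and u: "\<And>t. (u has_real_derivative - \<omega> t * v t ^ (2 * \<alpha> - 1)) (at t)"
    and v: "\<And>t. (v has_real_derivative \<omega> t * u t ^ (2 * \<beta> - 1)) (at t)"
    and U: "\<And>t. (U has_real_derivative - \<omega> t * V t ^ (2 * \<alpha> - 1)) (at t)"
    and V: "\<And>t. (V has_real_derivative \<omega> t * U t ^ (2 * \<beta> - 1)) (at t)"
    and uv: "\<And>t. real \<alpha> * u t ^ (2 * \<beta>) + real \<beta> * v t ^ (2 * \<alpha>) = real \<alpha>"
    and UV: "\<And>t. real \<alpha> * U t ^ (2 * \<beta>) + real \<beta> * V t ^ (2 * \<alpha>) = real \<alpha>"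
    and init: "u a = U a" "v a = V a"
  shows "u t = U t" "v t = V t"
proof -
  obtain L1 where L1: "0 \<le> L1" "\<And>x y. \<bar>x\<bar> \<le> real \<alpha> \<Longrightarrow> \<bar>y\<bar> \<le> real \<alpha> \<Longrightarrow>
      \<bar>x ^ (2 * \<alpha> - 1) - y ^ (2 * \<alpha> - 1)\<bar> \<le> L1 * \<bar>x - y\<bar>"
    using power_lipschitz by meson
  obtain L2 where L2: "0 \<le> L2" "\<And>x y. \<bar>x\<bar> \<le> real \<alpha> \<Longrightarrow> \<bar>y\<bar> \<le> real \<alpha> \<Longrightarrow>
      \<bar>x ^ (2 * \<beta> - 1) - y ^ (2 * \<beta> - 1)\<bar> \<le> L2 * \<bar>x - y\<bar>"
    using power_lipschitz by meson
  note bd = trig_curve_bounded[OF uv pos] trig_curve_bounded[OF UV pos]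
  define W where "W t = (u t - U t)\<^sup>2 + (v t - V t)\<^sup>2" for t
  define W' where "W' t = 2 * \<omega> t * ((v t - V t) * (u t ^ (2 * \<beta> - 1) - U t ^ (2 * \<beta> - 1)) -
    (u t - U t) * (v t ^ (2 * \<alpha> - 1) - V t ^ (2 * \<alpha> - 1)))" for t
  have "W t = 0"
  proof (rule gronwall_zero[where W = W and a = a and k = "\<lambda>t. \<bar>\<omega> t\<bar> * (L1 + L2)" and W' = W'])
    show "(W has_real_derivative W' t) (at t)" for t
      unfolding W_def W'_def
      by (auto intro!: derivative_eq_intros u v U V simp: algebra_simps)
    show "0 \<le> W t" for t by (simp add: W_def)
    show "W a = 0" by (simp add: W_def init)
    show "continuous_on UNIV (\<lambda>t. \<bar>\<omega> t\<bar> * (L1 + L2))" by (intro continuous_intros \<omega>)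
    fix t
    let ?x = "u t - U t" and ?y = "v t - V t"
    have "\<bar>?y * (u t ^ (2 * \<beta> - 1) - U t ^ (2 * \<beta> - 1)) - ?x * (v t ^ (2 * \<alpha> - 1) - V t ^ (2 * \<alpha> - 1))\<bar>
      \<le> \<bar>?y\<bar> * \<bar>u t ^ (2 * \<beta> - 1) - U t ^ (2 * \<beta> - 1)\<bar> + \<bar>?x\<bar> * \<bar>v t ^ (2 * \<alpha> - 1) - V t ^ (2 * \<alpha> - 1)\<bar>"
      unfolding abs_mult[symmetric] by (rule abs_triangle_ineq4)
    also have "\<dots> \<le> \<bar>?y\<bar> * (L2 * \<bar>?x\<bar>) + \<bar>?x\<bar> * (L1 * \<bar>?y\<bar>)"
      using bd by (intro add_mono mult_left_mono L1 L2) auto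
    also have "\<dots> = (L1 + L2) * (\<bar>?x\<bar> * \<bar>?y\<bar>)" by (simp add: algebra_simps)
    finally have "\<bar>W' t\<bar> \<le> \<bar>2 * \<omega> t\<bar> * ((L1 + L2) * (\<bar>?x\<bar> * \<bar>?y\<bar>))"
      unfolding W'_def abs_mult[of "2 * \<omega> t"] by (intro mult_left_mono) auto
    also have "\<dots> = \<bar>\<omega> t\<bar> * (L1 + L2) * (2 * \<bar>?x\<bar> * \<bar>?y\<bar>)" by (simp add: abs_mult)
    also have "\<dots> \<le> \<bar>\<omega> t\<bar> * (L1 + L2) * W t"
      using sum_squares_bound[of "\<bar>?x\<bar>" "\<bar>?y\<bar>"] L1 L2
      by (intro mult_left_mono) (auto simp: W_def)
    finally show "\<bar>W' t\<bar> \<le> \<bar>\<omega> t\<bar> * (L1 + L2) * W t" .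
  qed
  then show "u t = U t" "v t = V t" by (simp_all add: W_def sum_power2_eq_zero_iff)
qed

text \<open>The speed of the angle has to be \<open>u * v' - \<beta> / \<alpha> * v * u'\<close>, as
  the conserved quantity shows for \<open>Cs\<close> and \<open>Sn\<close>. Integrating it defines
  \<theta>; tangency to the level curve then makes \<open>(u, v)\<close> and
  \<open>(Cs \<theta>, Sn \<theta>)\<close> solutions of one system with equal initial
  values.\<close>

lemma pl_trig_angle_lift:
  fixes u v u' v' :: "real \<Rightarrow> real"
  assumes trig: "pl_trig \<alpha> \<beta> Cs Sn T" and pos: "\<alpha> > 0" "\<beta> > 0"
    and u: "\<And>t. (u has_real_derivative u' t) (at t)" and v: "\<And>t. (v has_real_derivative v' t) (at t)"
    and cont: "continuous_on UNIV u'" "continuous_on UNIV v'"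
    and curve: "\<And>t. real \<alpha> * u t ^ (2 * \<beta>) + real \<beta> * v t ^ (2 * \<alpha>) = real \<alpha>"
    and init: "u a = Cs \<theta>0" "v a = Sn \<theta>0"
  shows "\<exists>\<theta> \<theta>'. \<forall>t. (\<theta> has_real_derivative \<theta>' t) (at t) \<and> u t = Cs (\<theta> t) \<and> v t = Sn (\<theta> t)"
proof -
  define \<omega> where "\<omega> t = u t * v' t - real \<beta> / real \<alpha> * v t * u' t" for t
  have contuv: "continuous_on UNIV u" "continuous_on UNIV v"
    using u v DERIV_isCont continuous_at_imp_continuous_on by blast+
  have \<omega>: "continuous_on UNIV \<omega>"
    unfolding \<omega>_def using pos by (intro continuous_intros contuv cont)
  obtain \<Theta> where \<Theta>: "\<And>t. (\<Theta> has_real_derivative \<omega> t) (at t)"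
    using ex_antiderivative_real[OF \<omega>] by blast
  define \<theta> where "\<theta> t = \<Theta> t - \<Theta> a + \<theta>0" for t
  have \<theta>: "(\<theta> has_real_derivative \<omega> t) (at t)" for t
    unfolding \<theta>_def by (auto intro!: derivative_eq_intros \<Theta>)
  have u2: "u t ^ (2 * \<beta>) = u t * u t ^ (2 * \<beta> - 1)" and v2: "v t ^ (2 * \<alpha>) = v t * v t ^ (2 * \<alpha> - 1)" for t
    using pos by (simp_all flip: power_Suc)
  have tangent: "u t ^ (2 * \<beta> - 1) * u' t + v t ^ (2 * \<alpha> - 1) * v' t = 0" for t
  proof -
    have "((\<lambda>t. real \<alpha> * u t ^ (2 * \<beta>) + real \<beta> * v t ^ (2 * \<alpha>)) has_real_derivative
        2 * real \<alpha> * real \<beta> * (u t ^ (2 * \<beta> - 1) * u' t + v t ^ (2 * \<alpha> - 1) * v' t)) (at t)"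
      by (auto intro!: derivative_eq_intros u v simp: algebra_simps)
    moreover have "((\<lambda>t. real \<alpha> * u t ^ (2 * \<beta>) + real \<beta> * v t ^ (2 * \<alpha>)) has_real_derivative 0) (at t)"
      unfolding curve by simp
    ultimately have "2 * real \<alpha> * real \<beta> * (u t ^ (2 * \<beta> - 1) * u' t + v t ^ (2 * \<alpha> - 1) * v' t) = 0"
      by (rule DERIV_unique)
    then show ?thesis using pos by simp
  qed
  have u'_eq: "u' t = - \<omega> t * v t ^ (2 * \<alpha> - 1)" for t
  proof -
    have "real \<alpha> * (- \<omega> t * v t ^ (2 * \<alpha> - 1)) = - real \<alpha> * u t * (v t ^ (2 * \<alpha> - 1) * v' t) +
        real \<beta> * (v t * v t ^ (2 * \<alpha> - 1)) * u' t"
      using pos by (simp add: \<omega>_def field_simps)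
    also have "v t ^ (2 * \<alpha> - 1) * v' t = - (u t ^ (2 * \<beta> - 1) * u' t)" using tangent[of t] by simp
    also have "- real \<alpha> * u t * - (u t ^ (2 * \<beta> - 1) * u' t) + real \<beta> * (v t * v t ^ (2 * \<alpha> - 1)) * u' t =
        (real \<alpha> * u t ^ (2 * \<beta>) + real \<beta> * v t ^ (2 * \<alpha>)) * u' t"
      unfolding u2 v2 by (simp add: algebra_simps)
    finally have "real \<alpha> * (- \<omega> t * v t ^ (2 * \<alpha> - 1)) = real \<alpha> * u' t" unfolding curve .
    then show ?thesis using pos mult_left_cancel[of "real \<alpha>"] by fastforce
  qed
  have v'_eq: "v' t = \<omega> t * u t ^ (2 * \<beta> - 1)" for t
  proof -
    have "real \<alpha> * (\<omega> t * u t ^ (2 * \<beta> - 1)) = real \<alpha> * (u t * u t ^ (2 * \<beta> - 1)) * v' t -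
        real \<beta> * v t * (u t ^ (2 * \<beta> - 1) * u' t)"
      using pos by (simp add: \<omega>_def field_simps)
    also have "u t ^ (2 * \<beta> - 1) * u' t = - (v t ^ (2 * \<alpha> - 1) * v' t)" using tangent[of t] by simp
    also have "real \<alpha> * (u t * u t ^ (2 * \<beta> - 1)) * v' t - real \<beta> * v t * - (v t ^ (2 * \<alpha> - 1) * v' t) =
        (real \<alpha> * u t ^ (2 * \<beta>) + real \<beta> * v t ^ (2 * \<alpha>)) * v' t"
      unfolding u2 v2 by (simp add: algebra_simps)
    finally show ?thesis unfolding curve using pos by simp
  qed
  have "u t = Cs (\<theta> t) \<and> v t = Sn (\<theta> t)" for t
  proof -
    have C: "((\<lambda>t. Cs (\<theta> t)) has_real_derivative - \<omega> s * Sn (\<theta> s) ^ (2 * \<alpha> - 1)) (at s)"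
     and S: "((\<lambda>t. Sn (\<theta> t)) has_real_derivative \<omega> s * Cs (\<theta> s) ^ (2 * \<beta> - 1)) (at s)" for s
      using DERIV_chain2[OF pl_trig_deriv(1)[OF trig] \<theta>[of s]]
        DERIV_chain2[OF pl_trig_deriv(2)[OF trig] \<theta>[of s]] by (simp_all add: mult.commute)
    show ?thesis
      using trig_system_unique[OF pos \<omega> u[unfolded u'_eq] v[unfolded v'_eq] C S curve
          pl_trig_conserved[OF trig pos], of a t] init by (simp add: \<theta>_def)
  qed
  then show ?thesis using \<theta> by blast
qed

text \<open>By uniqueness, the remainder of \<open>a - b\<close> modulo \<open>T\<close> would be a
  common period if it were positive, but \<open>T\<close> is the least one.\<close>

lemma pl_trig_eq_imp:
  assumes trig: "pl_trig \<alpha> \<beta> Cs Sn T" and pos: "\<alpha> > 0" "\<beta> > 0"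
    and eq: "Cs a = Cs b" "Sn a = Sn b"
  shows "\<exists>k::int. a = b + of_int k * T"
proof -
  have T: "0 < T" and per: "Cs (t + T) = Cs t" "Sn (t + T) = Sn t"
    and least: "common_period Cs Sn T' \<Longrightarrow> T \<le> T'" for t T'
    using trig by (auto simp: pl_trig_def common_period_def)
  define k where "k = \<lfloor>(a - b) / T\<rfloor>"
  define s where "s = a - b - of_int k * T"
  have s: "0 \<le> s" "s < T"
    using floor_divide_lower[OF T, of "a - b"] floor_divide_upper[OF T, of "a - b"]
    by (simp_all add: s_def k_def algebra_simps)
  have bs: "b + s = a + of_int (- k) * T" by (simp add: s_def)
  have init: "Cs (b + s) = Cs b" "Sn (b + s) = Sn b"
    unfolding bs using quasiperiodic_shift[of Cs T 0 a "- k"] quasiperiodic_shift[of Sn T 0 a "- k"] per eq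
    by simp_all
  have "Cs (t + s) = Cs t \<and> Sn (t + s) = Sn t" for t
  proof -
    have C: "((\<lambda>t. Cs (t + s)) has_real_derivative - 1 * Sn (t + s) ^ (2 * \<alpha> - 1)) (at t)"
     and S: "((\<lambda>t. Sn (t + s)) has_real_derivative 1 * Cs (t + s) ^ (2 * \<beta> - 1)) (at t)"
     and C0: "(Cs has_real_derivative - 1 * Sn t ^ (2 * \<alpha> - 1)) (at t)"
     and S0: "(Sn has_real_derivative 1 * Cs t ^ (2 * \<beta> - 1)) (at t)" for t
      using pl_trig_deriv[OF trig, of "t + s"] pl_trig_deriv[OF trig, of t] by (simp_all add: DERIV_shift)
    show ?thesis
      using trig_system_unique[OF pos continuous_on_const C S C0 S0 pl_trig_conserved[OF trig pos]
          pl_trig_conserved[OF trig pos], of b t] init by simp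
  qed
  then have "\<not> 0 < s" using least[of s] s(2) by (auto simp: common_period_def)
  then have "a = b + of_int k * T" using s(1) by (simp add: s_def)
  then show ?thesis ..
qed

text \<open>Separation of variables: an antiderivative \<open>S\<close> of
  \<open>1 / \<Lambda>\<close> is injective, changes by a nonzero amount in each period and is thus
  onto, so its inverse is a solution for all times.\<close>

lemma ex_time_change:
  fixes \<Lambda> :: "real \<Rightarrow> real"
  assumes cont: "continuous_on UNIV \<Lambda>" and nz: "\<And>x. \<Lambda> x \<noteq> 0" and per: "\<And>x. \<Lambda> (x + P) = \<Lambda> x" and P: "0 < P"
  shows "\<exists>\<psi> \<tau> (j::int). 0 < \<tau> \<and> (\<forall>t. (\<psi> has_real_derivative \<Lambda> (\<psi> t)) (at t)) \<and>
    (\<forall>t. \<psi> (t + \<tau>) = \<psi> t + of_int j * P) \<and> surj \<psi>"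
proof -
  have cont': "continuous_on UNIV (\<lambda>x. 1 / \<Lambda> x)"
    using cont nz by (intro continuous_intros) auto
  then obtain S where S: "\<And>x. (S has_real_derivative 1 / \<Lambda> x) (at x)"
    using ex_antiderivative_real by blast
  define c where "c = S P - S 0"
  have S_per: "S (x + P) = S x + c" for x
    unfolding c_def by (rule antiderivative_periodic[OF S]) (simp add: per)
  have contS: "continuous_on A S" for A
    using S DERIV_isCont continuous_at_imp_continuous_on by blast
  have mono: "S x \<noteq> S y" if "x < y" for x y
  proof -
    consider "\<And>x. 0 < 1 / \<Lambda> x" | "\<And>x. 1 / \<Lambda> x < 0"
      using nonvanishing_sign[OF cont'] nz by auto
    then show ?thesis
    proof cases
      case 1
      then have "S x < S y" using DERIV_pos_imp_increasing[OF that, of S] S by blast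
      then show ?thesis by simp
    next
      case 2
      then have "S y < S x" using DERIV_neg_imp_decreasing[OF that, of S] S by blast
      then show ?thesis by simp
    qed
  qed
  then have inj: "inj S" by (intro injI) (metis linorder_neqE)
  have "c \<noteq> 0" unfolding c_def using mono[OF P] by simp
  have "surj S" by (rule quasiperiodic_surj[where q = S, OF contS S_per \<open>c \<noteq> 0\<close>])
  define \<psi> where "\<psi> = inv S"
  have S\<psi>: "S (\<psi> t) = t" and \<psi>S: "\<psi> (S x) = x" for t x
    unfolding \<psi>_def using \<open>surj S\<close> inj by (simp_all add: surj_f_inv_f)
  have \<psi>: "(\<psi> has_real_derivative \<Lambda> (\<psi> t)) (at t)" for t
  proof -
    have "(\<psi> has_derivative (*) (\<Lambda> (\<psi> t))) (at (S (\<psi> t)))"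
    proof (rule has_derivative_inverse_strong[OF open_UNIV UNIV_I contS])
      show "\<psi> (S x) = x" for x by (rule \<psi>S)
      show "(S has_derivative (*) (1 / \<Lambda> (\<psi> t))) (at (\<psi> t))"
        using S by (simp add: has_field_derivative_def)
      show "(*) (1 / \<Lambda> (\<psi> t)) \<circ> (*) (\<Lambda> (\<psi> t)) = id" using nz by auto
    qed
    then show ?thesis by (simp add: has_field_derivative_def S\<psi>)
  qed
  \<comment> \<open>For negative \<Lambda> the solution moves backwards, by one period in the time
    \<open>\<bar>c\<bar>\<close>.\<close>
  define j :: int where "j = (if 0 < c then 1 else - 1)"
  have "\<psi> (t + \<bar>c\<bar>) = \<psi> t + of_int j * P" for t
  proof -
    have "S (\<psi> t + of_int j * P) = t + of_int j * c"
      by (simp add: quasiperiodic_shift[where q = S, OF S_per] S\<psi>)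
    also have "of_int j * c = \<bar>c\<bar>" by (simp add: j_def)
    finally show ?thesis using \<psi>S by metis
  qed
  moreover have "surj \<psi>" using \<psi>S by (metis surjI)
  moreover have "0 < \<bar>c\<bar>" using \<open>c \<noteq> 0\<close> by simp
  ultimately show ?thesis using \<psi> by blast
qed

subsection \<open>Weighted polar coordinates\<close>

text \<open>The value 1 characterises \<open>x = e\<^sup>A\<^sup>s cos \<phi>\<close>, \<open>y = e\<^sup>B\<^sup>s sin \<phi>\<close> for some \<open>\<phi>\<close>.\<close>

definition weighted_radius_eq :: "real \<Rightarrow> real \<Rightarrow> real \<Rightarrow> real \<Rightarrow> real \<Rightarrow> real" where
  "weighted_radius_eq A B x y s = (x * exp (- (A * s)))\<^sup>2 + (y * exp (- (B * s)))\<^sup>2"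

lemma weighted_radius_eq_strict:
  assumes "A > 0" "B > 0" "(x, y) \<noteq> (0, 0)" "s < s'"
  shows "weighted_radius_eq A B x y s' < weighted_radius_eq A B x y s"
proof -
  have lt: "(exp (- (c * s')))\<^sup>2 < (exp (- (c * s)))\<^sup>2" if "0 < c" for c :: real
    using that assms(4) by (intro power_strict_mono) auto
  have le: "z\<^sup>2 * (exp (- (c * s')))\<^sup>2 \<le> z\<^sup>2 * (exp (- (c * s)))\<^sup>2" if "0 < c" for c z
    by (rule mult_left_mono[OF less_imp_le[OF lt[OF that]]]) simp
  have less: "z\<^sup>2 * (exp (- (c * s')))\<^sup>2 < z\<^sup>2 * (exp (- (c * s)))\<^sup>2" if "0 < c" "z \<noteq> 0" for c z
    by (rule mult_strict_left_mono[OF lt[OF that(1)]]) (use that in simp)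
  show ?thesis
  proof (cases "x = 0")
    case True
    then have "y \<noteq> 0" using assms(3) by simp
    then show ?thesis
      unfolding weighted_radius_eq_def power_mult_distrib
      by (intro add_le_less_mono le less assms)
  next
    case False
    then show ?thesis
      unfolding weighted_radius_eq_def power_mult_distrib
      by (intro add_less_le_mono le less assms)
  qed
qed

lemma weighted_radius_eq_inj:
  assumes "A > 0" "B > 0" "(x, y) \<noteq> (0, 0)" "weighted_radius_eq A B x y s = weighted_radius_eq A B x y s'"
  shows "s = s'"
  using weighted_radius_eq_strict[OF assms(1-3), of s s'] weighted_radius_eq_strict[OF assms(1-3), of s' s]
    assms(4) by (metis linorder_neqE less_irrefl)

text \<open>At \<open>s = ln \<bar>z\<bar> / c\<close> the summand of a nonzero coordinate
  \<open>z\<close> with weight \<open>c\<close> is 1, and for large \<open>s\<close> everything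
  tends to 0.\<close>

lemma ex_weighted_radius:
  assumes AB: "A > 0" "B > 0" and xy: "(x, y) \<noteq> (0, 0)"
  shows "\<exists>s. weighted_radius_eq A B x y s = 1"
proof -
  let ?E = "weighted_radius_eq A B x y"
  have cont: "continuous_on S ?E" for S
    unfolding weighted_radius_eq_def by (intro continuous_intros)
  have one: "(z * exp (- (c * (ln \<bar>z\<bar> / c))))\<^sup>2 = 1" if "z \<noteq> 0" "c > 0" for z c :: real
    using that by (simp add: exp_minus power_mult_distrib power_inverse)
  have "\<exists>s. 1 \<le> ?E s"
  proof (cases "x = 0")
    case True
    then show ?thesis using one[OF _ AB(2), of y] xy
      by (intro exI[of _ "ln \<bar>y\<bar> / B"]) (simp add: weighted_radius_eq_def)
  next
    case False
    then show ?thesis using one[OF _ AB(1), of x]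
      by (intro exI[of _ "ln \<bar>x\<bar> / A"]) (simp add: weighted_radius_eq_def)
  qed
  then obtain s1 where s1: "1 \<le> ?E s1" by blast
  have lim: "((\<lambda>s. exp (- (c * s))) \<longlongrightarrow> 0) at_top" if "c > 0" for c :: real
  proof (rule filterlim_compose[OF exp_at_bot])
    have "filterlim (\<lambda>s. c * s) at_top at_top"
      by (rule filterlim_tendsto_pos_mult_at_top[OF tendsto_const that filterlim_ident])
    then show "filterlim (\<lambda>s. - (c * s)) at_bot at_top" by (simp add: filterlim_uminus_at_top)
  qed
  have "(?E \<longlongrightarrow> (x * 0)\<^sup>2 + (y * 0)\<^sup>2) at_top"
    unfolding weighted_radius_eq_def by (intro tendsto_intros lim AB)
  then have "\<forall>\<^sub>F s in at_top. ?E s < 1" by (intro order_tendstoD(2)[of _ 0]) auto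
  then have "\<forall>\<^sub>F s in at_top. ?E s < 1 \<and> s1 \<le> s" using eventually_ge_at_top eventually_conj by blast
  then obtain s2 where "?E s2 < 1" "s1 \<le> s2" by (auto dest: eventually_happens)
  then show ?thesis using IVT2'[of ?E s2 1 s1] s1 cont[of "{s1..s2}"] by auto
qed

text \<open>The implicit function theorem in the form of an inverse map: \<open>E\<close> keeps the
  time and replaces \<open>s\<close> by the weighted radius. It is injective, its derivative is
  triangular with the nonzero entry \<open>Es\<close>, and \<sigma> is the first component of its
  inverse along \<open>(1, t)\<close>.\<close>

lemma weighted_radius_lift:
  fixes x y x' y' :: "real \<Rightarrow> real"
  assumes AB: "A > 0" "B > 0"
    and x: "\<And>t. (x has_real_derivative x' t) (at t)" and y: "\<And>t. (y has_real_derivative y' t) (at t)"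
    and cont: "continuous_on UNIV x'" "continuous_on UNIV y'"
    and nz: "\<And>t. (x t, y t) \<noteq> (0, 0)"
  shows "\<exists>\<sigma> \<sigma>'. continuous_on UNIV \<sigma>' \<and>
    (\<forall>t. weighted_radius_eq A B (x t) (y t) (\<sigma> t) = 1 \<and> (\<sigma> has_real_derivative \<sigma>' t) (at t))"
proof -
  define \<sigma> where "\<sigma> t = (SOME s. weighted_radius_eq A B (x t) (y t) s = 1)" for t
  have \<sigma>: "weighted_radius_eq A B (x t) (y t) (\<sigma> t) = 1" for t
    unfolding \<sigma>_def using someI_ex[OF ex_weighted_radius[OF AB nz]] .
  define Et where "Et s t = 2 * (x t * exp (- (A * s))) * (x' t * exp (- (A * s))) +
      2 * (y t * exp (- (B * s))) * (y' t * exp (- (B * s)))" for s t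
  define Es where "Es s t = - 2 * A * (x t * exp (- (A * s)))\<^sup>2 - 2 * B * (y t * exp (- (B * s)))\<^sup>2" for s t
  have Es: "Es s t \<noteq> 0" for s t
  proof -
    have "0 < A * (x t * exp (- (A * s)))\<^sup>2 + B * (y t * exp (- (B * s)))\<^sup>2"
    proof (cases "x t = 0")
      case True
      then have "y t \<noteq> 0" using nz[of t] by simp
      then show ?thesis using AB by (intro add_nonneg_pos) auto
    next
      case False
      then show ?thesis using AB by (intro add_pos_nonneg) auto
    qed
    then show ?thesis by (simp add: Es_def)
  qed
  define E where "E z = (weighted_radius_eq A B (x (snd z)) (y (snd z)) (fst z), snd z)" for z :: "real \<times> real"
  have inj: "inj E"
    using weighted_radius_eq_inj[OF AB nz] by (intro injI) (auto simp: E_def prod_eq_iff)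
  have snd_comp: "((\<lambda>z. h (snd z)) has_derivative (\<lambda>z. h' * snd z)) (at z)"
    if "(h has_real_derivative h') (at (snd z))" for h h' and z :: "real \<times> real"
    by (rule has_derivative_compose[of snd snd z UNIV h "(*) h'"])
      (use that in \<open>auto intro!: derivative_intros simp: has_field_derivative_def\<close>)
  have der: "(E has_derivative (\<lambda>z. (Es s t * fst z + Et s t * snd z, snd z))) (at (s, t))" for s t
    unfolding E_def weighted_radius_eq_def Es_def Et_def
    by (auto intro!: derivative_eq_intros snd_comp[OF x] snd_comp[OF y] simp: algebra_simps power2_eq_square)
  have contE: "continuous_on UNIV E"
  proof (intro continuous_at_imp_continuous_on ballI)
    fix z show "isCont E z" by (cases z) (simp only: has_derivative_continuous[OF der])
  qed
  have inv_der: "(inv E has_derivative (\<lambda>z. ((fst z - Et s t * snd z) / Es s t, snd z))) (at (E (s, t)))" for s t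
    by (rule has_derivative_inverse_strong[OF open_UNIV UNIV_I contE _ der])
      (use inj Es in \<open>auto simp: fun_eq_iff\<close>)
  have E\<sigma>: "E (\<sigma> t, t) = (1, t)" for t by (simp add: E_def \<sigma>)
  then have \<sigma>_eq: "\<sigma> t = fst (inv E (1, t))" for t using inj by (metis fst_conv inv_f_f)
  define \<sigma>' where "\<sigma>' t = - Et (\<sigma> t) t / Es (\<sigma> t) t" for t
  have \<sigma>_der: "(\<sigma> has_real_derivative \<sigma>' t) (at t)" for t
  proof -
    have "((\<lambda>t. (1, t)) has_derivative (\<lambda>b. (0, b))) (at t)" by (auto intro!: derivative_eq_intros)
    from has_derivative_compose[OF this inv_der[of "\<sigma> t" t, unfolded E\<sigma>]]
    have "((\<lambda>t. inv E (1, t)) has_derivative (\<lambda>b. ((0 - Et (\<sigma> t) t * b) / Es (\<sigma> t) t, b))) (at t)"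
      by simp
    from has_derivative_fst[OF this]
    have "(\<sigma> has_derivative (\<lambda>b. - (Et (\<sigma> t) t * b / Es (\<sigma> t) t))) (at t)"
      by (simp flip: \<sigma>_eq)
    then show ?thesis by (rule has_derivative_imp_has_field_derivative) (simp add: \<sigma>'_def)
  qed
  have c: "continuous_on UNIV x" "continuous_on UNIV y" "continuous_on UNIV \<sigma>"
    by (rule DERIV_continuous_on_all[OF x] DERIV_continuous_on_all[OF y] DERIV_continuous_on_all[OF \<sigma>_der])+
  have "continuous_on UNIV \<sigma>'"
  proof -
    have "continuous_on UNIV (\<lambda>t. Et (\<sigma> t) t)" "continuous_on UNIV (\<lambda>t. Es (\<sigma> t) t)"
      unfolding Et_def Es_def by (intro continuous_intros c cont)+
    then show ?thesis
      unfolding \<sigma>'_def using Es by (intro continuous_on_divide continuous_on_minus) auto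
  qed
  then show ?thesis using \<sigma> \<sigma>_der by blast
qed

text \<open>Removing the factors \<open>exp (A * \<sigma>)\<close> and
  \<open>exp (B * \<sigma>)\<close> leaves a curve on the unit circle, for which
  \<open>pl_trig_angle_lift\<close> with \<open>cos\<close> and \<open>sin\<close> provides the
  angle.\<close>

lemma weighted_polar_lift:
  fixes x y x' y' :: "real \<Rightarrow> real"
  assumes AB: "A > 0" "B > 0"
    and x: "\<And>t. (x has_real_derivative x' t) (at t)" and y: "\<And>t. (y has_real_derivative y' t) (at t)"
    and cont: "continuous_on UNIV x'" "continuous_on UNIV y'"
    and nz: "\<And>t. (x t, y t) \<noteq> (0, 0)"
  shows "\<exists>\<phi> \<sigma> \<phi>' \<sigma>'. \<forall>t. (\<phi> has_real_derivative \<phi>' t) (at t) \<and> (\<sigma> has_real_derivative \<sigma>' t) (at t) \<and>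
    x t = exp (A * \<sigma> t) * cos (\<phi> t) \<and> y t = exp (B * \<sigma> t) * sin (\<phi> t)"
proof -
  obtain \<sigma> \<sigma>' where \<sigma>': "continuous_on UNIV \<sigma>'" and \<sigma>: "\<And>t. (\<sigma> has_real_derivative \<sigma>' t) (at t)"
    and one: "\<And>t. weighted_radius_eq A B (x t) (y t) (\<sigma> t) = 1"
    using weighted_radius_lift[OF assms] by blast
  define u v where "u t = x t * exp (- (A * \<sigma> t))" and "v t = y t * exp (- (B * \<sigma> t))" for t
  define u' v' where "u' t = (x' t - A * \<sigma>' t * x t) * exp (- (A * \<sigma> t))"
    and "v' t = (y' t - B * \<sigma>' t * y t) * exp (- (B * \<sigma> t))" for t
  have uv: "(u has_real_derivative u' t) (at t)" "(v has_real_derivative v' t) (at t)" for t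
    unfolding u_def v_def u'_def v'_def by (auto intro!: derivative_eq_intros x y \<sigma> simp: algebra_simps)
  have c: "continuous_on UNIV x" "continuous_on UNIV y" "continuous_on UNIV \<sigma>"
    by (rule DERIV_continuous_on_all[OF x] DERIV_continuous_on_all[OF y] DERIV_continuous_on_all[OF \<sigma>])+
  have cont': "continuous_on UNIV u'" "continuous_on UNIV v'"
    unfolding u'_def v'_def by (intro continuous_intros c cont \<sigma>')+
  have circle: "(u t)\<^sup>2 + (v t)\<^sup>2 = 1" for t
    using one[of t] by (simp add: u_def v_def weighted_radius_eq_def)
  obtain \<theta>0 where "u 0 = cos \<theta>0" "v 0 = sin \<theta>0"
    using sincos_total_2pi[OF circle] by blast
  then obtain \<phi> \<phi>' where \<phi>: "\<And>t. (\<phi> has_real_derivative \<phi>' t) (at t)" "\<And>t. u t = cos (\<phi> t)" "\<And>t. v t = sin (\<phi> t)"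
    using pl_trig_angle_lift[OF pl_trig_1_1 _ _ uv cont', of 0 \<theta>0] circle by auto
  have "x t = exp (A * \<sigma> t) * cos (\<phi> t)" "y t = exp (B * \<sigma> t) * sin (\<phi> t)" for t
    unfolding \<phi>(2,3)[symmetric] u_def v_def by (simp_all add: exp_minus)
  then show ?thesis using \<phi>(1) \<sigma> by blast
qed

text \<open>Cramer's rule for the linear system expressing \<open>(p, q)\<close> by the velocities
  \<open>\<phi>'\<close> and \<open>\<sigma>'\<close>; the factor on the left is its
  determinant.\<close>

lemma weighted_polar_velocity:
  fixes x y :: "real \<Rightarrow> real"
  assumes x: "(x has_real_derivative exp (A * \<sigma> t) * p) (at t)" and y: "(y has_real_derivative exp (B * \<sigma> t) * q) (at t)"
    and \<phi>: "(\<phi> has_real_derivative \<phi>') (at t)" and \<sigma>: "(\<sigma> has_real_derivative \<sigma>') (at t)"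
    and xy: "\<And>t. x t = exp (A * \<sigma> t) * cos (\<phi> t)" "\<And>t. y t = exp (B * \<sigma> t) * sin (\<phi> t)"
  shows "\<phi>' * (A * (cos (\<phi> t))\<^sup>2 + B * (sin (\<phi> t))\<^sup>2) = A * cos (\<phi> t) * q - B * sin (\<phi> t) * p"
    and "\<sigma>' * (A * (cos (\<phi> t))\<^sup>2 + B * (sin (\<phi> t))\<^sup>2) = cos (\<phi> t) * p + sin (\<phi> t) * q"
proof -
  let ?C = "cos (\<phi> t)" and ?S = "sin (\<phi> t)"
  have one: "?C\<^sup>2 = 1 - ?S\<^sup>2" by (rule cos_squared_eq)
  have "(x has_real_derivative exp (A * \<sigma> t) * (A * \<sigma>' * ?C - \<phi>' * ?S)) (at t)"
    unfolding xy(1)[abs_def] by (auto intro!: derivative_eq_intros \<phi> \<sigma> simp: algebra_simps)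
  from DERIV_unique[OF x this] have p: "p = A * \<sigma>' * ?C - \<phi>' * ?S" by simp
  have "(y has_real_derivative exp (B * \<sigma> t) * (B * \<sigma>' * ?S + \<phi>' * ?C)) (at t)"
    unfolding xy(2)[abs_def] by (auto intro!: derivative_eq_intros \<phi> \<sigma> simp: algebra_simps)
  from DERIV_unique[OF y this] have q: "q = B * \<sigma>' * ?S + \<phi>' * ?C" by simp
  show "\<phi>' * (A * ?C\<^sup>2 + B * ?S\<^sup>2) = A * ?C * q - B * ?S * p"
    unfolding p q by (simp add: algebra_simps power2_eq_square)
  have "?C * p + ?S * q = \<sigma>' * (A * ?C\<^sup>2 + B * ?S\<^sup>2)"
    unfolding p q by (simp add: algebra_simps power2_eq_square)
  then show "\<sigma>' * (A * ?C\<^sup>2 + B * ?S\<^sup>2) = ?C * p + ?S * q" by simp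
qed

subsection \<open>Quasihomogeneous leading part\<close>

text \<open>The shifts \<open>(a, b)\<close> are \<open>(1, 0)\<close> and \<open>(0, 1)\<close> for
  the two components of a field, so that each estimate is proved once for both.\<close>

definition monomial_sum ::
  "(int \<times> int) set \<Rightarrow> (int \<times> int \<Rightarrow> real) \<Rightarrow> int \<Rightarrow> int \<Rightarrow> real \<Rightarrow> real \<Rightarrow> real" where
  "monomial_sum S k a b x y = (\<Sum>p\<in>S. k p * x ^ nat (fst p + a) * y ^ nat (snd p + b))"

lemma fst_vf: "fst (vf X (x, y)) = monomial_sum (supp X) (\<lambda>p. fst (X p)) 1 0 x y"
  and snd_vf: "snd (vf X (x, y)) = monomial_sum (supp X) (\<lambda>p. snd (X p)) 0 1 x y"
  by (simp_all add: vf_def monomial_sum_def fst_sum snd_sum case_prod_unfold)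

text \<open>Exponents need to be nonnegative only where the coefficient is nonzero: truncation by
  \<open>nat\<close> spoils the scaling law elsewhere, but there the term vanishes.\<close>

lemma monomial_sum_scale:
  assumes "\<forall>p\<in>S. k p \<noteq> 0 \<longrightarrow> 0 \<le> fst p + a \<and> 0 \<le> snd p + b"
  shows "monomial_sum S k a b (exp (A * s) * x) (exp (B * s) * y) =
    exp ((A * of_int a + B * of_int b) * s) *
    (\<Sum>p\<in>S. exp ((A * of_int (fst p) + B * of_int (snd p)) * s) *
       (k p * x ^ nat (fst p + a) * y ^ nat (snd p + b)))"
proof -
  have "k p * (exp (A * s) * x) ^ nat (fst p + a) * (exp (B * s) * y) ^ nat (snd p + b) =
      exp ((A * of_int a + B * of_int b) * s) * (exp ((A * of_int (fst p) + B * of_int (snd p)) * s) *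
       (k p * x ^ nat (fst p + a) * y ^ nat (snd p + b)))" if p: "p \<in> S" for p
  proof (cases "k p = 0")
    case False
    have "exp (A * s) ^ nat (fst p + a) = exp (of_int (fst p + a) * (A * s))"
      "exp (B * s) ^ nat (snd p + b) = exp (of_int (snd p + b) * (B * s))"
      using assms p False by (simp_all flip: exp_of_nat_mult)
    then have "k p * (exp (A * s) * x) ^ nat (fst p + a) * (exp (B * s) * y) ^ nat (snd p + b) =
        exp (of_int (fst p + a) * (A * s)) * exp (of_int (snd p + b) * (B * s)) *
        (k p * x ^ nat (fst p + a) * y ^ nat (snd p + b))"
      by (simp add: power_mult_distrib)
    also have "exp (of_int (fst p + a) * (A * s)) * exp (of_int (snd p + b) * (B * s)) =
        exp ((A * of_int a + B * of_int b) * s) * exp ((A * of_int (fst p) + B * of_int (snd p)) * s)"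
      by (simp add: algebra_simps flip: exp_add)
    finally show ?thesis by (simp only: mult.assoc)
  qed simp
  then show ?thesis unfolding monomial_sum_def sum_distrib_left by (rule sum.cong[OF refl])
qed

text \<open>After division by the leading exponential, terms satisfying \<open>P\<close> carry the
  factor 1 and all others a factor of at most \<open>exp (- s)\<close>, because their weight is
  lower by at least 1; the monomials are bounded by 1 on the square.\<close>

lemma monomial_sum_leading:
  assumes exps: "\<forall>p\<in>S. k p \<noteq> 0 \<longrightarrow> 0 \<le> fst p + a \<and> 0 \<le> snd p + b" and fin: "finite S"
    and top: "\<And>p. p \<in> S \<Longrightarrow> P p \<Longrightarrow> A * of_int (fst p) + B * of_int (snd p) = d"
    and rest: "\<And>p. p \<in> S \<Longrightarrow> \<not> P p \<Longrightarrow> A * of_int (fst p) + B * of_int (snd p) \<le> d - 1"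
    and bd: "\<bar>x\<bar> \<le> 1" "\<bar>y\<bar> \<le> 1" "0 \<le> s"
  shows "\<bar>exp (- ((d + A * of_int a + B * of_int b) * s)) * monomial_sum S k a b (exp (A * s) * x) (exp (B * s) * y)
    - monomial_sum {p \<in> S. P p} k a b x y\<bar> \<le> (\<Sum>p\<in>S. \<bar>k p\<bar>) * exp (- s)"
proof -
  let ?m = "\<lambda>p. k p * x ^ nat (fst p + a) * y ^ nat (snd p + b)"
  let ?e = "\<lambda>p. (A * of_int (fst p) + B * of_int (snd p) - d) * s"
  have "exp (- ((d + A * of_int a + B * of_int b) * s)) * monomial_sum S k a b (exp (A * s) * x) (exp (B * s) * y)
      = (\<Sum>p\<in>S. exp (?e p) * ?m p)"
    unfolding monomial_sum_scale[of S k a b A s x B y, OF exps] sum_distrib_left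
  proof (intro sum.cong refl)
    fix p
    have "exp (- ((d + A * of_int a + B * of_int b) * s)) * exp ((A * of_int a + B * of_int b) * s) *
        exp ((A * of_int (fst p) + B * of_int (snd p)) * s) = exp (?e p)"
      by (simp add: algebra_simps flip: exp_add)
    then show "exp (- ((d + A * of_int a + B * of_int b) * s)) * (exp ((A * of_int a + B * of_int b) * s) *
        (exp ((A * of_int (fst p) + B * of_int (snd p)) * s) * ?m p)) = exp (?e p) * ?m p"
      by (simp only: mult.assoc[symmetric])
  qed
  moreover have "monomial_sum {p \<in> S. P p} k a b x y = (\<Sum>p\<in>S. if P p then ?m p else 0)"
    unfolding monomial_sum_def by (rule sum.inter_filter[OF fin])
  ultimately have "exp (- ((d + A * of_int a + B * of_int b) * s)) *
        monomial_sum S k a b (exp (A * s) * x) (exp (B * s) * y) - monomial_sum {p \<in> S. P p} k a b x y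
      = (\<Sum>p\<in>S. exp (?e p) * ?m p - (if P p then ?m p else 0))"
    by (simp add: sum_subtractf)
  also have "\<bar>\<dots>\<bar> \<le> (\<Sum>p\<in>S. \<bar>k p\<bar> * exp (- s))"
  proof (rule order_trans[OF sum_abs], rule sum_mono)
    fix p assume p: "p \<in> S"
    show "\<bar>exp (?e p) * ?m p - (if P p then ?m p else 0)\<bar> \<le> \<bar>k p\<bar> * exp (- s)"
    proof (cases "P p")
      case True
      then show ?thesis using top[OF p] by simp
    next
      case False
      have "?e p \<le> (- 1) * s" using rest[OF p False] bd(3) by (intro mult_right_mono) auto
      then have 1: "exp (?e p) \<le> exp (- s)" by simp
      have "\<bar>x\<bar> ^ nat (fst p + a) * \<bar>y\<bar> ^ nat (snd p + b) \<le> 1 * 1"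
        by (intro mult_mono power_le_one) (use bd in auto)
      then have "\<bar>k p\<bar> * (\<bar>x\<bar> ^ nat (fst p + a) * \<bar>y\<bar> ^ nat (snd p + b)) \<le> \<bar>k p\<bar> * 1"
        by (intro mult_left_mono) auto
      then have 2: "\<bar>?m p\<bar> \<le> \<bar>k p\<bar>" by (simp add: abs_mult power_abs mult.assoc)
      have "exp (?e p) * \<bar>?m p\<bar> \<le> exp (- s) * \<bar>k p\<bar>"
        using 1 2 by (intro mult_mono) auto
      then show ?thesis using False by (simp add: abs_mult mult.commute)
    qed
  qed
  finally show ?thesis by (simp add: sum_distrib_right)
qed

lemma monomial_sum_quasihomogeneous:
  assumes exps: "\<forall>p\<in>S. k p \<noteq> 0 \<longrightarrow> 0 \<le> fst p + a \<and> 0 \<le> snd p + b"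
    and top: "\<And>p. p \<in> S \<Longrightarrow> A * of_int (fst p) + B * of_int (snd p) = d"
  shows "monomial_sum S k a b (exp (A * s) * x) (exp (B * s) * y) =
    exp ((d + A * of_int a + B * of_int b) * s) * monomial_sum S k a b x y"
proof -
  have "(\<Sum>p\<in>S. exp ((A * of_int (fst p) + B * of_int (snd p)) * s) *
      (k p * x ^ nat (fst p + a) * y ^ nat (snd p + b))) = exp (d * s) * monomial_sum S k a b x y"
    unfolding monomial_sum_def sum_distrib_left by (intro sum.cong refl) (simp add: top)
  then show ?thesis
    unfolding monomial_sum_scale[of S k a b A s x B y, OF exps]
    by (simp add: algebra_simps exp_add)
qed

lemma continuous_on_monomial_sum [continuous_intros]:
  assumes "continuous_on U x" "continuous_on U y"
  shows "continuous_on U (\<lambda>t. monomial_sum S k a b (x t) (y t))"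
  unfolding monomial_sum_def using assms by (intro continuous_intros)

lemma monomial_sum_trig_differentiable:
  "\<exists>q'. \<forall>x. ((\<lambda>x. monomial_sum S k a b (cos x) (sin x)) has_real_derivative q' x) (at x)"
  unfolding monomial_sum_def
  by (intro exI allI DERIV_sum) (rule derivative_eq_intros refl)+

lemma polynomial_vf_exponents:
  assumes "polynomial_vf X"
  shows "\<forall>p\<in>S. fst (X p) \<noteq> 0 \<longrightarrow> 0 \<le> fst p + 1 \<and> 0 \<le> snd p + 0"
    and "\<forall>p\<in>S. snd (X p) \<noteq> 0 \<longrightarrow> 0 \<le> fst p + 0 \<and> 0 \<le> snd p + 1"
proof -
  have "fst (X (m, n)) \<noteq> 0 \<Longrightarrow> \<not> (m < - 1 \<or> n \<le> - 1)"
    "snd (X (m, n)) \<noteq> 0 \<Longrightarrow> \<not> (m \<le> - 1 \<or> n < - 1)" for m n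
    using assms by (auto simp: polynomial_vf_def)
  then show "\<forall>p\<in>S. fst (X p) \<noteq> 0 \<longrightarrow> 0 \<le> fst p + 1 \<and> 0 \<le> snd p + 0"
    and "\<forall>p\<in>S. snd (X p) \<noteq> 0 \<longrightarrow> 0 \<le> fst p + 0 \<and> 0 \<le> snd p + 1"
    by (force simp: not_less not_le)+
qed

section \<open>The field and its principal part in weighted polar coordinates\<close>

locale weighted_vf =
  fixes X :: vf_coeffs and A B d :: real
  assumes poly: "polynomial_vf X" and A: "0 < A" and B: "0 < B"
    and upper: "\<And>p. p \<in> supp X \<Longrightarrow> real_pt p \<in> upper_boundary X \<Longrightarrow>
      A * of_int (fst p) + B * of_int (snd p) = d"
    and lower: "\<And>p. p \<in> supp X \<Longrightarrow> real_pt p \<notin> upper_boundary X \<Longrightarrow>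
      A * of_int (fst p) + B * of_int (snd p) \<le> d - 1"
begin

abbreviation "Y \<equiv> upper_principal_part X"

lemma supp_Y: "supp Y = {p \<in> supp X. real_pt p \<in> upper_boundary X}"
  by (auto simp: supp_def upper_principal_part_def)

lemma poly_Y: "polynomial_vf Y"
  using poly unfolding polynomial_vf_def supp_Y by (auto simp: upper_principal_part_def)

lemma finite_supp: "finite (supp X)"
  using poly by (simp add: polynomial_vf_def)

lemma monomial_sum_Y:
  "monomial_sum (supp Y) (\<lambda>p. h (Y p)) a b x y =
    monomial_sum {p \<in> supp X. real_pt p \<in> upper_boundary X} (\<lambda>p. h (X p)) a b x y"
  unfolding monomial_sum_def supp_Y by (intro sum.cong refl) (simp add: upper_principal_part_def)

definition vf_bound :: real where
  "vf_bound = (\<Sum>p\<in>supp X. \<bar>fst (X p)\<bar>) + (\<Sum>p\<in>supp X. \<bar>snd (X p)\<bar>)"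

lemma vf_leading:
  assumes "\<bar>x\<bar> \<le> 1" "\<bar>y\<bar> \<le> 1" "0 \<le> s"
  shows "\<bar>exp (- ((d + A) * s)) * fst (vf X (exp (A * s) * x, exp (B * s) * y)) - fst (vf Y (x, y))\<bar>
      \<le> vf_bound * exp (- s)" (is ?fst)
    and "\<bar>exp (- ((d + B) * s)) * snd (vf X (exp (A * s) * x, exp (B * s) * y)) - snd (vf Y (x, y))\<bar>
      \<le> vf_bound * exp (- s)" (is ?snd)
proof -
  have le: "(\<Sum>p\<in>supp X. \<bar>fst (X p)\<bar>) * exp (- s) \<le> vf_bound * exp (- s)"
    "(\<Sum>p\<in>supp X. \<bar>snd (X p)\<bar>) * exp (- s) \<le> vf_bound * exp (- s)"
    by (auto intro!: mult_right_mono sum_nonneg simp: vf_bound_def)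
  show ?fst
    unfolding fst_vf monomial_sum_Y
    using monomial_sum_leading[where S = "supp X" and k = "\<lambda>p. fst (X p)" and a = 1 and b = 0 and P = "\<lambda>p. real_pt p \<in> upper_boundary X",
        OF polynomial_vf_exponents(1)[OF poly] finite_supp upper lower assms] order_trans[OF _ le(1)] by simp
  show ?snd
    unfolding snd_vf monomial_sum_Y
    using monomial_sum_leading[where S = "supp X" and k = "\<lambda>p. snd (X p)" and a = 0 and b = 1 and P = "\<lambda>p. real_pt p \<in> upper_boundary X",
        OF polynomial_vf_exponents(2)[OF poly] finite_supp upper lower assms] order_trans[OF _ le(2)] by simp
qed

lemma vf_Y_quasihomogeneous:
  "fst (vf Y (exp (A * s) * x, exp (B * s) * y)) = exp ((d + A) * s) * fst (vf Y (x, y))"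
  "snd (vf Y (exp (A * s) * x, exp (B * s) * y)) = exp ((d + B) * s) * snd (vf Y (x, y))"
  unfolding fst_vf snd_vf
  using monomial_sum_quasihomogeneous[where a = 1 and b = 0 and S = "supp Y" and k = "\<lambda>p. fst (Y p)"
      and A = A and B = B and d = d and s = s and x = x and y = y, OF polynomial_vf_exponents(1)[OF poly_Y]]
    monomial_sum_quasihomogeneous[where a = 0 and b = 1 and S = "supp Y" and k = "\<lambda>p. snd (Y p)"
      and A = A and B = B and d = d and s = s and x = x and y = y, OF polynomial_vf_exponents(2)[OF poly_Y]] upper
  by (simp_all add: supp_Y)

text \<open>For the principal part, \<open>weight\<close> times the velocity of \<open>(\<phi>, \<sigma>)\<close> is \<open>e\<^sup>d\<^sup>\<sigma>\<close> times
  \<open>(angular \<phi>, radial \<phi>)\<close>.\<close>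

definition radial :: "real \<Rightarrow> real" where
  "radial x = cos x * fst (vf Y (cos x, sin x)) + sin x * snd (vf Y (cos x, sin x))"

definition angular :: "real \<Rightarrow> real" where
  "angular x = A * cos x * snd (vf Y (cos x, sin x)) - B * sin x * fst (vf Y (cos x, sin x))"

definition weight :: "real \<Rightarrow> real" where
  "weight x = A * (cos x)\<^sup>2 + B * (sin x)\<^sup>2"

lemma weight_pos: "0 < weight x"
proof (cases "cos x = 0")
  case True
  then have "sin x \<noteq> 0" using sin_cos_squared_add[of x] by auto
  then show ?thesis using A B by (simp add: weight_def add_nonneg_pos)
next
  case False
  then show ?thesis using A B by (simp add: weight_def add_pos_nonneg)
qed

text \<open>The inverse of the linear map from the field on the unit circle to
  \<open>(radial, angular)\<close>, cleared of its determinant \<open>weight\<close>. A common zero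
  of both functions is thus a zero of the field off the origin.\<close>

lemma weight_mult_vf:
  "weight x * fst (vf Y (cos x, sin x)) = A * cos x * radial x - sin x * angular x"
  "weight x * snd (vf Y (cos x, sin x)) = B * sin x * radial x + cos x * angular x"
  by (simp_all add: weight_def radial_def angular_def algebra_simps power2_eq_square)

lemma continuous_on_vf_Y_trig:
  "continuous_on S (\<lambda>x. fst (vf Y (cos x, sin x)))" "continuous_on S (\<lambda>x. snd (vf Y (cos x, sin x)))"
  unfolding fst_vf snd_vf by (intro continuous_intros)+

lemma continuous_on_radial: "continuous_on S radial"
  unfolding radial_def[abs_def] by (intro continuous_intros continuous_on_vf_Y_trig)

lemma continuous_on_weight: "continuous_on S weight"
  unfolding weight_def[abs_def] by (intro continuous_intros)

lemma angular_differentiable: "\<exists>g'. \<forall>x. (angular has_real_derivative g' x) (at x)"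
proof -
  obtain p' where p': "\<And>x. ((\<lambda>x. fst (vf Y (cos x, sin x))) has_real_derivative p' x) (at x)"
    using monomial_sum_trig_differentiable[of "supp Y" "\<lambda>p. fst (Y p)" 1 0] unfolding fst_vf by blast
  obtain q' where q': "\<And>x. ((\<lambda>x. snd (vf Y (cos x, sin x))) has_real_derivative q' x) (at x)"
    using monomial_sum_trig_differentiable[of "supp Y" "\<lambda>p. snd (Y p)" 0 1] unfolding snd_vf by blast
  show ?thesis
    unfolding angular_def[abs_def]
    by (intro exI allI) (rule derivative_eq_intros p' q' refl)+
qed

lemma radial_periodic: "radial (x + 2 * pi) = radial x"
  and angular_periodic: "angular (x + 2 * pi) = angular x"
  and weight_periodic: "weight (x + 2 * pi) = weight x"
  by (simp_all add: radial_def angular_def weight_def)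

lemma radial_or_angular:
  assumes "{z. vf Y z = 0} = {0}"
  shows "radial x \<noteq> 0 \<or> angular x \<noteq> 0"
proof (rule ccontr)
  assume "\<not> ?thesis"
  then have "vf Y (cos x, sin x) = 0"
    using weight_mult_vf[of x] weight_pos[of x] by (simp add: prod_eq_iff)
  then have "(cos x, sin x) = 0" using assms by blast
  then show False using sin_cos_squared_add[of x] by (simp add: zero_prod_def)
qed

text \<open>The factor \<mu> is there because the compactified field follows the planar one in a
  different time. The condition on \<open>M\<close> says that the curve nowhere enters the weighted
  circle of logarithmic radius \<open>M\<close>.\<close>

lemma planar_orbit_on_cylinder:
  fixes x y \<mu> :: "real \<Rightarrow> real"
  assumes x: "\<And>t. (x has_real_derivative \<mu> t * fst (vf X (x t, y t))) (at t)"
    and y: "\<And>t. (y has_real_derivative \<mu> t * snd (vf X (x t, y t))) (at t)"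
    and \<mu>: "continuous_on UNIV \<mu>" "\<And>t. 0 < \<mu> t"
    and nz: "\<And>t. (x t, y t) \<noteq> (0, 0)"
    and per: "0 < \<tau>" "\<And>t. x (t + \<tau>) = x t" "\<And>t. y (t + \<tau>) = y t"
    and M: "0 \<le> M" "\<And>t. 1 \<le> weighted_radius_eq A B (x t) (y t) M"
  shows "\<exists>\<phi> \<sigma> \<nu> e1 e2 k. cylinder_orbit radial angular ((A + B + 2) * vf_bound) M \<tau> \<phi> \<sigma> \<nu> e1 e2 k"
proof -
  note cxy = DERIV_continuous_on_all[OF x] DERIV_continuous_on_all[OF y]
  have "continuous_on UNIV (\<lambda>t. \<mu> t * fst (vf X (x t, y t)))" "continuous_on UNIV (\<lambda>t. \<mu> t * snd (vf X (x t, y t)))"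
    unfolding fst_vf snd_vf by (intro continuous_intros \<mu> cxy)+
  from weighted_polar_lift[OF A B x y this nz]
  obtain \<phi> \<sigma> \<phi>' \<sigma>' where \<phi>: "\<And>t. (\<phi> has_real_derivative \<phi>' t) (at t)"
    and \<sigma>: "\<And>t. (\<sigma> has_real_derivative \<sigma>' t) (at t)"
    and xy: "\<And>t. x t = exp (A * \<sigma> t) * cos (\<phi> t)" "\<And>t. y t = exp (B * \<sigma> t) * sin (\<phi> t)"
    by blast
  have cancel: "exp z * w * exp (- z) = w" for z w :: real by (simp add: exp_minus)
  have radius: "weighted_radius_eq A B (x t) (y t) (\<sigma> t) = 1" for t
    unfolding weighted_radius_eq_def xy cancel by simp
  have \<sigma>M: "M \<le> \<sigma> t" for t
  proof (rule ccontr)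
    assume "\<not> M \<le> \<sigma> t"
    then show False
      using weighted_radius_eq_strict[OF A B nz, of "\<sigma> t" M t] radius[of t] M(2)[of t] by simp
  qed
  let ?P = "\<lambda>x. fst (vf Y (cos x, sin x))" and ?Q = "\<lambda>x. snd (vf Y (cos x, sin x))"
  \<comment> \<open>Besides the factors \<open>exp (A * \<sigma>)\<close> and
    \<open>exp (B * \<sigma>)\<close> of the coordinates, the principal part grows like
    \<open>exp (d * \<sigma>)\<close>; moving this growth into the time change leaves functions of
    the angle only, up to \<open>ep\<close> and \<open>eq\<close>.\<close>
  define \<nu>0 where "\<nu>0 t = \<mu> t * exp (d * \<sigma> t)" for t
  define ep where "ep t = exp (- ((d + A) * \<sigma> t)) * fst (vf X (x t, y t)) - ?P (\<phi> t)" for t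
  define eq where "eq t = exp (- ((d + B) * \<sigma> t)) * snd (vf X (x t, y t)) - ?Q (\<phi> t)" for t
  have ep: "\<bar>ep t\<bar> \<le> vf_bound * exp (- \<sigma> t)" and eq: "\<bar>eq t\<bar> \<le> vf_bound * exp (- \<sigma> t)" for t
    unfolding ep_def eq_def xy using \<sigma>M[of t] M(1) by (auto intro!: vf_leading)
  have "\<mu> t * fst (vf X (x t, y t)) = exp (A * \<sigma> t) * (\<nu>0 t * (?P (\<phi> t) + ep t))"
    "\<mu> t * snd (vf X (x t, y t)) = exp (B * \<sigma> t) * (\<nu>0 t * (?Q (\<phi> t) + eq t))" for t
  proof -
    have e: "exp (c * \<sigma> t) * exp (d * \<sigma> t) * exp (- ((d + c) * \<sigma> t)) = 1" for c
      by (simp add: algebra_simps flip: exp_add)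
    have "exp (A * \<sigma> t) * (\<nu>0 t * (?P (\<phi> t) + ep t)) =
        exp (A * \<sigma> t) * exp (d * \<sigma> t) * exp (- ((d + A) * \<sigma> t)) * (\<mu> t * fst (vf X (x t, y t)))"
      by (simp add: ep_def \<nu>0_def mult_ac)
    then show "\<mu> t * fst (vf X (x t, y t)) = exp (A * \<sigma> t) * (\<nu>0 t * (?P (\<phi> t) + ep t))"
      unfolding e by simp
    have "exp (B * \<sigma> t) * (\<nu>0 t * (?Q (\<phi> t) + eq t)) =
        exp (B * \<sigma> t) * exp (d * \<sigma> t) * exp (- ((d + B) * \<sigma> t)) * (\<mu> t * snd (vf X (x t, y t)))"
      by (simp add: eq_def \<nu>0_def mult_ac)
    then show "\<mu> t * snd (vf X (x t, y t)) = exp (B * \<sigma> t) * (\<nu>0 t * (?Q (\<phi> t) + eq t))"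
      unfolding e by simp
  qed
  then have "\<And>t. (x has_real_derivative exp (A * \<sigma> t) * (\<nu>0 t * (?P (\<phi> t) + ep t))) (at t)"
    "\<And>t. (y has_real_derivative exp (B * \<sigma> t) * (\<nu>0 t * (?Q (\<phi> t) + eq t))) (at t)"
    using x y by metis+
  note vel = weighted_polar_velocity[OF this \<phi> \<sigma> xy, folded weight_def]
  define \<nu> where "\<nu> t = \<nu>0 t / weight (\<phi> t)" for t
  define e1 where "e1 t = A * cos (\<phi> t) * eq t - B * sin (\<phi> t) * ep t" for t
  define e2 where "e2 t = cos (\<phi> t) * ep t + sin (\<phi> t) * eq t" for t
  have "\<phi>' t * weight (\<phi> t) = \<nu>0 t * (angular (\<phi> t) + e1 t)"
    "\<sigma>' t * weight (\<phi> t) = \<nu>0 t * (radial (\<phi> t) + e2 t)" for t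
    unfolding vel by (simp_all add: angular_def radial_def e1_def e2_def algebra_simps)
  then have "\<phi>' t = \<nu> t * (angular (\<phi> t) + e1 t)" "\<sigma>' t = \<nu> t * (radial (\<phi> t) + e2 t)" for t
    using weight_pos[of "\<phi> t"] by (simp_all add: \<nu>_def field_simps)
  then have deriv: "\<And>t. (\<phi> has_real_derivative \<nu> t * (angular (\<phi> t) + e1 t)) (at t)"
    "\<And>t. (\<sigma> has_real_derivative \<nu> t * (radial (\<phi> t) + e2 t)) (at t)"
    using \<phi> \<sigma> by metis+
  \<comment> \<open>\<open>A + B\<close> is what \<open>e1\<close> needs and 2 what
    \<open>e2\<close> needs; their sum is the common constant.\<close>
  have combine: "\<bar>a * c * p + b * s * q\<bar> \<le> (a + b) * E"
    if "0 \<le> a" "0 \<le> b" "\<bar>c\<bar> \<le> 1" "\<bar>s\<bar> \<le> 1" "\<bar>p\<bar> \<le> E" "\<bar>q\<bar> \<le> E" for a b c s p q E :: real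
  proof -
    have "\<bar>a * c * p\<bar> \<le> a * 1 * E" "\<bar>b * s * q\<bar> \<le> b * 1 * E"
      unfolding abs_mult using that by (auto intro!: mult_mono mult_left_le)
    then show ?thesis using abs_triangle_ineq[of "a * c * p" "b * s * q"] by (simp add: algebra_simps)
  qed
  have E: "0 \<le> vf_bound * exp (- \<sigma> t)" for t using ep[of t] abs_ge_zero[of "ep t"] by linarith
  have e1: "\<bar>e1 t\<bar> \<le> (A + B + 2) * vf_bound * exp (- \<sigma> t)" for t
  proof -
    have "\<bar>e1 t\<bar> \<le> (A + B) * (vf_bound * exp (- \<sigma> t))"
      using combine[of A B "cos (\<phi> t)" "sin (\<phi> t)" "eq t" "vf_bound * exp (- \<sigma> t)" "- ep t"] A B ep[of t] eq[of t]
      by (simp add: e1_def)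
    also have "\<dots> \<le> (A + B + 2) * (vf_bound * exp (- \<sigma> t))" using E[of t] by (intro mult_right_mono) auto
    finally show ?thesis by (simp only: mult.assoc)
  qed
  have e2: "\<bar>e2 t\<bar> \<le> (A + B + 2) * vf_bound * exp (- \<sigma> t)" for t
  proof -
    have "\<bar>e2 t\<bar> \<le> 2 * (vf_bound * exp (- \<sigma> t))"
      using combine[of 1 1 "cos (\<phi> t)" "sin (\<phi> t)" "ep t" "vf_bound * exp (- \<sigma> t)" "eq t"] ep[of t] eq[of t]
      by (simp add: e2_def)
    also have "\<dots> \<le> (A + B + 2) * (vf_bound * exp (- \<sigma> t))" using E[of t] A B by (intro mult_right_mono) auto
    finally show ?thesis by (simp only: mult.assoc)
  qed
  have \<sigma>_per: "\<sigma> (t + \<tau>) = \<sigma> t" for t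
    using weighted_radius_eq_inj[OF A B nz] radius[of t] radius[of "t + \<tau>"] per by metis
  have "\<exists>k::int. \<phi> (t + \<tau>) - \<phi> t = of_int k * (2 * pi)" for t
  proof -
    have "cos (\<phi> (t + \<tau>)) = cos (\<phi> t)" "sin (\<phi> (t + \<tau>)) = sin (\<phi> t)"
      using per(2,3)[of t] by (simp_all add: xy \<sigma>_per)
    from pl_trig_eq_imp[OF pl_trig_1_1 _ _ this] show ?thesis by auto
  qed
  moreover have "continuous_on UNIV (\<lambda>t. \<phi> (t + \<tau>) - \<phi> t)"
    by (intro continuous_intros continuous_on_compose2[OF DERIV_continuous_on_all[OF \<phi>]]
        DERIV_continuous_on_all[OF \<phi>]) auto
  ultimately obtain k :: int where k: "\<And>t. \<phi> (t + \<tau>) - \<phi> t = of_int k * (2 * pi)"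
    using int_valued_constant[of "\<lambda>t. \<phi> (t + \<tau>) - \<phi> t" "2 * pi"] by auto
  have \<phi>_per: "\<phi> (t + \<tau>) = \<phi> t + of_int k * (2 * pi)" for t using k[of t] by linarith
  have \<nu>: "0 < \<nu> t" for t using \<mu>(2) weight_pos by (simp add: \<nu>_def \<nu>0_def)
  have "cylinder_orbit radial angular ((A + B + 2) * vf_bound) M \<tau> \<phi> \<sigma> \<nu> e1 e2 k"
    by unfold_locales (rule deriv \<nu> e1 e2 per(1) \<phi>_per \<sigma>_per \<sigma>M)+
  then show ?thesis by blast
qed

end

subsection \<open>From the disk to the cylinder\<close>

text \<open>The factor \<open>r\<close> of the second component keeps the boundary invariant;
  continuity of the cofactor is what Gronwall needs.\<close>

lemma pl_compactification_radial:
  assumes "pl_trig \<alpha> \<beta> Cs Sn T"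
  shows "\<exists>R. continuous_on UNIV R \<and> (\<forall>z. snd (pl_compactification \<alpha> \<beta> Cs Sn X z) = snd z * R z)"
proof -
  define R where "R z = (\<Sum>p\<in>supp X. - (1 / real \<alpha>) *
      snd z ^ nat (weight_degree \<alpha> \<beta> X - (int \<alpha> * fst p + int \<beta> * snd p)) *
      (fst (X p) * Cs (fst z) ^ nat (fst p + 2 * int \<beta>) * Sn (fst z) ^ nat (snd p) +
       snd (X p) * Cs (fst z) ^ nat (fst p) * Sn (fst z) ^ nat (snd p + 2 * int \<alpha>)))" for z :: "real \<times> real"
  have "continuous_on UNIV Cs" "continuous_on UNIV Sn"
    by (rule DERIV_continuous_on_all[OF pl_trig_deriv(1)[OF assms]]
        DERIV_continuous_on_all[OF pl_trig_deriv(2)[OF assms]])+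
  then have "continuous_on UNIV (\<lambda>z::real \<times> real. Cs (fst z))" "continuous_on UNIV (\<lambda>z::real \<times> real. Sn (fst z))"
    using continuous_on_compose2[OF _ continuous_on_fst[OF continuous_on_id]] by blast+
  then have "continuous_on UNIV R" unfolding R_def by (intro continuous_intros)
  moreover have "snd (pl_compactification \<alpha> \<beta> Cs Sn X z) = snd z * R z" for z
    unfolding R_def pl_compactification_def case_prod_unfold Let_def snd_sum sum_distrib_left
    by (intro sum.cong refl) simp
  ultimately show ?thesis by blast
qed

text \<open>With an antiderivative \<open>G\<close> of the right-hand side, \<open>G \<circ> \<theta>\<close> has derivative \<open>(g \<circ> \<theta>)\<^sup>2\<close>.\<close>

lemma scalar_autonomous_not_periodic:
  fixes \<theta> g :: "real \<Rightarrow> real"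
  assumes \<theta>: "\<And>t. (\<theta> has_real_derivative g (\<theta> t)) (at t)" and g: "continuous_on UNIV g"
    and per: "0 < \<tau>" "\<And>t. \<theta> (t + \<tau>) = \<theta> t"
  shows "\<theta> s = \<theta> t"
proof -
  obtain G where G: "\<And>x. (G has_real_derivative g x) (at x)"
    using ex_antiderivative_real[OF g] by blast
  have deriv: "((\<lambda>t. G (\<theta> t)) has_real_derivative g (\<theta> t) * g (\<theta> t)) (at t)" for t
    by (rule DERIV_chain2[OF G \<theta>])
  have mono: "G (\<theta> a) \<le> G (\<theta> b)" if "a \<le> b" for a b
    using DERIV_nonneg_imp_nondecreasing[OF that, of "\<lambda>t. G (\<theta> t)"] deriv by (metis zero_le_square)
  \<comment> \<open>\<open>G \<circ> \<theta>\<close> is nondecreasing and periodic.\<close>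
  have "G (\<theta> a) = G (\<theta> 0)" for a
  proof -
    have shift: "\<theta> (t + of_int n * \<tau>) = \<theta> t" for n t
      using quasiperiodic_shift[of \<theta> \<tau> 0] per by simp
    obtain n :: int where "(0 - a) / \<tau> \<le> of_int n" using ex_le_of_int by blast
    then have "0 \<le> a + of_int n * \<tau>" using per by (simp add: field_simps)
    moreover obtain m :: int where "a / \<tau> \<le> of_int m" using ex_le_of_int by blast
    then have "a \<le> 0 + of_int m * \<tau>" using per by (simp add: field_simps)
    ultimately show ?thesis using mono shift by (metis order_antisym)
  qed
  then have "(\<lambda>t. G (\<theta> t)) = (\<lambda>_. G (\<theta> 0))" by blast
  then have "((\<lambda>t. G (\<theta> t)) has_real_derivative 0) (at t)" for t by simp
  then have "g (\<theta> t) * g (\<theta> t) = 0" for t by (rule DERIV_unique[OF deriv])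
  then have "g (\<theta> t) = 0" for t by simp
  then show ?thesis using \<theta> DERIV_isconst_all[of \<theta>] by simp
qed

lemma periodic_orbit_components:
  assumes "periodic_orbit T F c"
  shows "\<And>t. (c has_vector_derivative F (c t)) (at t)"
    and "\<And>t. ((\<lambda>t. fst (c t)) has_real_derivative fst (F (c t))) (at t)"
    and "\<And>t. ((\<lambda>t. snd (c t)) has_real_derivative snd (F (c t))) (at t)"
    and "\<And>t. 0 \<le> snd (c t)"
proof -
  show c: "(c has_vector_derivative F (c t)) (at t)" and "0 \<le> snd (c t)" for t
    using assms by (auto simp: periodic_orbit_def solves_def)
  show "((\<lambda>t. fst (c t)) has_real_derivative fst (F (c t))) (at t)"
    and "((\<lambda>t. snd (c t)) has_real_derivative snd (F (c t))) (at t)" for t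
    using has_derivative_fst[OF c[unfolded has_vector_derivative_def]]
      has_derivative_snd[OF c[unfolded has_vector_derivative_def]]
    by (auto simp: has_real_derivative_iff_has_vector_derivative has_vector_derivative_def)
qed

text \<open>By Gronwall for \<open>r\<close>, one point on the boundary puts the whole orbit there.
  The angle then solves a scalar equation, where \<open>k = 0\<close> would make the orbit constant;
  so it winds and covers the circle.\<close>

lemma boundary_periodic_orbit:
  assumes trig: "pl_trig \<alpha> \<beta> Cs Sn T"
    and orb: "periodic_orbit T (pl_compactification \<alpha> \<beta> Cs Sn X) c"
    and zero: "snd (c a) = 0"
  shows "lifted_orbit T c = boundary_circle"
proof -
  let ?F = "pl_compactification \<alpha> \<beta> Cs Sn X"
  have T: "0 < T" using trig by (simp add: pl_trig_def common_period_def)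
  note comp = periodic_orbit_components[OF orb]
  obtain R where R: "continuous_on UNIV R" "\<And>z. snd (?F z) = snd z * R z"
    using pl_compactification_radial[OF trig] by blast
  have contc: "continuous_on UNIV c"
    using comp(1) has_vector_derivative_continuous continuous_at_imp_continuous_on by blast
  have r0: "snd (c t) = 0" for t
  proof (rule gronwall_zero[where W = "\<lambda>t. snd (c t)" and k = "\<lambda>t. \<bar>R (c t)\<bar>", OF comp(3,4) _ _ zero])
    show "\<bar>snd (?F (c t))\<bar> \<le> \<bar>R (c t)\<bar> * snd (c t)" for t
      using comp(4)[of t] by (simp add: R abs_mult)
    show "continuous_on UNIV (\<lambda>t. \<bar>R (c t)\<bar>)"
      by (intro continuous_intros continuous_on_compose2[OF R(1) contc]) auto
  qed
  define \<theta> where "\<theta> t = fst (c t)" for t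
  have c: "c t = (\<theta> t, 0)" for t using r0[of t] by (simp add: \<theta>_def prod_eq_iff)
  define g where "g x = fst (?F (x, 0))" for x
  have g: "continuous_on UNIV g"
  proof -
    have "continuous_on UNIV (\<lambda>x. ?F (x, 0))"
      by (rule continuous_on_compose2[OF continuous_on_pl_compactification[OF trig]])
        (auto intro!: continuous_intros)
    then show ?thesis unfolding g_def by (rule continuous_on_fst)
  qed
  have \<theta>: "(\<theta> has_real_derivative g (\<theta> t)) (at t)" for t
    using comp(2)[of t] unfolding \<theta>_def[symmetric] by (simp add: c g_def)
  note cont\<theta> = DERIV_continuous_on_all[OF \<theta>]
  obtain \<tau> where \<tau>: "0 < \<tau>" "\<And>t. \<exists>k. c (t + \<tau>) = c t + (of_int k * T, 0)"
    using orb by (auto simp: periodic_orbit_def)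
  have "\<exists>k::int. \<theta> (t + \<tau>) - \<theta> t = of_int k * T" for t
    using \<tau>(2)[of t] by (auto simp: c)
  moreover have "continuous_on UNIV (\<lambda>t. \<theta> (t + \<tau>) - \<theta> t)"
    by (intro continuous_intros continuous_on_compose2[OF cont\<theta>] cont\<theta>) auto
  ultimately obtain k :: int where diff: "\<And>t. \<theta> (t + \<tau>) - \<theta> t = of_int k * T"
    using int_valued_constant[of "\<lambda>t. \<theta> (t + \<tau>) - \<theta> t" T] T by auto
  have k: "\<theta> (t + \<tau>) = \<theta> t + of_int k * T" for t using diff[of t] by linarith
  have "k \<noteq> 0"
  proof
    assume "k = 0"
    then have "\<theta> s = \<theta> t" for s t
      using scalar_autonomous_not_periodic[OF \<theta> g \<tau>(1)] k by simp
    then have "c constant_on UNIV" unfolding constant_on_def c by blast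
    then show False using orb by (simp add: periodic_orbit_def)
  qed
  then have "surj \<theta>" using quasiperiodic_surj[where q = \<theta>, OF cont\<theta> k] T by simp
  show ?thesis
  proof
    show "lifted_orbit T c \<subseteq> boundary_circle"
      by (auto simp: lifted_orbit_def boundary_circle_def c)
    show "boundary_circle \<subseteq> lifted_orbit T c"
    proof
      fix z :: "real \<times> real" assume "z \<in> boundary_circle"
      then obtain x where z: "z = (x, 0)" by (auto simp: boundary_circle_def)
      obtain t where "x = \<theta> t" using \<open>surj \<theta>\<close> by blast
      then have "z = c t + (of_int 0 * T, 0)" by (simp add: c z)
      then show "z \<in> lifted_orbit T c" unfolding lifted_orbit_def by blast
    qed
  qed
qed

lemma pl_chart_curve_derivative:
  assumes trig: "pl_trig \<alpha> \<beta> Cs Sn T" and pos: "\<alpha> > 0" "\<beta> > 0" and X: "polynomial_vf X"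
    and c: "(c has_vector_derivative pl_compactification \<alpha> \<beta> Cs Sn X (c t)) (at t)" and r: "0 < snd (c t)"
  shows "((\<lambda>t. pl_chart \<alpha> \<beta> Cs Sn (c t)) has_vector_derivative
    (snd (c t) powi weight_degree \<alpha> \<beta> X) *\<^sub>R vf X (pl_chart \<alpha> \<beta> Cs Sn (c t))) (at t)"
proof -
  let ?F = "pl_compactification \<alpha> \<beta> Cs Sn X" and ?\<Phi> = "pl_chart \<alpha> \<beta> Cs Sn"
  obtain \<theta> r where ct: "c t = (\<theta>, r)" by force
  have "?\<Phi> differentiable at (c t)"
    using pl_chart_has_derivative[OF trig _ pos, of r \<theta>] r unfolding differentiable_def ct by auto
  then have D: "(?\<Phi> has_derivative frechet_derivative ?\<Phi> (at (c t))) (at (c t))"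
    by (simp add: frechet_derivative_works)
  from has_derivative_compose[OF c[unfolded has_vector_derivative_def] D]
  have "((\<lambda>t. ?\<Phi> (c t)) has_derivative (\<lambda>h. frechet_derivative ?\<Phi> (at (c t)) (h *\<^sub>R ?F (c t)))) (at t)" .
  moreover have "frechet_derivative ?\<Phi> (at (c t)) (h *\<^sub>R ?F (c t)) =
      h *\<^sub>R ((snd (c t) powi weight_degree \<alpha> \<beta> X) *\<^sub>R vf X (?\<Phi> (c t)))" for h
    using linear_cmul[OF has_derivative_linear[OF D]] pl_compactification_pushforward[OF trig pos X, of r \<theta>] r
    by (simp add: ct)
  ultimately show ?thesis by (simp add: has_vector_derivative_def)
qed

text \<open>The conserved quantity of \<open>Cs\<close> and \<open>Sn\<close> after scaling: it
  determines \<open>r\<close> from the planar point alone, without the angle.\<close>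

lemma pl_chart_conserved:
  assumes trig: "pl_trig \<alpha> \<beta> Cs Sn T" and pos: "\<alpha> > 0" "\<beta> > 0" and r: "0 < r"
    and xy: "pl_chart \<alpha> \<beta> Cs Sn (\<theta>, r) = (x, y)"
  shows "(real \<alpha> * x ^ (2 * \<beta>) + real \<beta> * y ^ (2 * \<alpha>)) * r ^ (2 * \<alpha> * \<beta>) = real \<alpha>"
proof -
  have x: "Cs \<theta> = x * r ^ \<alpha>" and y: "Sn \<theta> = y * r ^ \<beta>"
    using xy r by (auto simp: pl_chart_def)
  have "r ^ (2 * \<alpha> * \<beta>) = (r ^ \<alpha>) ^ (2 * \<beta>)" "r ^ (2 * \<alpha> * \<beta>) = (r ^ \<beta>) ^ (2 * \<alpha>)"
    by (simp_all add: mult_ac flip: power_mult)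
  then show ?thesis
    using pl_trig_conserved[OF trig pos, of \<theta>] unfolding x y power_mult_distrib
    by (simp add: algebra_simps)
qed

text \<open>The comparison of the two weightings: a weighted radius below 1 at level
  \<open>M\<close> bounds \<open>\<bar>x\<bar>\<close> and \<open>\<bar>y\<bar>\<close> by
  \<open>N\<close>, hence the polynomial in \<open>pl_chart_conserved\<close> by \<open>G\<close>,
  and this keeps \<open>r\<close> away from 0.\<close>

lemma near_boundary_large_radius:
  assumes trig: "pl_trig \<alpha> \<beta> Cs Sn T" and pos: "\<alpha> > 0" "\<beta> > 0"
  shows "\<exists>r1>0. \<forall>\<theta> r x y. 0 < r \<longrightarrow> r < r1 \<longrightarrow> pl_chart \<alpha> \<beta> Cs Sn (\<theta>, r) = (x, y) \<longrightarrow>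
    (x, y) \<noteq> (0, 0) \<and> 1 \<le> weighted_radius_eq A B x y M"
proof -
  define N where "N = max (exp (A * M)) (exp (B * M))"
  define G where "G = real \<alpha> * N ^ (2 * \<beta>) + real \<beta> * N ^ (2 * \<alpha>)"
  have "0 < N" by (simp add: N_def less_max_iff_disj)
  then have G: "0 < G" using pos by (simp add: G_def add_pos_pos)
  show ?thesis
  proof (intro exI[of _ "min 1 (real \<alpha> / G)"] conjI allI impI)
    show "0 < min 1 (real \<alpha> / G)" using G pos by simp
    fix \<theta> r x y assume r: "0 < r" "r < min 1 (real \<alpha> / G)" and xy: "pl_chart \<alpha> \<beta> Cs Sn (\<theta>, r) = (x, y)"
    note cons = pl_chart_conserved[OF trig pos r(1) xy]
    show "(x, y) \<noteq> (0, 0)" using cons pos by (auto simp: zero_power)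
    show "1 \<le> weighted_radius_eq A B x y M"
    proof (rule ccontr)
      assume neg: "\<not> ?thesis"
      have "0 \<le> (x * exp (- (A * M)))\<^sup>2" "0 \<le> (y * exp (- (B * M)))\<^sup>2" by simp_all
      then have "(x * exp (- (A * M)))\<^sup>2 < 1" "(y * exp (- (B * M)))\<^sup>2 < 1"
        using neg unfolding weighted_radius_eq_def by linarith+
      then have "\<bar>x * exp (- (A * M))\<bar> < 1" "\<bar>y * exp (- (B * M))\<bar> < 1"
        unfolding abs_square_less_1 .
      then have "\<bar>x\<bar> < exp (A * M)" "\<bar>y\<bar> < exp (B * M)"
        by (simp_all add: abs_mult exp_minus field_simps)
      then have "\<bar>x\<bar> \<le> N" "\<bar>y\<bar> \<le> N" by (auto simp: N_def)
      then have "\<bar>x\<bar> ^ (2 * \<beta>) \<le> N ^ (2 * \<beta>)" "\<bar>y\<bar> ^ (2 * \<alpha>) \<le> N ^ (2 * \<alpha>)"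
        by (intro power_mono; simp)+
      then have "x ^ (2 * \<beta>) \<le> N ^ (2 * \<beta>)" "y ^ (2 * \<alpha>) \<le> N ^ (2 * \<alpha>)"
        by (simp_all add: power_mult)
      then have "real \<alpha> * x ^ (2 * \<beta>) + real \<beta> * y ^ (2 * \<alpha>) \<le> G"
        unfolding G_def by (intro add_mono mult_left_mono) auto
      then have "(real \<alpha> * x ^ (2 * \<beta>) + real \<beta> * y ^ (2 * \<alpha>)) * r ^ (2 * \<alpha> * \<beta>) \<le> G * r ^ (2 * \<alpha> * \<beta>)"
        using r by (intro mult_right_mono) auto
      then have "real \<alpha> \<le> G * r ^ (2 * \<alpha> * \<beta>)" unfolding cons .
      \<comment> \<open>Taking the radius at most 1 allows a linear bound here and avoids a root of
        order \<open>2 * \<alpha> * \<beta>\<close>.\<close>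
      also have "r ^ (2 * \<alpha> * \<beta>) \<le> r ^ 1"
        using r pos by (intro power_decreasing) auto
      then have "G * r ^ (2 * \<alpha> * \<beta>) \<le> G * r" using G by simp
      also have "\<dots> < real \<alpha>" using r G by (simp add: field_simps)
      finally show False by simp
    qed
  qed
qed

section \<open>Absence of periodic orbits when the principal part has no center\<close>

context weighted_vf
begin

lemma free_if_no_center:
  assumes trig: "pl_trig \<alpha> \<beta> Cs Sn T" and pos: "\<alpha> > 0" "\<beta> > 0"
    and sing: "{z. vf Y z = 0} = {0}"
    and no_center: "\<nexists>F. (\<forall>x. angular x \<noteq> 0) \<and> (\<forall>x. (F has_real_derivative radial x / angular x) (at x)) \<and>
      (\<forall>x. F (x + 2 * pi) = F x)"
  shows "free_of_periodic_orbits \<alpha> \<beta> Cs Sn T X"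
proof -
  obtain g' where g': "\<And>x. (angular has_real_derivative g' x) (at x)"
    using angular_differentiable by blast
  obtain M0 where M0: "\<And>\<tau> \<phi> \<sigma> \<nu> e1 e2 k.
      \<not> cylinder_orbit radial angular ((A + B + 2) * vf_bound) M0 \<tau> \<phi> \<sigma> \<nu> e1 e2 k"
    using no_cylinder_orbit[OF continuous_on_radial radial_periodic g' angular_periodic
        radial_or_angular[OF sing] no_center] by meson
  define M where "M = max 0 M0"
  have M: "0 \<le> M" "M0 \<le> M" by (simp_all add: M_def)
  obtain r1 where r1: "0 < r1" "\<And>\<theta> r x y. 0 < r \<Longrightarrow> r < r1 \<Longrightarrow> pl_chart \<alpha> \<beta> Cs Sn (\<theta>, r) = (x, y) \<Longrightarrow>
    (x, y) \<noteq> (0, 0) \<and> 1 \<le> weighted_radius_eq A B x y M"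
    using near_boundary_large_radius[OF trig pos] by blast
  define W :: "(real \<times> real) set" where "W = UNIV \<times> {0..<r1}"
  have "openin (top_of_set (UNIV \<times> {0..})) W"
  proof -
    have "W = (UNIV \<times> {0..}) \<inter> (UNIV \<times> {..<r1})" by (auto simp: W_def)
    then show ?thesis by (metis open_Times open_UNIV open_lessThan openin_open_Int)
  qed
  then have "boundary_neighbourhood T W"
    unfolding boundary_neighbourhood_def using r1(1)
    by (intro conjI exI[of _ W]) (auto simp: W_def boundary_circle_def)
  moreover have "lifted_orbit T c = boundary_circle"
    if orb: "periodic_orbit T (pl_compactification \<alpha> \<beta> Cs Sn X) c" and sub: "lifted_orbit T c \<subseteq> W" for c
  proof (rule ccontr)
    assume "lifted_orbit T c \<noteq> boundary_circle"
    note comp = periodic_orbit_components[OF orb]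
    \<comment> \<open>An orbit that touched \<open>r = 0\<close> would be the boundary circle, which
      the definition exempts.\<close>
    have r: "0 < snd (c t)" for t
      using boundary_periodic_orbit[OF trig orb, of t] comp(4)[of t] \<open>lifted_orbit T c \<noteq> boundary_circle\<close>
      by (auto simp: order.order_iff_strict)
    have "c t = c t + (of_int 0 * T, 0)" for t by (simp add: prod_eq_iff)
    then have "c t \<in> W" for t using sub unfolding lifted_orbit_def by blast
    then have r_less: "snd (c t) < r1" for t by (auto simp: W_def mem_Times_iff)
    define x y where "x t = fst (pl_chart \<alpha> \<beta> Cs Sn (c t))" and "y t = snd (pl_chart \<alpha> \<beta> Cs Sn (c t))" for t
    define \<mu> where "\<mu> t = snd (c t) powi weight_degree \<alpha> \<beta> X" for t
    have chart: "pl_chart \<alpha> \<beta> Cs Sn (c t) = (x t, y t)" for t by (simp add: x_def y_def)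
    have large: "(x t, y t) \<noteq> (0, 0) \<and> 1 \<le> weighted_radius_eq A B (x t) (y t) M" for t
      using r1(2)[OF r[of t] r_less[of t], of "fst (c t)"] chart[of t] by simp
    note D = pl_chart_curve_derivative[OF trig pos poly comp(1) r, unfolded has_vector_derivative_def]
    have dx: "(x has_real_derivative \<mu> t * fst (vf X (x t, y t))) (at t)"
      and dy: "(y has_real_derivative \<mu> t * snd (vf X (x t, y t))) (at t)" for t
    proof -
      have "(x has_derivative (\<lambda>h. h * \<mu> t * fst (vf X (x t, y t)))) (at t)"
        "(y has_derivative (\<lambda>h. h * \<mu> t * snd (vf X (x t, y t)))) (at t)"
        using has_derivative_fst[OF D[of t]] has_derivative_snd[OF D[of t]]
        by (simp_all add: chart flip: \<mu>_def)
      then show "(x has_real_derivative \<mu> t * fst (vf X (x t, y t))) (at t)"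
        and "(y has_real_derivative \<mu> t * snd (vf X (x t, y t))) (at t)"
        by (auto intro: has_derivative_imp_has_field_derivative)
    qed
    obtain \<tau> where \<tau>: "0 < \<tau>" "\<And>t. \<exists>k. c (t + \<tau>) = c t + (of_int k * T, 0)"
      using orb by (auto simp: periodic_orbit_def)
    have per: "x (t + \<tau>) = x t" "y (t + \<tau>) = y t" for t
    proof -
      obtain k where k: "c (t + \<tau>) = c t + (of_int k * T, 0)" using \<tau> by blast
      have "Cs (u + T) = Cs u + 0" "Sn (u + T) = Sn u + 0" for u
        using trig by (simp_all add: pl_trig_def common_period_def)
      from quasiperiodic_shift[where q = Cs, OF this(1), of "fst (c t)" k]
        quasiperiodic_shift[where q = Sn, OF this(2), of "fst (c t)" k]
      show "x (t + \<tau>) = x t" "y (t + \<tau>) = y t"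
        by (simp_all add: x_def y_def pl_chart_def k case_prod_unfold)
    qed
    have "continuous_on UNIV \<mu>"
    proof -
      have "snd (c t) \<noteq> 0" for t using r[of t] by simp
      then show ?thesis
        unfolding \<mu>_def by (intro continuous_on_power_int DERIV_continuous_on_all[OF comp(3)]) simp
    qed
    moreover have "0 < \<mu> t" for t using r by (simp add: \<mu>_def)
    ultimately have "\<exists>\<phi> \<sigma> \<nu> e1 e2 k. cylinder_orbit radial angular ((A + B + 2) * vf_bound) M \<tau> \<phi> \<sigma> \<nu> e1 e2 k"
      by (intro planar_orbit_on_cylinder[where x = x and y = y and \<mu> = \<mu>,
            OF dx dy _ _ _ \<tau>(1) per M(1)]) (use large in auto)
    then show False using M0 cylinder_orbit_mono[OF _ M(2)] by blast
  qed
  ultimately show ?thesis unfolding free_of_periodic_orbits_def by blast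
qed

end

subsection \<open>Periodic orbits of a center at infinity\<close>

text \<open>Compactness of one period of the boundary gives a uniform height, and periodicity of
  \<open>W\<close> spreads it.\<close>

lemma boundary_neighbourhood_strip:
  assumes W: "boundary_neighbourhood T W" and T: "0 < T"
  shows "\<exists>r1>0. UNIV \<times> {0..<r1} \<subseteq> W"
proof -
  have shift: "(\<theta> + T, r) \<in> W \<longleftrightarrow> (\<theta>, r) \<in> W" for \<theta> r
    using W by (simp add: boundary_neighbourhood_def)
  obtain V where V: "openin (top_of_set (UNIV \<times> {0..})) V" "boundary_circle \<subseteq> V" "V \<subseteq> W"
    using W by (auto simp: boundary_neighbourhood_def)
  obtain U where U: "open U" "V = (UNIV \<times> {0..}) \<inter> U"
    using V(1) by (auto simp: openin_open)
  have "compact ({0..T} \<times> {0::real})" by (intro compact_Times compact_Icc) simp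
  moreover have "{0..T} \<times> {0} \<subseteq> U" using V(2) U(2) by (auto simp: boundary_circle_def)
  ultimately obtain e where e: "0 < e" "(\<Union>x\<in>{0..T} \<times> {0}. ball x e) \<subseteq> U"
    using compact_subset_open_imp_ball_epsilon_subset[OF _ U(1)] by metis
  have "(\<theta>, r) \<in> W" if r: "0 \<le> r" "r < e" for \<theta> r
  proof -
    define k where "k = \<lfloor>\<theta> / T\<rfloor>"
    define \<theta>0 where "\<theta>0 = \<theta> + of_int (- k) * T"
    have "0 \<le> \<theta>0" "\<theta>0 \<le> T"
      using floor_divide_lower[OF T, of \<theta>] floor_divide_upper[OF T, of \<theta>]
      by (simp_all add: \<theta>0_def k_def algebra_simps)
    moreover have "(\<theta>0, r) \<in> ball (\<theta>0, 0) e" using r by (simp add: dist_Pair_Pair)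
    ultimately have "(\<theta>0, r) \<in> U" using e(2) by fastforce
    then have "(\<theta>0, r) \<in> W" using U(2) V(3) r by auto
    \<comment> \<open>Membership is encoded as a function with values 0 and 1, so that
      \<open>quasiperiodic_shift\<close> with increment 0 moves it by whole periods.\<close>
    moreover have "(if (\<theta> + of_int (- k) * T, r) \<in> W then 1 else 0) =
        (if (\<theta>, r) \<in> W then 1 else 0) + of_int (- k) * (0::real)"
      by (rule quasiperiodic_shift[where q = "\<lambda>\<theta>. if (\<theta>, r) \<in> W then 1 else 0"]) (simp add: shift)
    ultimately show ?thesis by (simp add: \<theta>0_def split: if_splits)
  qed
  then show ?thesis using e(1) by (intro exI[of _ e]) auto
qed

text \<open>The radius is solved from \<open>H * r ^ (2 * \<alpha> * \<beta>) = \<alpha>\<close>,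
  after which \<open>(x * r ^ \<alpha>, y * r ^ \<beta>)\<close> lies on the curve of
  \<open>Cs\<close> and \<open>Sn\<close>. A point on the positive horizontal axis supplies the
  initial angle 0.\<close>

lemma pl_chart_lift:
  fixes x y x' y' :: "real \<Rightarrow> real"
  assumes trig: "pl_trig \<alpha> \<beta> Cs Sn T" and pos: "\<alpha> > 0" "\<beta> > 0"
    and x: "\<And>t. (x has_real_derivative x' t) (at t)" and y: "\<And>t. (y has_real_derivative y' t) (at t)"
    and cont: "continuous_on UNIV x'" "continuous_on UNIV y'"
    and nz: "\<And>t. (x t, y t) \<noteq> (0, 0)" and init: "0 < x a" "y a = 0"
  shows "\<exists>\<theta> \<theta>' r r'. \<forall>t. (\<theta> has_real_derivative \<theta>' t) (at t) \<and> (r has_real_derivative r' t) (at t) \<and>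
    0 < r t \<and> pl_chart \<alpha> \<beta> Cs Sn (\<theta> t, r t) = (x t, y t)"
proof -
  define n where "n = 2 * \<alpha> * \<beta>"
  have n: "0 < n" using pos by (simp add: n_def)
  define H where "H t = real \<alpha> * x t ^ (2 * \<beta>) + real \<beta> * y t ^ (2 * \<alpha>)" for t
  define H' where "H' t = real n * (x t ^ (2 * \<beta> - 1) * x' t + y t ^ (2 * \<alpha> - 1) * y' t)" for t
  have H_pos: "0 < H t" for t
  proof (cases "x t = 0")
    case True
    then have "0 < y t ^ (2 * \<alpha>)" using nz[of t] by (simp add: zero_less_power_eq)
    then show ?thesis using pos by (simp add: H_def add_nonneg_pos)
  next
    case False
    then have "0 < x t ^ (2 * \<beta>)" by (simp add: zero_less_power_eq)
    then show ?thesis using pos by (simp add: H_def add_pos_nonneg)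
  qed
  have H: "(H has_real_derivative H' t) (at t)" for t
    unfolding H_def H'_def n_def by (auto intro!: derivative_eq_intros x y simp: algebra_simps)
  define r where "r t = exp ((ln (real \<alpha>) - ln (H t)) / real n)" for t
  define r' where "r' t = - (r t * H' t / (H t * real n))" for t
  have r: "(r has_real_derivative r' t) (at t)" for t
  proof -
    have "((\<lambda>t. ln (H t)) has_real_derivative inverse (H t) * H' t) (at t)"
      by (rule DERIV_chain2[OF DERIV_ln[OF H_pos] H])
    then have "((\<lambda>t. (ln (real \<alpha>) - ln (H t)) / real n) has_real_derivative (0 - inverse (H t) * H' t) / real n) (at t)"
      by (intro DERIV_cdivide DERIV_diff DERIV_const)
    from DERIV_fun_exp[OF this] show ?thesis
      unfolding r_def r'_def by (rule DERIV_cong) (simp add: field_simps)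
  qed
  have r_pos: "0 < r t" for t by (simp add: r_def)
  have rn: "r t ^ n = real \<alpha> / H t" for t
  proof -
    have "r t ^ n = exp (real n * ((ln (real \<alpha>) - ln (H t)) / real n))"
      unfolding r_def by (rule exp_of_nat_mult[symmetric])
    also have "\<dots> = real \<alpha> / H t" using n pos H_pos[of t] by (simp add: exp_diff)
    finally show ?thesis .
  qed
  note cxy = DERIV_continuous_on_all[OF x] DERIV_continuous_on_all[OF y]
    DERIV_continuous_on_all[OF r] DERIV_continuous_on_all[OF H]
  have "H t * real n \<noteq> 0" for t using H_pos[of t] n by simp
  then have r'_cont: "continuous_on UNIV r'"
    unfolding r'_def H'_def by (intro continuous_intros cxy cont) simp
  define u v where "u t = x t * r t ^ \<alpha>" and "v t = y t * r t ^ \<beta>" for t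
  define u' v' where "u' t = x' t * r t ^ \<alpha> + x t * (real \<alpha> * r t ^ (\<alpha> - 1) * r' t)"
    and "v' t = y' t * r t ^ \<beta> + y t * (real \<beta> * r t ^ (\<beta> - 1) * r' t)" for t
  have u: "(u has_real_derivative u' t) (at t)" and v: "(v has_real_derivative v' t) (at t)" for t
    unfolding u_def v_def u'_def v'_def by (auto intro!: derivative_eq_intros x y r simp: algebra_simps)
  have cont': "continuous_on UNIV u'" "continuous_on UNIV v'"
    unfolding u'_def v'_def by (intro continuous_intros cxy cont r'_cont)+
  have curve: "real \<alpha> * u t ^ (2 * \<beta>) + real \<beta> * v t ^ (2 * \<alpha>) = real \<alpha>" for t
  proof -
    have "(r t ^ \<alpha>) ^ (2 * \<beta>) = r t ^ n" "(r t ^ \<beta>) ^ (2 * \<alpha>) = r t ^ n"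
      by (simp_all add: n_def mult_ac flip: power_mult)
    then have "real \<alpha> * u t ^ (2 * \<beta>) + real \<beta> * v t ^ (2 * \<alpha>) = H t * r t ^ n"
      by (simp add: u_def v_def H_def power_mult_distrib algebra_simps)
    then show ?thesis using rn[of t] H_pos[of t] by simp
  qed
  have "u a ^ (2 * \<beta>) = 1 ^ (2 * \<beta>)" using curve[of a] init pos by (simp add: v_def zero_power)
  moreover have "0 \<le> u a" using init r_pos[of a] by (simp add: u_def)
  ultimately have "u a = 1" using pos by (intro power_eq_imp_eq_base[of "u a" "2 * \<beta>" 1]) auto
  then have "u a = Cs 0" "v a = Sn 0" using trig init by (simp_all add: pl_trig_def v_def)
  from pl_trig_angle_lift[where u = u and v = v, OF trig pos u v cont' curve this]
  obtain \<theta> \<theta>' where \<theta>: "\<And>t. (\<theta> has_real_derivative \<theta>' t) (at t)" "\<And>t. u t = Cs (\<theta> t)" "\<And>t. v t = Sn (\<theta> t)"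
    by blast
  have "pl_chart \<alpha> \<beta> Cs Sn (\<theta> t, r t) = (x t, y t)" for t
    using r_pos[of t] unfolding pl_chart_def by (simp add: u_def v_def flip: \<theta>(2,3))
  then show ?thesis using \<theta>(1) r r_pos by blast
qed

text \<open>Both sides have the same image under the derivative \<open>L\<close> of the chart, and
  \<open>L\<close> is injective for positive radius. The factor \<open>l\<close> may have either
  sign, since the closed orbit below is parametrised by its angle.\<close>

lemma pl_chart_velocity:
  assumes trig: "pl_trig \<alpha> \<beta> Cs Sn T" and pos: "\<alpha> > 0" "\<beta> > 0" and X: "polynomial_vf X"
    and \<theta>: "(\<theta> has_real_derivative \<theta>') (at t)" and r: "(r has_real_derivative r') (at t)" and r_pos: "0 < r t"
    and xy: "\<And>t. pl_chart \<alpha> \<beta> Cs Sn (\<theta> t, r t) = (x t, y t)"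
    and x: "(x has_real_derivative l * fst (vf X (x t, y t))) (at t)"
    and y: "(y has_real_derivative l * snd (vf X (x t, y t))) (at t)"
  shows "(r t powi weight_degree \<alpha> \<beta> X) *\<^sub>R (\<theta>', r') = l *\<^sub>R pl_compactification \<alpha> \<beta> Cs Sn X (\<theta> t, r t)"
proof -
  let ?F = "pl_compactification \<alpha> \<beta> Cs Sn X" and ?D = "r t powi weight_degree \<alpha> \<beta> X"
  define C S \<rho> where "C = Cs (\<theta> t)" and "S = Sn (\<theta> t)" and "\<rho> = r t"
  define L where "L = (\<lambda>(u, v). (- (S ^ (2 * \<alpha> - 1)) / \<rho> ^ \<alpha> * u - real \<alpha> * C / \<rho> ^ (\<alpha> + 1) * v,
                C ^ (2 * \<beta> - 1) / \<rho> ^ \<beta> * u - real \<beta> * S / \<rho> ^ (\<beta> + 1) * v))"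
  have der: "(pl_chart \<alpha> \<beta> Cs Sn has_derivative L) (at (\<theta> t, r t))"
    unfolding L_def C_def S_def \<rho>_def by (rule pl_chart_has_derivative[OF trig r_pos pos])
  have lin: "linear L" by (rule has_derivative_linear[OF der])
  have push: "L (?F (\<theta> t, r t)) = ?D *\<^sub>R vf X (x t, y t)"
    using pl_compactification_pushforward[OF trig pos X r_pos, of "\<theta> t"] xy[of t]
    by (simp flip: frechet_derivative_at[OF der])
  have "((\<lambda>t. (\<theta> t, r t)) has_derivative (\<lambda>h. h *\<^sub>R (\<theta>', r'))) (at t)"
    using has_derivative_Pair[OF \<theta>[unfolded has_field_derivative_def] r[unfolded has_field_derivative_def]]
    by (simp add: mult.commute)
  from has_derivative_compose[OF this der]
  have "((\<lambda>t. (x t, y t)) has_derivative (\<lambda>h. L (h *\<^sub>R (\<theta>', r')))) (at t)"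
    by (simp add: xy)
  moreover have "((\<lambda>t. (x t, y t)) has_derivative (\<lambda>h. h *\<^sub>R (l *\<^sub>R vf X (x t, y t)))) (at t)"
    using has_derivative_Pair[OF x[unfolded has_field_derivative_def] y[unfolded has_field_derivative_def]]
    by (simp add: mult_ac scaleR_prod_def)
  ultimately have "(\<lambda>h. L (h *\<^sub>R (\<theta>', r'))) = (\<lambda>h. h *\<^sub>R (l *\<^sub>R vf X (x t, y t)))"
    by (rule has_derivative_unique)
  then have "L (1 *\<^sub>R (\<theta>', r')) = 1 *\<^sub>R (l *\<^sub>R vf X (x t, y t))" by metis
  then have "L (?D *\<^sub>R (\<theta>', r')) = L (l *\<^sub>R ?F (\<theta> t, r t))"
    by (simp only: linear_cmul[OF lin] push scaleR_one scaleR_left_commute)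
  then have zero: "L (?D *\<^sub>R (\<theta>', r') - l *\<^sub>R ?F (\<theta> t, r t)) = 0"
    by (simp only: linear_diff[OF lin]) simp
  \<comment> \<open>The determinant of \<open>L\<close> is, up to a positive factor, the conserved
    quantity in \<open>CS\<close>; the two identities isolate \<open>v\<close> and then
    \<open>u\<close>.\<close>
  have inj: "u = 0 \<and> v = 0" if "L (u, v) = 0" for u v
  proof -
    have \<rho>: "0 < \<rho>" using r_pos by (simp add: \<rho>_def)
    have E1: "S ^ (2 * \<alpha> - 1) * (\<rho> * u) + real \<alpha> * C * v = 0"
      and E2: "C ^ (2 * \<beta> - 1) * (\<rho> * u) - real \<beta> * S * v = 0"
      using that \<rho> by (simp_all add: L_def zero_prod_def field_simps)
    have CS: "real \<alpha> * (C * C ^ (2 * \<beta> - 1)) + real \<beta> * (S * S ^ (2 * \<alpha> - 1)) = real \<alpha>"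
      using pl_trig_conserved[OF trig pos, of "\<theta> t"] pos by (simp add: C_def S_def flip: power_Suc)
    have "(real \<alpha> * (C * C ^ (2 * \<beta> - 1)) + real \<beta> * (S * S ^ (2 * \<alpha> - 1))) * v =
        C ^ (2 * \<beta> - 1) * (S ^ (2 * \<alpha> - 1) * (\<rho> * u) + real \<alpha> * C * v) -
        S ^ (2 * \<alpha> - 1) * (C ^ (2 * \<beta> - 1) * (\<rho> * u) - real \<beta> * S * v)"
      by (simp add: algebra_simps)
    then have "v = 0" unfolding CS E1 E2 using pos by simp
    have "(real \<alpha> * (C * C ^ (2 * \<beta> - 1)) + real \<beta> * (S * S ^ (2 * \<alpha> - 1))) * (\<rho> * u) =
        real \<beta> * S * (S ^ (2 * \<alpha> - 1) * (\<rho> * u) + real \<alpha> * C * v) +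
        real \<alpha> * C * (C ^ (2 * \<beta> - 1) * (\<rho> * u) - real \<beta> * S * v)"
      by (simp add: algebra_simps)
    then have "u = 0" unfolding CS E1 E2 using pos \<rho> by simp
    with \<open>v = 0\<close> show ?thesis by simp
  qed
  obtain u v where uv: "?D *\<^sub>R (\<theta>', r') - l *\<^sub>R ?F (\<theta> t, r t) = (u, v)" by force
  then have "(u, v) = 0" using inj[of u v] zero by (simp add: zero_prod_def)
  then show ?thesis using uv by simp
qed

context weighted_vf
begin

text \<open>The curve \<open>\<sigma> = F(\<phi>) + s0\<close> is closed and invariant, and a large
  \<open>s0\<close> puts it into the given neighbourhood. It is parametrised by its angle, carried
  to the disk by \<open>pl_chart_lift\<close>, and only then reparametrised into a solution of the
  compactified field.\<close>

lemma not_free_if_center: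
  assumes trig: "pl_trig \<alpha> \<beta> Cs Sn T" and pos: "\<alpha> > 0" "\<beta> > 0"
    and ang: "\<And>x. angular x \<noteq> 0" and F: "\<And>x. (F has_real_derivative radial x / angular x) (at x)"
    and F_per: "\<And>x. F (x + 2 * pi) = F x"
  shows "\<not> free_of_periodic_orbits \<alpha> \<beta> Cs Sn T Y"
proof
  assume "free_of_periodic_orbits \<alpha> \<beta> Cs Sn T Y"
  then obtain W where W: "boundary_neighbourhood T W"
    and free: "\<And>c. periodic_orbit T (pl_compactification \<alpha> \<beta> Cs Sn Y) c \<Longrightarrow> lifted_orbit T c \<subseteq> W \<Longrightarrow>
      lifted_orbit T c = boundary_circle"
    unfolding free_of_periodic_orbits_def by blast
  have T: "0 < T" using trig by (simp add: pl_trig_def common_period_def)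
  obtain r1 where r1: "0 < r1" "UNIV \<times> {0..<r1} \<subseteq> W" using boundary_neighbourhood_strip[OF W T] by blast
  \<comment> \<open>If \<open>r \<ge> r1\<close>, the conservation law bounds the polynomial in
    \<open>x\<close> and \<open>y\<close> by \<open>N\<close>; with \<open>N \<ge> 1\<close> this
    bounds \<open>\<bar>x\<bar>\<close> and \<open>\<bar>y\<bar>\<close> by \<open>N\<close>
    too.\<close>
  define N where "N = max 1 (real \<alpha> / r1 ^ (2 * \<alpha> * \<beta>))"
  have N: "1 \<le> N" "real \<alpha> / r1 ^ (2 * \<alpha> * \<beta>) \<le> N" by (simp_all add: N_def)
  obtain b where b: "\<And>x. F b \<le> F x"
    using periodic_attains_inf[OF DERIV_continuous_on_all[OF F] F_per] by auto
  \<comment> \<open>Each logarithmic term alone makes one exponential exceed \<open>2 * N\<close>;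
    both are nonnegative, so their sum serves for both, and the minimum \<open>F b\<close> is
    compensated.\<close>
  define s0 where "s0 = ln (2 * N + 1) / A + ln (2 * N + 1) / B - F b"
  define \<sigma> where "\<sigma> x = F x + s0" for x
  have \<sigma>: "(\<sigma> has_real_derivative radial x / angular x) (at x)" for x
    unfolding \<sigma>_def by (auto intro!: derivative_eq_intros F)
  have \<sigma>_per: "\<sigma> (x + 2 * pi) = \<sigma> x" for x by (simp add: \<sigma>_def F_per)
  have exp_large: "2 * N < exp (A * \<sigma> x)" "2 * N < exp (B * \<sigma> x)" for x
  proof -
    have ge: "2 * N < exp (c * s)" if "0 < c" "ln (2 * N + 1) / c \<le> s" for c s :: real
    proof -
      have "ln (2 * N + 1) \<le> c * s" using that by (simp add: field_simps)
      then have "exp (ln (2 * N + 1)) \<le> exp (c * s)" by simp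
      then show ?thesis using N by simp
    qed
    have "0 \<le> ln (2 * N + 1) / A" "0 \<le> ln (2 * N + 1) / B" using N A B by simp_all
    then have "ln (2 * N + 1) / A \<le> \<sigma> x" "ln (2 * N + 1) / B \<le> \<sigma> x"
      using b[of x] by (simp_all add: \<sigma>_def s0_def)
    then show "2 * N < exp (A * \<sigma> x)" "2 * N < exp (B * \<sigma> x)" using ge A B by blast+
  qed
  define x where "x t = exp (A * \<sigma> t) * cos t" for t
  define y where "y t = exp (B * \<sigma> t) * sin t" for t
  \<comment> \<open>The planar time per unit of angle: on this curve the angle moves with speed
    \<open>exp (d * \<sigma>) * angular / weight\<close>. It is negative when \<open>angular\<close>
    is.\<close>
  define l where "l t = weight t / angular t * exp (- (d * \<sigma> t))" for t
  define x' where "x' t = l t * fst (vf Y (x t, y t))" for t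
  define y' where "y' t = l t * snd (vf Y (x t, y t))" for t
  have e: "exp (- (d * \<sigma> t)) * exp ((d + c) * \<sigma> t) = exp (c * \<sigma> t)" for c t
    by (simp add: algebra_simps flip: exp_add)
  have dx: "(x has_real_derivative x' t) (at t)" for t
  proof -
    have "x' t = exp (- (d * \<sigma> t)) * exp ((d + A) * \<sigma> t) * (weight t * fst (vf Y (cos t, sin t))) / angular t"
      unfolding x'_def x_def y_def vf_Y_quasihomogeneous l_def by simp
    also have "\<dots> = exp (A * \<sigma> t) * (A * cos t * radial t - sin t * angular t) / angular t"
      unfolding e weight_mult_vf ..
    finally have x': "x' t = exp (A * \<sigma> t) * (A * cos t * radial t - sin t * angular t) / angular t" .
    show ?thesis
      unfolding x' unfolding x_def
      by (rule derivative_eq_intros \<sigma> refl)+ (use ang[of t] in \<open>simp add: field_simps\<close>)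
  qed
  have dy: "(y has_real_derivative y' t) (at t)" for t
  proof -
    have "y' t = exp (- (d * \<sigma> t)) * exp ((d + B) * \<sigma> t) * (weight t * snd (vf Y (cos t, sin t))) / angular t"
      unfolding y'_def x_def y_def vf_Y_quasihomogeneous l_def by simp
    also have "\<dots> = exp (B * \<sigma> t) * (B * sin t * radial t + cos t * angular t) / angular t"
      unfolding e weight_mult_vf ..
    finally have y': "y' t = exp (B * \<sigma> t) * (B * sin t * radial t + cos t * angular t) / angular t" .
    show ?thesis
      unfolding y' unfolding y_def
      by (rule derivative_eq_intros \<sigma> refl)+ (use ang[of t] in \<open>simp add: field_simps\<close>)
  qed
  note cxy = DERIV_continuous_on_all[OF dx] DERIV_continuous_on_all[OF dy] DERIV_continuous_on_all[OF \<sigma>]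
  obtain g' where g': "\<And>x. (angular has_real_derivative g' x) (at x)" using angular_differentiable by blast
  note cang = DERIV_continuous_on_all[OF g']
  have l_cont: "continuous_on UNIV l"
    unfolding l_def using ang by (intro continuous_intros continuous_on_weight cang cxy) auto
  have l_nz: "l t \<noteq> 0" for t using ang[of t] weight_pos[of t] by (simp add: l_def)
  have cont: "continuous_on UNIV x'" "continuous_on UNIV y'"
    unfolding x'_def y'_def fst_vf snd_vf by (intro continuous_intros l_cont cxy)+
  have nz: "(x t, y t) \<noteq> (0, 0)" for t
  proof
    assume "(x t, y t) = (0, 0)"
    then have zero: "cos t = 0" "sin t = 0" by (simp_all add: x_def y_def)
    show False using sin_cos_squared_add[of t] unfolding zero by simp
  qed
  have init: "0 < x 0" "y 0 = 0" by (simp_all add: x_def y_def)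
  obtain \<theta> \<theta>' r r' where \<theta>: "\<And>t. (\<theta> has_real_derivative \<theta>' t) (at t)"
    and r: "\<And>t. (r has_real_derivative r' t) (at t)" and r_pos: "\<And>t. 0 < r t"
    and chart: "\<And>t. pl_chart \<alpha> \<beta> Cs Sn (\<theta> t, r t) = (x t, y t)"
    using pl_chart_lift[OF trig pos dx dy cont nz init] by blast
  note cons = pl_chart_conserved[OF trig pos r_pos chart]
  \<comment> \<open>Otherwise \<open>\<bar>x\<bar>\<close> and \<open>\<bar>y\<bar>\<close> are at
    most \<open>N\<close> while the exponentials exceed \<open>2 * N\<close>, so cosine and sine
    would both be below 1/2 in absolute value.\<close>
  have r_less: "r t < r1" for t
  proof (rule ccontr)
    assume "\<not> r t < r1"
    define H where "H = real \<alpha> * x t ^ (2 * \<beta>) + real \<beta> * y t ^ (2 * \<alpha>)"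
    have nonneg: "0 \<le> real \<alpha> * x t ^ (2 * \<beta>)" "0 \<le> real \<beta> * y t ^ (2 * \<alpha>)" by simp_all
    then have "0 \<le> H" by (simp add: H_def)
    then have "H * r1 ^ (2 * \<alpha> * \<beta>) \<le> H * r t ^ (2 * \<alpha> * \<beta>)"
      using \<open>\<not> r t < r1\<close> r1(1) by (intro mult_left_mono power_mono) auto
    then have "H \<le> real \<alpha> / r1 ^ (2 * \<alpha> * \<beta>)"
      using cons[of t] r1(1) by (simp add: H_def field_simps)
    then have "H \<le> N" using N(2) by linarith
    moreover have "1 * x t ^ (2 * \<beta>) \<le> real \<alpha> * x t ^ (2 * \<beta>)" "1 * y t ^ (2 * \<alpha>) \<le> real \<beta> * y t ^ (2 * \<alpha>)"
      using pos by (intro mult_right_mono; auto)+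
    ultimately have "x t ^ (2 * \<beta>) \<le> N" "y t ^ (2 * \<alpha>) \<le> N"
      using nonneg unfolding H_def by linarith+
    moreover have le: "\<bar>z\<bar> \<le> N" if "z ^ (2 * k) \<le> N" "0 < k" for z :: real and k :: nat
    proof (cases "1 \<le> \<bar>z\<bar>")
      case True
      have "\<bar>z\<bar> ^ 1 \<le> \<bar>z\<bar> ^ (2 * k)" using True that(2) by (intro power_increasing) auto
      then show ?thesis using that(1) by (simp add: power_mult)
    qed (use N in auto)
    ultimately have "\<bar>x t\<bar> \<le> N" "\<bar>y t\<bar> \<le> N" using pos by blast+
    moreover have small: "q\<^sup>2 < 1 / 4" if "\<bar>E * q\<bar> \<le> N" "2 * N < E" for E q :: real
    proof -
      have "0 < E" using that N by linarith
      then have "E * \<bar>q\<bar> \<le> N" using that by (simp add: abs_mult)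
      then have "E * \<bar>q\<bar> < E * (1 / 2)" using that by linarith
      then have "\<bar>q\<bar> < 1 / 2" by (simp only: mult_less_cancel_left_pos[OF \<open>0 < E\<close>])
      then have "\<bar>q\<bar>\<^sup>2 < (1 / 2)\<^sup>2" by (intro power_strict_mono) auto
      then show ?thesis by (simp add: power2_eq_square)
    qed
    ultimately have "(cos t)\<^sup>2 < 1 / 4" "(sin t)\<^sup>2 < 1 / 4"
      using exp_large[of t] unfolding x_def y_def by blast+
    then show False using sin_cos_squared_add[of t] by linarith
  qed
  have xy_per: "x (t + of_int j * (2 * pi)) = x t" "y (t + of_int j * (2 * pi)) = y t" for t j
    using quasiperiodic_shift[of x "2 * pi" 0] quasiperiodic_shift[of y "2 * pi" 0]
    by (simp_all add: x_def y_def \<sigma>_per)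
  have r_per: "r (t + of_int j * (2 * pi)) = r t" for t j
  proof (rule power_eq_imp_eq_base)
    let ?H = "real \<alpha> * x t ^ (2 * \<beta>) + real \<beta> * y t ^ (2 * \<alpha>)"
    have "?H * r (t + of_int j * (2 * pi)) ^ (2 * \<alpha> * \<beta>) = ?H * r t ^ (2 * \<alpha> * \<beta>)"
      using cons[of "t + of_int j * (2 * pi)"] cons[of t] by (simp only: xy_per)
    moreover have "?H \<noteq> 0" using cons[of t] pos by auto
    ultimately show "r (t + of_int j * (2 * pi)) ^ (2 * \<alpha> * \<beta>) = r t ^ (2 * \<alpha> * \<beta>)" by simp
  qed (use r_pos pos in \<open>auto intro: less_imp_le\<close>)
  define D where "D = weight_degree \<alpha> \<beta> Y"
  \<comment> \<open>The compactified field is \<open>r powi D\<close> times the planar one, and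
    under the latter the angle moves at speed \<open>1 / l\<close>.\<close>
  define \<Lambda> where "\<Lambda> t = r t powi D / l t" for t
  have "r t \<noteq> 0" for t using r_pos[of t] by simp
  then have \<Lambda>_cont: "continuous_on UNIV \<Lambda>"
    unfolding \<Lambda>_def using l_nz
    by (intro continuous_on_divide continuous_on_power_int DERIV_continuous_on_all[OF r] l_cont) auto
  have \<Lambda>_nz: "\<Lambda> t \<noteq> 0" for t using r_pos[of t] l_nz[of t] by (simp add: \<Lambda>_def)
  have \<Lambda>_per: "\<Lambda> (t + 2 * pi) = \<Lambda> t" for t
    using r_per[of t 1] by (simp add: \<Lambda>_def l_def weight_periodic angular_periodic \<sigma>_per)
  obtain \<psi> \<tau> and j :: int where \<psi>: "\<And>t. (\<psi> has_real_derivative \<Lambda> (\<psi> t)) (at t)" "0 < \<tau>"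
    "\<And>t. \<psi> (t + \<tau>) = \<psi> t + of_int j * (2 * pi)" "surj \<psi>"
    using ex_time_change[OF \<Lambda>_cont \<Lambda>_nz \<Lambda>_per] by auto
  define c where "c t = (\<theta> (\<psi> t), r (\<psi> t))" for t
  let ?F = "pl_compactification \<alpha> \<beta> Cs Sn Y"
  have c_deriv: "(c has_vector_derivative ?F (c t)) (at t)" for t
  proof -
    have "((\<lambda>t. \<theta> (\<psi> t)) has_vector_derivative \<theta>' (\<psi> t) * \<Lambda> (\<psi> t)) (at t)"
      "((\<lambda>t. r (\<psi> t)) has_vector_derivative r' (\<psi> t) * \<Lambda> (\<psi> t)) (at t)"
      using DERIV_chain2[OF \<theta> \<psi>(1)] DERIV_chain2[OF r \<psi>(1)]
      by (simp_all add: has_real_derivative_iff_has_vector_derivative)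
    then have "(c has_vector_derivative (\<theta>' (\<psi> t) * \<Lambda> (\<psi> t), r' (\<psi> t) * \<Lambda> (\<psi> t))) (at t)"
      unfolding c_def by (rule has_vector_derivative_Pair)
    also have "(\<theta>' (\<psi> t) * \<Lambda> (\<psi> t), r' (\<psi> t) * \<Lambda> (\<psi> t)) =
        (1 / l (\<psi> t)) *\<^sub>R ((r (\<psi> t) powi D) *\<^sub>R (\<theta>' (\<psi> t), r' (\<psi> t)))"
      by (simp add: \<Lambda>_def mult_ac)
    also have "(r (\<psi> t) powi D) *\<^sub>R (\<theta>' (\<psi> t), r' (\<psi> t)) = l (\<psi> t) *\<^sub>R ?F (c t)"
      unfolding D_def c_def
      by (rule pl_chart_velocity[OF trig pos poly_Y \<theta> r r_pos chart dx[unfolded x'_def] dy[unfolded y'_def]])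
    also have "(1 / l (\<psi> t)) *\<^sub>R (l (\<psi> t) *\<^sub>R ?F (c t)) = ?F (c t)" using l_nz by simp
    finally show ?thesis .
  qed
  have "solves ?F c UNIV"
    using c_deriv r_pos by (auto simp: solves_def c_def intro: less_imp_le)
  moreover have "\<not> c constant_on UNIV"
  proof
    assume "c constant_on UNIV"
    then obtain z where z: "\<And>t. c t = z" by (auto simp: constant_on_def)
    have "(x s, y s) = pl_chart \<alpha> \<beta> Cs Sn z" for s
    proof -
      obtain t where "s = \<psi> t" using \<psi>(4) by blast
      then show ?thesis using chart[of s] z[of t] by (simp add: c_def)
    qed
    then have "x 0 = x (pi / 2)" by (metis prod.inject)
    then show False using init by (simp add: x_def)
  qed
  moreover have "\<exists>k. c (t + \<tau>) = c t + (of_int k * T, 0)" for t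
  proof -
    let ?s = "\<psi> t + of_int j * (2 * pi)"
    have "Cs (\<theta> s) = x s * r s ^ \<alpha> \<and> Sn (\<theta> s) = y s * r s ^ \<beta>" for s
      using chart[of s] r_pos[of s] by (simp add: pl_chart_def field_simps)
    then have "Cs (\<theta> ?s) = Cs (\<theta> (\<psi> t))" "Sn (\<theta> ?s) = Sn (\<theta> (\<psi> t))"
      by (simp_all only: xy_per r_per)
    then obtain k :: int where "\<theta> ?s = \<theta> (\<psi> t) + of_int k * T" using pl_trig_eq_imp[OF trig pos] by blast
    then show ?thesis by (intro exI[of _ k]) (simp add: c_def \<psi>(3) r_per)
  qed
  ultimately have orb: "periodic_orbit T ?F c" using \<psi>(2) unfolding periodic_orbit_def by blast
  have "lifted_orbit T c \<subseteq> W"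
  proof
    fix z assume "z \<in> lifted_orbit T c"
    then obtain t k where "z = (\<theta> (\<psi> t) + of_int k * T, r (\<psi> t))"
      by (auto simp: lifted_orbit_def c_def)
    moreover have "(\<theta> (\<psi> t) + of_int k * T, r (\<psi> t)) \<in> UNIV \<times> {0..<r1}"
      using r_pos[of "\<psi> t"] r_less[of "\<psi> t"] by simp
    ultimately show "z \<in> W" using r1(2) by blast
  qed
  from free[OF orb this] have "lifted_orbit T c = boundary_circle" .
  moreover have "c 0 + (of_int 0 * T, 0) \<in> lifted_orbit T c" unfolding lifted_orbit_def by blast
  ultimately show False using r_pos[of "\<psi> 0"] by (auto simp: boundary_circle_def c_def)
qed

end

theorem theorem2:
  fixes \<alpha> \<beta> :: nat and Cs Sn :: "real \<Rightarrow> real" and T :: real and X :: vf_coeffs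
  assumes "\<alpha> > 0" and "\<beta> > 0"
    and "pl_trig \<alpha> \<beta> Cs Sn T"
    and "polynomial_vf X"
    and "free_of_characteristic_orbits \<alpha> \<beta> Cs Sn X"
    and "\<exists>p q. p \<noteq> q \<and> upper_boundary X = closed_segment p q"
    and "{z. vf (upper_principal_part X) z = 0} = {0}"
    and "free_of_periodic_orbits \<alpha> \<beta> Cs Sn T (upper_principal_part X)"
  shows "free_of_periodic_orbits \<alpha> \<beta> Cs Sn T X"
proof (cases "interior (newton_polytope X) = {}")
  case True
  have "upper_principal_part X p = X p" for p
  proof (cases "p \<in> supp X")
    case True
    then have "real_pt p \<in> newton_polytope X" unfolding newton_polytope_def by (intro hull_inc) auto
    then show ?thesis using \<open>interior (newton_polytope X) = {}\<close>
      by (simp add: upper_principal_part_def upper_boundary_def)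
  next
    case False
    then show ?thesis by (simp add: supp_def upper_principal_part_def prod_eq_iff sum_power2_eq_zero_iff)
  qed
  then have "upper_principal_part X = X" by blast
  then show ?thesis using assms(8) by simp
next
  case False
  have fin: "finite (supp X)" using assms(4) by (simp add: polynomial_vf_def)
  obtain p q where seg: "upper_boundary X = closed_segment p q" using assms(6) by blast
  obtain A B d :: real where AB: "0 < A" "0 < B"
    and weights: "\<And>m n. (m, n) \<in> supp X \<Longrightarrow>
      (if real_pt (m, n) \<in> upper_boundary X then A * of_int m + B * of_int n = d
       else A * of_int m + B * of_int n \<le> d - 1)"
    using upper_boundary_normal_gap[OF fin False seg] by blast
  interpret weighted_vf X A B d
  proof
    fix p assume p: "p \<in> supp X"
    obtain m n where mn: "p = (m, n)" by force
    show "real_pt p \<in> upper_boundary X \<Longrightarrow> A * of_int (fst p) + B * of_int (snd p) = d"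
      "real_pt p \<notin> upper_boundary X \<Longrightarrow> A * of_int (fst p) + B * of_int (snd p) \<le> d - 1"
      using weights[of m n] p by (auto simp: mn)
  qed (use assms(4) AB in auto)
  show ?thesis
    using not_free_if_center[OF assms(3,1,2)] assms(8)
    by (intro free_if_no_center[OF assms(3,1,2,7)]) blast
qed

end
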